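(* Let $P\subset\mathbb{R}^3$ be a polyhedron (not necessarily convex). If $P$ has an exposed face $F$ and some vertex of $F$ has degree more than $3$ in $P$, then $P$ can be perturbed so as to decrease the Melzak ratio: there is a perturbation $\{P_t\}_{t\in[0,\epsilon]}$ of $P$ with $m(P_t)<m(P)$ for all sufficiently small $t>0$.
   Context: A polyhedron is a compact solid region in $\mathbb{R}^3$ with nonempty interior bounded by finitely many planar polygonal faces. $e(P)$ is the total edge length of $P$, $v(P)$ its volume, and the Melzak ratio is $m(P)=e(P)^3/v(P)$. The degree of a vertex is the number of edges of $P$ meeting at it. A face $F$ of $P$ is exposed if it is contained in an open set $U_F$ such that $U_F\cap P$ is convex. A perturbation of $P$ is a one-parameter family $\{P_t\}_{t\in[0,\epsilon]}$ ($\epsilon>0$) of polyhedra with $P_0=P$ and $P_t\to P$ (in Hausdorff distance) as $t\to 0^+$. *)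

theory Defs
  imports "HOL-Analysis.Analysis"
begin

(* Every polygon, convex or not, is a finite union of convex polygons, so "bounded by finitely
   many planar polygons" can be said with two-dimensional convex polytopes.  These pieces need
   not be the faces of P.  The condition P = closure (interior P) is what "solid" means: no
   lower-dimensional parts are attached.  The library predicate polyhedron only covers
   convex sets. *)
definition solid_polyhedron :: "(real^3) set \<Rightarrow> bool" where
  "solid_polyhedron P \<longleftrightarrow>
     compact P \<and> interior P \<noteq> {} \<and> P = closure (interior P) \<and>
     (\<exists>\<F>. finite \<F> \<and> (\<forall>F\<in>\<F>. polytope F \<and> aff_dim F = 2) \<and> frontier P = \<Union>\<F>)"

(* The face structure is determined by the set P alone.  Adjacent coplanar pieces of the boundary
   belong to one face, so there are no artificial edges with dihedral angle pi. *)
definition flat_points :: "(real^3) set \<Rightarrow> (real^3) set" where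
  "flat_points P =
     {x. \<exists>a r. a \<noteq> 0 \<and> r > 0 \<and> P \<inter> ball x r = {y. a \<bullet> y \<le> a \<bullet> x} \<inter> ball x r}"

definition faces :: "(real^3) set \<Rightarrow> (real^3) set set" where
  "faces P = closure ` components (flat_points P)"

(* The union of all edges, including their end points. *)
definition skeleton :: "(real^3) set \<Rightarrow> (real^3) set" where
  "skeleton P = frontier P - flat_points P"

(* Points in the relative interior of an edge. *)
definition edge_points :: "(real^3) set \<Rightarrow> (real^3) set" where
  "edge_points P =
     {x. \<exists>d r. d \<noteq> 0 \<and> r > 0 \<and>
        skeleton P \<inter> ball x r = range (\<lambda>s. x + s *\<^sub>R d) \<inter> ball x r}"

definition edges :: "(real^3) set \<Rightarrow> (real^3) set set" where
  "edges P = closure ` components (edge_points P)"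

definition vertices :: "(real^3) set \<Rightarrow> (real^3) set" where
  "vertices P = skeleton P - edge_points P"

definition vertex_degree :: "(real^3) set \<Rightarrow> real^3 \<Rightarrow> nat" where
  "vertex_degree P x = card {e \<in> edges P. x \<in> e}"

(* Edges of a polyhedron are straight segments, so the diameter is the length. *)
definition total_edge_length :: "(real^3) set \<Rightarrow> real" where
  "total_edge_length P = (\<Sum>e\<in>edges P. diameter e)"

definition volume :: "(real^3) set \<Rightarrow> real" where
  "volume P = measure lebesgue P"

definition melzak_ratio :: "(real^3) set \<Rightarrow> real" where
  "melzak_ratio P = total_edge_length P ^ 3 / volume P"

definition exposed_face :: "(real^3) set \<Rightarrow> (real^3) set \<Rightarrow> bool" where
  "exposed_face P F \<longleftrightarrow> F \<in> faces P \<and> (\<exists>U. open U \<and> F \<subseteq> U \<and> convex (U \<inter> P))"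

(* Meaningful for nonempty bounded sets, where both suprema are finite. *)
definition hausdorff_dist :: "'a::metric_space set \<Rightarrow> 'a set \<Rightarrow> real" where
  "hausdorff_dist A B = max (SUP x\<in>A. infdist x B) (SUP y\<in>B. infdist y A)"

(* The values of Q outside the interval from 0 to \<epsilon> are irrelevant. *)
definition is_perturbation :: "(real^3) set \<Rightarrow> real \<Rightarrow> (real \<Rightarrow> (real^3) set) \<Rightarrow> bool" where
  "is_perturbation P \<epsilon> Q \<longleftrightarrow>
     \<epsilon> > 0 \<and> (\<forall>t\<in>{0..\<epsilon>}. solid_polyhedron (Q t)) \<and> Q 0 = P \<and>
     ((\<lambda>t. hausdorff_dist (Q t) P) \<longlongrightarrow> 0) (at_right 0)"

end

theory Submission imports Defs
begin

text \<open>Let \<open>n \<bullet> y = h\<close> be the plane of the exposed face \<open>F\<close>, with \<open>P\<close> below it near \<open>F\<close>.  There \<open>P\<close> is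
the part below this plane of a convex polyhedron \<open>K\<close> whose facets extend the side faces along \<open>F\<close>.
Replacing the height \<open>h\<close> by \<open>h + s\<close> in a neighbourhood of \<open>F\<close> gives a polyhedron \<open>pushed s\<close>, for
small \<open>s\<close> of either sign.  Its edge length \<open>E s\<close> has one-sided derivatives at 0, and these differ
if \<open>F\<close> has vertices of degree greater than 3.  The theorem follows from
\<open>E t + E (- t) \<le> 2 * E 0 - c * t\<close> with \<open>c > 0\<close>, for all small \<open>t > 0\<close>: the volumes
differ from that of \<open>P\<close> by at most a multiple of \<open>t\<close> and add up to at least twice it, up to an
error of order \<open>t\<^sup>2\<close>, so by the inequality of arithmetic and geometric means one of
\<open>pushed t\<close> and \<open>pushed (- t)\<close> has a smaller Melzak ratio than \<open>P\<close>
(\<open>one_push_improves_ratio\<close>).  The perturbation takes for every \<open>t\<close> a direction that works.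

For the inequality let \<open>U\<close> and \<open>D\<close> be the lengths of the edges of \<open>K\<close> at heights between \<open>h\<close> and
\<open>h + t\<close> and between \<open>h - t\<close> and \<open>h\<close>, and let \<open>p s\<close> be the perimeter of the section of \<open>K\<close> at height
\<open>h + s\<close>.  Cutting \<open>K\<close> at a height keeps the edges below it and adds the perimeter of the section, so
\<open>E t + E (- t) - 2 * E 0 = U - D + \<Delta>\<close> with \<open>\<Delta> = p t + p (- t) - 2 * p 0\<close>.  There are two reasons
for this to be negative.

\<^item> \<open>\<Delta> \<le> 0\<close> (\<open>perimeter_concave\<close>).  The perimeter of a convex polygon is, up to a constant, the
  mean of its widths over all directions, and the width of the sections of a convex body is a
  concave function of the height.

\<^item> \<open>2 * U + \<Delta> \<le> 2 * D\<close> (\<open>facet_inequality\<close>, summed over the facets of \<open>K\<close>; every edge lies in two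
  of them).  In one facet the horizontal section is a segment whose end points run along the edges
  of the facet.  For small \<open>t\<close> they move linearly on either side of the height \<open>h\<close>, and the
  triangle inequality compares their paths above and below \<open>h\<close> with the change of the section.

Adding the two and halving gives \<open>U - D + \<Delta> \<le> 0\<close>.  The second inequality is strict, by a multiple
of \<open>t\<close>, if some facet of \<open>K\<close> meets \<open>F\<close> in a single point, because its section at height \<open>h - t\<close> is
the third side of a triangle whose other two sides are edges of \<open>K\<close>.  If a vertex of \<open>F\<close> has
degree greater than 3, such a facet passes through it (\<open>many_edges_imp_tip\<close>): otherwise at most two
facets of \<open>K\<close> pass through the vertex, and together with the plane of \<open>F\<close> they bound at most three
edges.

The edges of a polyhedron are defined as closures of components of a set that is described
locally.  The link to lengths is \<open>total_edge_length_eq_len\<close>: the total edge length is the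
one-dimensional measure of the skeleton, hence additive over pieces of the skeleton, and only the
part of the skeleton near \<open>F\<close> has to be compared.  This rests on the fact that a polyhedron is a
union of cells of a finite arrangement of planes, and that every property defined by the shape of
the polyhedron near a point is constant on each cell.\<close>

section \<open>Cells of a plane arrangement\<close>

definition same_side :: "('a::euclidean_space \<times> real) set \<Rightarrow> 'a \<Rightarrow> 'a \<Rightarrow> bool" where
  "same_side H x y \<longleftrightarrow> (\<forall>(a,b)\<in>H. sgn (a \<bullet> x - b) = sgn (a \<bullet> y - b))"

definition cell :: "('a::euclidean_space \<times> real) set \<Rightarrow> 'a \<Rightarrow> 'a set" where
  "cell H x = {y. same_side H x y}"

definition arrangement :: "('a::euclidean_space \<times> real) set \<Rightarrow> bool" where
  "arrangement H \<longleftrightarrow> finite H \<and> (\<forall>(a,b)\<in>H. a \<noteq> 0)"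

definition union_of_cells :: "('a::euclidean_space \<times> real) set \<Rightarrow> 'a set \<Rightarrow> bool" where
  "union_of_cells H S \<longleftrightarrow> (\<forall>x y. same_side H x y \<longrightarrow> x \<in> S \<longrightarrow> y \<in> S)"

lemma same_side_refl: "same_side H x x"
  by (auto simp: same_side_def)

lemma same_side_sym: "same_side H x y \<Longrightarrow> same_side H y x"
  by (auto simp: same_side_def)

lemma same_side_trans: "same_side H x y \<Longrightarrow> same_side H y z \<Longrightarrow> same_side H x z"
  by (fastforce simp: same_side_def)

lemma same_side_mono: "same_side H x y \<Longrightarrow> G \<subseteq> H \<Longrightarrow> same_side G x y"
  by (auto simp: same_side_def)

lemma union_of_cells_mono: "union_of_cells G S \<Longrightarrow> G \<subseteq> H \<Longrightarrow> union_of_cells H S"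
  unfolding union_of_cells_def using same_side_mono by blast

lemma union_of_cells_Un: "union_of_cells H S \<Longrightarrow> union_of_cells H T \<Longrightarrow> union_of_cells H (S \<union> T)"
  and union_of_cells_Int: "union_of_cells H S \<Longrightarrow> union_of_cells H T \<Longrightarrow> union_of_cells H (S \<inter> T)"
  unfolding union_of_cells_def by blast+

lemma union_of_cells_Compl: "union_of_cells H S \<Longrightarrow> union_of_cells H (- S)"
  unfolding union_of_cells_def using same_side_sym by blast

lemma union_of_cells_Diff: "union_of_cells H S \<Longrightarrow> union_of_cells H T \<Longrightarrow> union_of_cells H (S - T)"
  by (simp add: Diff_eq union_of_cells_Compl union_of_cells_Int)

lemma union_of_cells_halfspace: "(a,b) \<in> H \<Longrightarrow> union_of_cells H {y. a \<bullet> y \<le> b}"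
  unfolding union_of_cells_def same_side_def
  by (force simp: sgn_if split: if_splits)

lemma union_of_cells_halfspace_ge: "(a,b) \<in> H \<Longrightarrow> union_of_cells H {y. a \<bullet> y \<ge> b}"
  unfolding union_of_cells_def same_side_def
  by (force simp: sgn_if split: if_splits)

lemma union_of_cells_Inter:
  "(\<And>S. S \<in> \<S> \<Longrightarrow> union_of_cells H S) \<Longrightarrow> union_of_cells H (\<Inter>\<S>)"
  unfolding union_of_cells_def by blast

lemma finite_cells:
  assumes "finite H" shows "finite (range (cell H))"
proof -
  define sig where "sig x = restrict (\<lambda>p. sgn (fst p \<bullet> x - snd p)) H" for x
  have "sig x \<in> H \<rightarrow>\<^sub>E {-1,0,1}" for x
    by (auto simp: sig_def sgn_if)
  then have "finite (range sig)"
    using finite_PiE[OF assms, of "\<lambda>_. {-1,0,1::real}"] by (meson finite.emptyI finite.insertI finite_subset image_subsetI)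
  moreover have "cell H x = {y. sig y = sig x}" for x
    unfolding cell_def same_side_def sig_def restrict_def fun_eq_iff by (auto split: prod.splits)
  then have "range (cell H) = (\<lambda>s. {y. sig y = s}) ` range sig"
    by (auto simp: image_image)
  ultimately show ?thesis by simp
qed

lemma convex_sgn: "convex {y::'a::euclidean_space. s = sgn (a \<bullet> y - b)}"
proof -
  consider "s = 1" | "s = 0" | "s = -1" | "s \<notin> {1,0,-1}" by blast
  then show ?thesis
  proof cases
    case 1
    then have "{y. s = sgn (a \<bullet> y - b)} = {y. a \<bullet> y > b}" by (auto simp: sgn_if)
    then show ?thesis by (simp add: convex_halfspace_gt)
  next
    case 2
    then have "{y. s = sgn (a \<bullet> y - b)} = {y. a \<bullet> y = b}" by (auto simp: sgn_if)
    then show ?thesis by (simp add: convex_hyperplane)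
  next
    case 3
    then have "{y. s = sgn (a \<bullet> y - b)} = {y. a \<bullet> y < b}" by (auto simp: sgn_if)
    then show ?thesis by (simp add: convex_halfspace_lt)
  next
    case 4
    then have "{y. s = sgn (a \<bullet> y - b)} = {}" by (auto simp: sgn_if)
    then show ?thesis by simp
  qed
qed

lemma cell_eq_Inter: "cell H x = (\<Inter>(a,b)\<in>H. {y. sgn (a \<bullet> x - b) = sgn (a \<bullet> y - b)})"
  by (auto simp: cell_def same_side_def)

lemma convex_cell: "convex (cell H x)"
  unfolding cell_eq_Inter by (intro convex_INT) (auto simp: convex_sgn)

lemma connected_cell: "connected (cell H x)"
  by (simp add: convex_cell convex_connected)

lemma mem_cell: "x \<in> cell H x"
  by (simp add: cell_def same_side_refl)

lemma cell_subset: "union_of_cells H S \<Longrightarrow> x \<in> S \<Longrightarrow> cell H x \<subseteq> S"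
  by (auto simp: union_of_cells_def cell_def)

text \<open>Near \<open>x\<close> the only planes that can be crossed are those through \<open>x\<close>.\<close>

lemma signs_near:
  fixes x :: "'a::euclidean_space"
  assumes "finite H"
  obtains r :: real where "r > 0"
    "\<And>(v::'a) a b. norm v < r \<Longrightarrow> (a,b) \<in> H \<Longrightarrow>
       sgn (a \<bullet> (x + v) - b) = (if a \<bullet> x = b then sgn (a \<bullet> v) else sgn (a \<bullet> x - b))"
proof -
  have "eventually (\<lambda>y. \<forall>p\<in>H. fst p \<bullet> x \<noteq> snd p \<longrightarrow> sgn (fst p \<bullet> y - snd p) = sgn (fst p \<bullet> x - snd p)) (nhds x)"
  proof (rule eventually_ball_finite[OF assms], intro ballI)
    fix p assume "p \<in> H"
    have t: "((\<lambda>y. fst p \<bullet> y - snd p) \<longlongrightarrow> fst p \<bullet> x - snd p) (nhds x)"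
      by (intro tendsto_intros filterlim_ident)
    show "eventually (\<lambda>y. fst p \<bullet> x \<noteq> snd p \<longrightarrow> sgn (fst p \<bullet> y - snd p) = sgn (fst p \<bullet> x - snd p)) (nhds x)"
    proof (cases "fst p \<bullet> x - snd p" "0::real" rule: linorder_cases)
      case less
      then show ?thesis using order_tendstoD(2)[OF t less] by (auto elim!: eventually_mono simp: sgn_if)
    next
      case greater
      then show ?thesis using order_tendstoD(1)[OF t greater] by (auto elim!: eventually_mono simp: sgn_if)
    qed auto
  qed
  then obtain r where r: "r > 0" "\<And>y. dist y x < r \<Longrightarrow> \<forall>p\<in>H. fst p \<bullet> x \<noteq> snd p \<longrightarrow> sgn (fst p \<bullet> y - snd p) = sgn (fst p \<bullet> x - snd p)"
    unfolding eventually_nhds_metric by blast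
  show ?thesis
  proof (rule that[OF r(1)])
    fix v :: 'a and a b assume "norm v < r" "(a,b) \<in> H"
    then show "sgn (a \<bullet> (x + v) - b) = (if a \<bullet> x = b then sgn (a \<bullet> v) else sgn (a \<bullet> x - b))"
      using r(2)[of "x+v"] by (force simp: inner_add_right dist_norm)
  qed
qed

section \<open>Germs of sets\<close>

text \<open>Up to a translation, \<open>S\<close> looks near \<open>x\<close> like \<open>T\<close> near \<open>y\<close>.  Flat points, skeletons and edge points are
determined by germs, so that statements about them can be transported between the points of a cell
and between sets that agree on an open set.\<close>

definition germ_eq :: "'a::real_normed_vector set \<Rightarrow> 'a \<Rightarrow> 'a set \<Rightarrow> 'a \<Rightarrow> bool" where
  "germ_eq S x T y \<longleftrightarrow> (\<exists>r>0. \<forall>v. norm v < r \<longrightarrow> (x + v \<in> S \<longleftrightarrow> y + v \<in> T))"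

lemma germ_eq_sym: "germ_eq S x T y \<Longrightarrow> germ_eq T y S x"
  unfolding germ_eq_def by metis

lemma germ_eq_Compl: "germ_eq S x T y \<Longrightarrow> germ_eq (-S) x (-T) y"
  unfolding germ_eq_def by simp

lemma germ_eq_mem: "germ_eq S x T y \<Longrightarrow> x \<in> S \<longleftrightarrow> y \<in> T"
  unfolding germ_eq_def by (metis add.right_neutral norm_zero)

lemma germ_eq_move:
  assumes "germ_eq S x T y"
  obtains r where "r > 0" "\<And>v. norm v < r \<Longrightarrow> germ_eq S (x + v) T (y + v)"
proof -
  obtain r where r: "r > 0" "\<And>v. norm v < r \<Longrightarrow> (x + v \<in> S \<longleftrightarrow> y + v \<in> T)"
    using assms unfolding germ_eq_def by blast
  show ?thesis
  proof (rule that[OF r(1)])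
    fix v :: 'a assume v: "norm v < r"
    show "germ_eq S (x + v) T (y + v)"
      unfolding germ_eq_def
    proof (intro exI[of _ "r - norm v"] conjI allI impI)
      fix w :: 'a assume "norm w < r - norm v"
      then have "norm (v + w) < r" using norm_triangle_ineq[of v w] by linarith
      then show "(x + v + w \<in> S) = (y + v + w \<in> T)" using r(2)[of "v+w"] by (simp add: add.assoc)
    qed (use v in auto)
  qed
qed

lemma germ_eq_local:
  assumes "\<And>S x T y. germ_eq S x T y \<Longrightarrow> x \<in> f S \<Longrightarrow> y \<in> f T" and "germ_eq S x T y"
  shows "germ_eq (f S) x (f T) y"
proof -
  obtain r where "r > 0" "\<And>v. norm v < r \<Longrightarrow> germ_eq S (x + v) T (y + v)"
    using assms(2) germ_eq_move by blast
  then show ?thesis unfolding germ_eq_def[of "f S"] using assms(1) germ_eq_sym by blast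
qed

lemma germ_eq_open:
  assumes "open W" "S \<inter> W = T \<inter> W" "x \<in> W" shows "germ_eq S x T x"
proof -
  obtain r where "r > 0" "ball x r \<subseteq> W" using assms(1,3) open_contains_ball by blast
  moreover have "x + v \<in> ball x r" if "norm v < r" for v using that by (simp add: dist_norm)
  ultimately show ?thesis unfolding germ_eq_def using assms(2) by blast
qed

lemma ball_translate: "P \<inter> ball x r = Q \<inter> ball x r \<longleftrightarrow> (\<forall>v. norm v < r \<longrightarrow> (x + v \<in> P \<longleftrightarrow> x + v \<in> Q))"
  for x :: "'a::real_normed_vector"
proof
  assume *: "P \<inter> ball x r = Q \<inter> ball x r"
  have "x + v \<in> ball x r" if "norm v < r" for v using that by (simp add: dist_norm)
  then show "\<forall>v. norm v < r \<longrightarrow> (x + v \<in> P \<longleftrightarrow> x + v \<in> Q)" using * by blast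
next
  assume *: "\<forall>v. norm v < r \<longrightarrow> (x + v \<in> P \<longleftrightarrow> x + v \<in> Q)"
  have "y \<in> P \<longleftrightarrow> y \<in> Q" if "y \<in> ball x r" for y
    using *[rule_format, of "y - x"] that by (simp add: dist_norm norm_minus_commute)
  then show "P \<inter> ball x r = Q \<inter> ball x r" by blast
qed

lemma mem_interior_translate: "x \<in> interior S \<longleftrightarrow> (\<exists>r>0. \<forall>v. norm v < r \<longrightarrow> x + v \<in> S)"
  for x :: "'a::real_normed_vector"
proof -
  have "x \<in> interior S \<longleftrightarrow> (\<exists>r>0. S \<inter> ball x r = UNIV \<inter> ball x r)"
    unfolding mem_interior by blast
  then show ?thesis unfolding ball_translate by simp
qed

lemma germ_eq_interior: "germ_eq S x T y \<Longrightarrow> x \<in> interior S \<Longrightarrow> y \<in> interior T"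
  unfolding mem_interior_translate germ_eq_def
proof -
  assume "\<exists>r>0. \<forall>v. norm v < r \<longrightarrow> (x + v \<in> S) = (y + v \<in> T)" "\<exists>r>0. \<forall>v. norm v < r \<longrightarrow> x + v \<in> S"
  then obtain r r' where "r > 0" "r' > 0" "\<forall>v. norm v < r \<longrightarrow> (x + v \<in> S) = (y + v \<in> T)" "\<forall>v. norm v < r' \<longrightarrow> x + v \<in> S" by blast
  then show "\<exists>r>0. \<forall>v. norm v < r \<longrightarrow> y + v \<in> T" by (intro exI[of _ "min r r'"]) auto
qed

lemma germ_eq_closure: "germ_eq S x T y \<Longrightarrow> x \<in> closure S \<Longrightarrow> y \<in> closure T"
  unfolding closure_interior using germ_eq_interior germ_eq_Compl germ_eq_sym by (metis ComplD ComplI)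

lemma germ_eq_frontier: "germ_eq S x T y \<Longrightarrow> x \<in> frontier S \<Longrightarrow> y \<in> frontier T"
  unfolding frontier_def using germ_eq_closure germ_eq_interior germ_eq_sym by blast

lemma mem_flat_points: "x \<in> flat_points P \<longleftrightarrow> (\<exists>a r. a \<noteq> 0 \<and> r > 0 \<and> (\<forall>v. norm v < r \<longrightarrow> (x + v \<in> P \<longleftrightarrow> a \<bullet> v \<le> 0)))"
  unfolding flat_points_def ball_translate by (simp add: inner_add_right)

lemma germ_eq_flat_points:
  assumes "germ_eq S x T y" "x \<in> flat_points S" shows "y \<in> flat_points T"
proof -
  obtain r r' a where "r > 0" "r' > 0" "a \<noteq> 0" "\<forall>v. norm v < r \<longrightarrow> (x + v \<in> S) = (y + v \<in> T)" "\<forall>v. norm v < r' \<longrightarrow> (x + v \<in> S \<longleftrightarrow> a \<bullet> v \<le> 0)"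
    using assms unfolding mem_flat_points germ_eq_def by blast
  then show ?thesis unfolding mem_flat_points by (intro exI[of _ a] exI[of _ "min r r'"]) auto
qed

lemma germ_eq_skeleton: "germ_eq S x T y \<Longrightarrow> x \<in> skeleton S \<Longrightarrow> y \<in> skeleton T"
  unfolding skeleton_def using germ_eq_flat_points germ_eq_frontier germ_eq_sym by blast

lemma mem_edge_points: "x \<in> edge_points P \<longleftrightarrow> (\<exists>d r. d \<noteq> 0 \<and> r > 0 \<and> (\<forall>v. norm v < r \<longrightarrow> (x + v \<in> skeleton P \<longleftrightarrow> v \<in> range (\<lambda>s. s *\<^sub>R d))))"
  unfolding edge_points_def ball_translate by (simp add: image_iff)

lemma germ_eq_edge_points:
  assumes "germ_eq S x T y" "x \<in> edge_points S" shows "y \<in> edge_points T"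
proof -
  have "germ_eq (skeleton S) x (skeleton T) y"
    using germ_eq_local[where f=skeleton] germ_eq_skeleton assms(1) by blast
  then obtain r r' d where "r > 0" "r' > 0" "d \<noteq> 0" "\<forall>v. norm v < r \<longrightarrow> (x + v \<in> skeleton S) = (y + v \<in> skeleton T)"
      "\<forall>v. norm v < r' \<longrightarrow> (x + v \<in> skeleton S \<longleftrightarrow> v \<in> range (\<lambda>s. s *\<^sub>R d))"
    using assms(2) unfolding mem_edge_points germ_eq_def by blast
  then show ?thesis unfolding mem_edge_points by (intro exI[of _ d] exI[of _ "min r r'"]) auto
qed

lemma local_eq_on_open:
  assumes "\<And>S x T y. germ_eq S x T y \<Longrightarrow> x \<in> f S \<Longrightarrow> y \<in> f T"
    and "open W" "S \<inter> W = T \<inter> W"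
  shows "f S \<inter> W = f T \<inter> W"
proof -
  have "x \<in> f S \<longleftrightarrow> x \<in> f T" if "x \<in> W" for x
    using germ_eq_open[OF assms(2,3) that] assms(1) germ_eq_sym by blast
  then show ?thesis by blast
qed

text \<open>Planes that miss \<open>x\<close> and \<open>y\<close> stay on their side after a small displacement \<open>v\<close>; a plane through \<open>x\<close>
also passes through \<open>y\<close>, and the side of \<open>x + v\<close> and \<open>y + v\<close> depends on \<open>v\<close> alone.\<close>

lemma same_side_germ_eq:
  assumes "finite H" "union_of_cells H S" "same_side H x y" shows "germ_eq S x S y"
proof -
  obtain r where r: "r > 0" "\<And>v a b. norm v < r \<Longrightarrow> (a,b) \<in> H \<Longrightarrow>
       sgn (a \<bullet> (x + v) - b) = (if a \<bullet> x = b then sgn (a \<bullet> v) else sgn (a \<bullet> x - b))"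
    using signs_near[OF assms(1)] by blast
  obtain r' where r': "r' > 0" "\<And>v a b. norm v < r' \<Longrightarrow> (a,b) \<in> H \<Longrightarrow>
       sgn (a \<bullet> (y + v) - b) = (if a \<bullet> y = b then sgn (a \<bullet> v) else sgn (a \<bullet> y - b))"
    using signs_near[OF assms(1)] by blast
  have eq: "a \<bullet> x = b \<longleftrightarrow> a \<bullet> y = b" "sgn (a \<bullet> x - b) = sgn (a \<bullet> y - b)" if "(a,b) \<in> H" for a b
  proof -
    show *: "sgn (a \<bullet> x - b) = sgn (a \<bullet> y - b)"
      using assms(3) that by (auto simp: same_side_def)
    show "a \<bullet> x = b \<longleftrightarrow> a \<bullet> y = b"
      using * by (auto simp: sgn_if split: if_splits)
  qed
  have "same_side H (x+v) (y+v)" if "norm v < min r r'" for v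
    unfolding same_side_def using that r(2)[of v] r'(2)[of v] eq by auto
  then show ?thesis
    unfolding germ_eq_def using r(1) r'(1) assms(2) same_side_sym unfolding union_of_cells_def
    by (intro exI[of _ "min r r'"]) (simp, blast)
qed

lemma union_of_cells_local:
  assumes "\<And>S x T y. germ_eq S x T y \<Longrightarrow> x \<in> f S \<Longrightarrow> y \<in> f T" "finite H" "union_of_cells H S"
  shows "union_of_cells H (f S)"
  unfolding union_of_cells_def using same_side_germ_eq assms by blast

section \<open>Polyhedra as unions of cells\<close>

lemma polyhedron_union_of_cells:
  assumes "polyhedron S" obtains H where "arrangement H" "union_of_cells H S"
proof -
  obtain F where F: "finite F" "S = \<Inter>F" "\<forall>h\<in>F. \<exists>a b. a \<noteq> 0 \<and> h = {x. a \<bullet> x \<le> b}"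
    using assms unfolding polyhedron_def by blast
  then obtain a b where ab: "\<And>h. h \<in> F \<Longrightarrow> a h \<noteq> 0 \<and> h = {x. a h \<bullet> x \<le> b h}" by metis
  let ?H = "(\<lambda>h. (a h, b h)) ` F"
  have "union_of_cells ?H h" if "h \<in> F" for h
  proof -
    have "union_of_cells ?H {x. a h \<bullet> x \<le> b h}"
      using that by (intro union_of_cells_halfspace) auto
    then show ?thesis using ab[OF that] by simp
  qed
  then have "union_of_cells ?H S" unfolding F(2) by (rule union_of_cells_Inter)
  moreover have "arrangement ?H" using F(1) ab by (auto simp: arrangement_def)
  ultimately show ?thesis using that by blast
qed

lemma Union_union_of_cells:
  assumes "finite \<F>" "\<And>F. F \<in> \<F> \<Longrightarrow> polyhedron F"
  shows "\<exists>H. arrangement H \<and> union_of_cells H (\<Union>\<F>)"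
  using assms
proof (induction \<F>)
  case empty
  then show ?case by (intro exI[of _ "{}"]) (auto simp: arrangement_def union_of_cells_def)
next
  case (insert F \<F>)
  then obtain H where H: "arrangement H" "union_of_cells H (\<Union>\<F>)" by auto
  obtain G where G: "arrangement G" "union_of_cells G F"
    using insert.prems polyhedron_union_of_cells[of F] by blast
  have "union_of_cells (G \<union> H) (F \<union> \<Union>\<F>)"
    using H(2) G(2) by (intro union_of_cells_Un) (auto elim: union_of_cells_mono)
  moreover have "arrangement (G \<union> H)" using H(1) G(1) by (auto simp: arrangement_def)
  ultimately show ?case by auto
qed

text \<open>A cell is connected, so it cannot leave \<open>P\<close> without meeting the frontier.\<close>

lemma union_of_cells_if_frontier:
  assumes "finite H" "union_of_cells H (frontier P)" "closed P"
  shows "union_of_cells H P"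
  unfolding union_of_cells_def
proof (intro allI impI)
  fix x y assume xy: "same_side H x y" "x \<in> P"
  show "y \<in> P"
  proof (rule ccontr)
    assume "y \<notin> P"
    have "cell H x \<inter> frontier P \<noteq> {}"
      using connected_Int_frontier[OF connected_cell[of H x], of P] xy \<open>y \<notin> P\<close> mem_cell[of x H] unfolding cell_def by blast
    then obtain z where "z \<in> frontier P" "same_side H x z" unfolding cell_def by blast
    then have "y \<in> frontier P"
      using assms(2) xy(1) same_side_sym same_side_trans unfolding union_of_cells_def by meson
    then show False using \<open>y \<notin> P\<close> assms(3) frontier_subset_closed by blast
  qed
qed

lemma solid_polyhedron_union_of_cells:
  assumes "solid_polyhedron P" obtains H where "arrangement H" "union_of_cells H P"
proof -
  obtain \<F> where F: "finite \<F>" "\<forall>F\<in>\<F>. polytope F" "frontier P = \<Union>\<F>"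
    using assms unfolding solid_polyhedron_def by blast
  then obtain H where "arrangement H" "union_of_cells H (frontier P)"
    using Union_union_of_cells[of \<F>] polytope_imp_polyhedron by metis
  moreover have "closed P" using assms compact_imp_closed by (auto simp: solid_polyhedron_def)
  ultimately show ?thesis using that union_of_cells_if_frontier by (metis arrangement_def)
qed

text \<open>Closed under reversal, so that each of the two closed half-spaces of a plane is named by a member.\<close>

definition unit_arrangement :: "('a::euclidean_space \<times> real) set \<Rightarrow> bool" where
  "unit_arrangement H \<longleftrightarrow> finite H \<and> (\<forall>(a,b)\<in>H. norm a = 1 \<and> (-a,-b) \<in> H)"

lemma unit_arrangement_exists:
  assumes "arrangement H" "union_of_cells H S"
  obtains G where "unit_arrangement G" "union_of_cells G S"
proof -
  define G where "G = (\<lambda>(a,b). (a /\<^sub>R norm a, b / norm a)) ` H \<union> (\<lambda>(a,b). (-(a /\<^sub>R norm a), -(b / norm a))) ` H"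
  have "same_side H x y" if "same_side G x y" for x y
    unfolding same_side_def
  proof clarify
    fix a b assume ab: "(a,b) \<in> H"
    then have "a \<noteq> 0" using assms(1) by (auto simp: arrangement_def)
    have "(a /\<^sub>R norm a, b / norm a) \<in> G" using ab by (force simp: G_def)
    then have "sgn ((a /\<^sub>R norm a) \<bullet> x - b / norm a) = sgn ((a /\<^sub>R norm a) \<bullet> y - b / norm a)"
      using that by (auto simp: same_side_def)
    moreover have "(a /\<^sub>R norm a) \<bullet> z - b / norm a = (a \<bullet> z - b) * inverse (norm a)" for z
      by (simp add: divide_inverse left_diff_distrib)
    ultimately show "sgn (a \<bullet> x - b) = sgn (a \<bullet> y - b)"
      using \<open>a \<noteq> 0\<close> by (simp add: sgn_mult)
  qed
  then have "union_of_cells G S" using assms(2) by (auto simp: union_of_cells_def)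
  moreover have "unit_arrangement G"
    unfolding unit_arrangement_def
  proof (intro conjI ballI)
    show "finite G" using assms(1) by (simp add: G_def arrangement_def)
    fix p assume "p \<in> G"
    then obtain a b where ab: "(a,b) \<in> H" "p = (a /\<^sub>R norm a, b / norm a) \<or> p = (-(a /\<^sub>R norm a), -(b / norm a))"
      unfolding G_def by auto
    then have "a \<noteq> 0" using assms(1) by (auto simp: arrangement_def)
    moreover have "(a /\<^sub>R norm a, b / norm a) \<in> G" "(-(a /\<^sub>R norm a), -(b / norm a)) \<in> G"
      using ab(1) by (force simp: G_def)+
    ultimately show "case p of (a,b) \<Rightarrow> norm a = 1 \<and> (-a,-b) \<in> G"
      using ab(2) by auto
  qed
  ultimately show ?thesis using that by blast
qed

lemma open_avoids_planes:
  assumes "finite H" "\<forall>(a,b)\<in>H. a \<noteq> 0" "open W" "W \<noteq> {}"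
  shows "\<exists>y\<in>W. \<forall>(a::'a::euclidean_space,b)\<in>H. a \<bullet> y \<noteq> b"
  using assms
proof (induction H arbitrary: W)
  case empty
  then show ?case by auto
next
  case (insert p H)
  obtain a b where p: "p = (a,b)" by fastforce
  let ?W = "W - {y. a \<bullet> y = b}"
  have "open ?W" using insert.prems(2) by (simp add: closed_hyperplane open_Diff)
  moreover have "?W \<noteq> {}"
  proof
    assume "?W = {}"
    then have "W \<subseteq> interior {y. a \<bullet> y = b}" using insert.prems(2) by (intro interior_maximal) auto
    moreover have "a \<noteq> 0" using insert.prems p by auto
    ultimately show False using insert.prems(3) by simp
  qed
  ultimately show ?case using insert.IH[of ?W] insert.prems(1) p by auto
qed

definition aligned_at :: "('a::euclidean_space \<times> real) set \<Rightarrow> 'a \<Rightarrow> bool" where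
  "aligned_at H q \<longleftrightarrow> (\<forall>(a,b)\<in>H. \<forall>(a',b')\<in>H. a \<bullet> q = b \<longrightarrow> a' \<bullet> q = b' \<longrightarrow> (\<exists>k. a' = k *\<^sub>R a))"

text \<open>Choose \<open>y\<close> outside all planes.  For two planes that meet in a line, the segment from \<open>z\<close> to \<open>y\<close> can
only hit that line if \<open>z\<close> lies in the plane spanned by \<open>y\<close> and the line.  So almost every \<open>z\<close>
avoids all these lines.\<close>

lemma generic_crossing:
  assumes H: "arrangement H" and W: "open W" "W \<noteq> {}" "W \<subseteq> Q" "open V" "V \<noteq> {}" "V \<inter> Q = {}"
  obtains z y u where "z \<in> W" "y \<in> V" "0 < u" "u < 1" "z + u *\<^sub>R (y - z) \<in> frontier Q" "aligned_at H (z + u *\<^sub>R (y - z))"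
proof -
  have fin: "finite H" and nz: "\<And>a b. (a,b) \<in> H \<Longrightarrow> a \<noteq> 0" using H by (auto simp: arrangement_def)
  obtain y where y: "y \<in> V" "\<And>a b. (a,b) \<in> H \<Longrightarrow> a \<bullet> y \<noteq> b"
    using open_avoids_planes[OF fin _ W(4,5)] nz by fast
  \<comment> \<open>the plane spanned by \<open>y\<close> and the intersection line of two planes\<close>
  define G where "G = (\<lambda>((a,b),(a',b')). ((a' \<bullet> y - b') *\<^sub>R a - (a \<bullet> y - b) *\<^sub>R a', (a' \<bullet> y - b') * b - (a \<bullet> y - b) * b')) ` (H \<times> H)"
  let ?G = "{p\<in>G. fst p \<noteq> 0}"
  have "finite ?G" unfolding G_def using fin by simp
  moreover have "\<forall>(a,b)\<in>?G. a \<noteq> 0" by auto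
  ultimately have "\<exists>z\<in>W. \<forall>(a,b)\<in>?G. a \<bullet> z \<noteq> b" by (rule open_avoids_planes[OF _ _ W(1,2)])
  then obtain z where z: "z \<in> W" "\<And>p. p \<in> ?G \<Longrightarrow> fst p \<bullet> z \<noteq> snd p"
    by (auto simp: case_prod_beta)
  have "closed_segment z y \<inter> frontier Q \<noteq> {}"
    using W z y by (intro connected_Int_frontier) auto
  then obtain u where u: "0 \<le> u" "u \<le> 1" "(1-u) *\<^sub>R z + u *\<^sub>R y \<in> frontier Q"
    by (auto simp: closed_segment_def)
  define q where "q = z + u *\<^sub>R (y - z)"
  have qf: "q \<in> frontier Q" using u(3) by (simp add: q_def algebra_simps)
  have "z \<in> interior Q" using W(1,3) z(1) interior_maximal by blast
  then have "z \<notin> frontier Q" by (simp add: frontier_def)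
  have "y \<in> interior (-Q)" using W(4,6) y(1) interior_maximal[of V "-Q"] by blast
  then have "y \<notin> frontier Q" by (simp add: frontier_def interior_closure)
  have "u \<noteq> 0" "u \<noteq> 1" using qf \<open>z \<notin> frontier Q\<close> \<open>y \<notin> frontier Q\<close> by (auto simp: q_def)
  then have u01: "0 < u" "u < 1" using u by auto
  have "aligned_at H q"
  proof -
    have "\<exists>k. a' = k *\<^sub>R a" if ab: "(a,b) \<in> H" "(a',b') \<in> H" "a \<bullet> q = b" "a' \<bullet> q = b'" for a b a' b'
    proof -
    let ?c = "(a' \<bullet> y - b') *\<^sub>R a - (a \<bullet> y - b) *\<^sub>R a'" and ?d = "(a' \<bullet> y - b') * b - (a \<bullet> y - b) * b'"
    have cdG: "(?c,?d) \<in> G" unfolding G_def using ab by force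
    have cy: "?c \<bullet> y = ?d" by (simp add: algebra_simps)
    have cq: "?c \<bullet> q = ?d" using ab(3,4) by (simp add: inner_diff_left)
    have on_line: "c \<bullet> z = d" if "c \<bullet> y = d" "c \<bullet> q = d" for c d
    proof -
      have "(1 - u) * (c \<bullet> z - d) = 0"
        using that unfolding q_def by (simp add: inner_add_right inner_diff_right algebra_simps)
      then show ?thesis using u01 by simp
    qed
    have "?c \<bullet> z = ?d" by (rule on_line[OF cy cq])
    then have "?c = 0" using z(2)[of "(?c,?d)"] cdG by auto
    then have "(a \<bullet> y - b) *\<^sub>R a' = (a' \<bullet> y - b') *\<^sub>R a" by simp
    moreover have "a \<bullet> y - b \<noteq> 0" using y(2)[OF ab(1)] by simp
    ultimately have "a' = ((a' \<bullet> y - b') / (a \<bullet> y - b)) *\<^sub>R a"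
      by (metis (no_types, opaque_lifting) divide_inverse_commute left_inverse scaleR_one scaleR_scaleR)
    then show "\<exists>k. a' = k *\<^sub>R a" by blast
    qed
    then show ?thesis unfolding aligned_at_def by auto
  qed
  then show ?thesis by (rule that[OF z(1) y(1) u01 qf[unfolded q_def], folded q_def])
qed

text \<open>Near \<open>q\<close> membership in \<open>P\<close> depends only on the position relative to a single plane.  As \<open>P\<close> is the
closure of its interior and \<open>q\<close> is a frontier point, exactly one side of the plane belongs to \<open>P\<close>.\<close>

lemma flat_if_aligned:
  assumes H: "unit_arrangement H" "union_of_cells H P" and P: "closed P" "P \<subseteq> closure (interior P)"
    and q: "q \<in> frontier P" "aligned_at H q"
  obtains a b r where "(a,b) \<in> H" "a \<bullet> q = b" "r > 0" "\<And>v. norm v < r \<Longrightarrow> (q + v \<in> P \<longleftrightarrow> a \<bullet> v \<le> 0)"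
proof -
  have fin: "finite H" and sym: "\<And>a b. (a,b) \<in> H \<Longrightarrow> (-a,-b) \<in> H" and n1: "\<And>a b. (a,b) \<in> H \<Longrightarrow> norm a = 1"
    using H(1) by (auto simp: unit_arrangement_def)
  obtain r where r: "r > 0" "\<And>v a b. norm v < r \<Longrightarrow> (a,b) \<in> H \<Longrightarrow>
       sgn (a \<bullet> (q + v) - b) = (if a \<bullet> q = b then sgn (a \<bullet> v) else sgn (a \<bullet> q - b))"
    using signs_near[OF fin] by blast
  have mem: "q + v \<in> P \<longleftrightarrow> q + w \<in> P"
    if "norm v < r" "norm w < r" "\<And>a b. (a,b) \<in> H \<Longrightarrow> a \<bullet> q = b \<Longrightarrow> sgn (a \<bullet> v) = sgn (a \<bullet> w)" for v w
  proof -
    have "same_side H (q+v) (q+w)"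
      unfolding same_side_def
    proof (intro ballI)
      fix p assume p: "p \<in> H"
      obtain a b where ab: "p = (a,b)" by fastforce
      show "case p of (a,b) \<Rightarrow> sgn (a \<bullet> (q+v) - b) = sgn (a \<bullet> (q+w) - b)"
        using r(2)[OF that(1), of a b] r(2)[OF that(2), of a b] that(3)[of a b] p ab by (simp split: if_splits)
    qed
    then show ?thesis using H(2) same_side_sym unfolding union_of_cells_def by blast
  qed
  have "q \<in> P" using q(1) P(1) frontier_subset_closed by blast
  have not_int: "\<exists>v. norm v < r \<and> q + v \<notin> P"
    using q(1) r(1) mem_interior_translate[of q P] unfolding frontier_def by blast
  have "\<exists>(a,b)\<in>H. a \<bullet> q = b"
  proof (rule ccontr)
    assume "\<not> ?thesis"
    then have "q + v \<in> P" if "norm v < r" for v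
      using mem[OF that, of 0] \<open>q \<in> P\<close> r(1) by auto
    then show False using not_int by blast
  qed
  then obtain a0 b0 where a0: "(a0,b0) \<in> H" "a0 \<bullet> q = b0" by blast
  have mem0: "q + v \<in> P \<longleftrightarrow> q + w \<in> P"
    if "norm v < r" "norm w < r" "sgn (a0 \<bullet> v) = sgn (a0 \<bullet> w)" for v w
  proof (rule mem[OF that(1,2)])
    fix a b assume "(a,b) \<in> H" "a \<bullet> q = b"
    then obtain k where "a = k *\<^sub>R a0" using q(2) a0 unfolding aligned_at_def by blast
    then show "sgn (a \<bullet> v) = sgn (a \<bullet> w)" using that(3) by (simp add: sgn_mult)
  qed
  define W where "W = interior P \<inter> ball q r"
  have "q \<in> closure (interior P)" using \<open>q \<in> P\<close> P(2) by blast
  then have "\<exists>y\<in>interior P. dist y q < r" using r(1) unfolding closure_approachable by blast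
  then have "W \<noteq> {}" unfolding W_def by (auto simp: dist_commute)
  then have "\<exists>y\<in>W. \<forall>(a,b)\<in>{(a0,b0)}. a \<bullet> y \<noteq> b"
    using n1[OF a0(1)] by (intro open_avoids_planes) (auto simp: W_def open_Int)
  then obtain y where y: "y \<in> W" "a0 \<bullet> y \<noteq> b0" by auto
  define v0 where "v0 = y - q"
  have v0: "norm v0 < r" "q + v0 \<in> P" "a0 \<bullet> v0 \<noteq> 0"
    using y a0(2) interior_subset[of P] by (auto simp: v0_def W_def dist_norm norm_minus_commute inner_diff_right)
  define s where "s = - sgn (a0 \<bullet> v0)"
  define a where "a = s *\<^sub>R a0"
  define b where "b = s * b0"
  have s: "s = 1 \<or> s = -1" using v0(3) by (auto simp: s_def sgn_if)
  have ab: "(a,b) \<in> H" using s a0(1) sym by (auto simp: a_def b_def)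
  have aq: "a \<bullet> q = b" using a0(2) by (simp add: a_def b_def)
  have neg: "q + v \<in> P" if "norm v < r" "a \<bullet> v < 0" for v
  proof -
    have "sgn (a0 \<bullet> v) = sgn (a0 \<bullet> v0)"
      using that(2) s v0(3) unfolding a_def s_def by (auto simp: sgn_if split: if_splits)
    then show ?thesis using mem0[OF that(1) v0(1)] v0(2) by simp
  qed
  have zero: "q + v \<in> P" if "norm v < r" "a \<bullet> v = 0" for v
  proof -
    have "q + v \<in> closure P"
      unfolding closure_approachable
    proof (intro allI impI)
      fix e :: real assume "e > 0"
      define t where "t = min (e/2) ((r - norm v)/2)"
      have t: "t > 0" "t < e" "norm v + t < r" using \<open>e > 0\<close> that(1) by (auto simp: t_def min_def field_simps)
      have na: "norm a = 1" using n1[OF ab] .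
      have "norm (v - t *\<^sub>R a) < r" using norm_triangle_ineq4[of v "t *\<^sub>R a"] t na by simp
      moreover have "a \<bullet> (v - t *\<^sub>R a) < 0" using that(2) t(1) na by (simp add: inner_diff_right norm_eq_1)
      ultimately have "q + (v - t *\<^sub>R a) \<in> P" by (rule neg)
      moreover have "dist (q + (v - t *\<^sub>R a)) (q + v) < e" using t na by (simp add: dist_norm)
      ultimately show "\<exists>y\<in>P. dist y (q + v) < e" by blast
    qed
    then show ?thesis using P(1) by simp
  qed
  have pos: "q + v \<notin> P" if "norm v < r" "a \<bullet> v > 0" for v
  proof
    assume *: "q + v \<in> P"
    have "q + w \<in> P" if w: "norm w < r" for w
    proof (cases "a \<bullet> w > 0")
      case True
      then have "sgn (a0 \<bullet> w) = sgn (a0 \<bullet> v)"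
        using \<open>a \<bullet> v > 0\<close> s unfolding a_def by (auto simp: sgn_if)
      then show ?thesis using mem0[OF w \<open>norm v < r\<close>] * by simp
    next
      case False
      then show ?thesis using neg zero w by fastforce
    qed
    then show False using not_int by blast
  qed
  show ?thesis
    by (rule that[OF ab aq r(1)]) (use neg zero pos in force)
qed

lemma aligned_frontier_dense:
  assumes H: "arrangement H" and P: "P \<subseteq> closure (interior P)" "closed P" and q: "q \<in> frontier P" "e > 0"
  obtains q' where "q' \<in> frontier P" "q' \<in> ball q e" "aligned_at H q'"
proof -
  define W where "W = interior P \<inter> ball q e"
  define V where "V = ball q e - P"
  have "q \<in> closure (interior P)" using q(1) P frontier_subset_closed by blast
  then have "\<exists>y\<in>interior P. dist y q < e" using q(2) unfolding closure_approachable by blast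
  then have "W \<noteq> {}" unfolding W_def by (auto simp: dist_commute)
  moreover have "\<not> ball q e \<subseteq> P" using q mem_interior[of q P] by (auto simp: frontier_def)
  then have "V \<noteq> {}" unfolding V_def by blast
  moreover have "open V" "open W" using P(2) by (auto simp: V_def W_def open_Diff open_Int)
  moreover have "W \<subseteq> P" "V \<inter> P = {}" using interior_subset by (auto simp: V_def W_def)
  ultimately obtain z y u where zy: "z \<in> W" "y \<in> V" "0 < u" "u < 1" "z + u *\<^sub>R (y - z) \<in> frontier P" "aligned_at H (z + u *\<^sub>R (y - z))"
    using generic_crossing[OF H] by metis
  have "(1-u) *\<^sub>R z + u *\<^sub>R y \<in> ball q e"
    using zy by (intro convexD) (auto simp: W_def V_def)
  then have "z + u *\<^sub>R (y - z) \<in> ball q e" by (simp add: algebra_simps)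
  then show ?thesis using that zy by blast
qed

text \<open>The required polygons are the closures of the frontier cells in which only one plane passes through
each point.  Such points are dense in the frontier, and there are only finitely many cells, so the
closed cells cover the frontier.\<close>

lemma solid_polyhedronI:
  assumes H: "arrangement H" "union_of_cells H P"
    and P: "compact P" "interior P \<noteq> {}" "P = closure (interior P)"
  shows "solid_polyhedron P"
proof -
  obtain G where G: "unit_arrangement G" "union_of_cells G P" using unit_arrangement_exists[OF H] by blast
  have fin: "finite G" and sym: "\<And>a b. (a,b) \<in> G \<Longrightarrow> (-a,-b) \<in> G" and n1: "\<And>a b. (a,b) \<in> G \<Longrightarrow> norm a = 1"
    using G(1) by (auto simp: unit_arrangement_def)
  have arr: "arrangement G" unfolding arrangement_def using fin n1 by fastforce
  have "closed P" using P(1) compact_imp_closed by blast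
  define C where "C x = {y. \<forall>(a,b)\<in>G. a \<bullet> x \<le> b \<longrightarrow> a \<bullet> y \<le> b}" for x
  define X where "X = {x \<in> frontier P. aligned_at G x}"
  have fr: "union_of_cells G (frontier P)"
    using union_of_cells_local[where f=frontier, OF _ fin G(2)] germ_eq_frontier by blast
  have C_eq: "C x = C x'" if "cell G x = cell G x'" for x x'
  proof -
    have "same_side G x x'" using that mem_cell[of x' G] unfolding cell_def by auto
    then have "a \<bullet> x \<le> b \<longleftrightarrow> a \<bullet> x' \<le> b" if "(a,b) \<in> G" for a b
      using that unfolding same_side_def by (fastforce simp: sgn_if split: if_splits)
    then show ?thesis unfolding C_def by auto
  qed
  have C_sub: "C x \<subseteq> frontier P" if "x \<in> frontier P" for x
  proof
    fix y assume y: "y \<in> C x"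
    have "open_segment x y \<subseteq> cell G x"
    proof
      fix z assume "z \<in> open_segment x y"
      then obtain u where u: "0 < u" "u < 1" "z = (1-u) *\<^sub>R x + u *\<^sub>R y" by (auto simp: in_segment)
      have *: "a \<bullet> x < b \<Longrightarrow> a \<bullet> z < b" "a \<bullet> x = b \<Longrightarrow> a \<bullet> z \<le> b" if "(a,b) \<in> G" for a b
      proof -
        have zz: "a \<bullet> z = (1-u) * (a \<bullet> x) + u * (a \<bullet> y)" by (simp add: u(3) inner_add_right)
        have "a \<bullet> y \<le> b" if "a \<bullet> x \<le> b" using y \<open>(a,b) \<in> G\<close> that unfolding C_def by auto
        then have yy: "u * (a \<bullet> y) \<le> u * b" if "a \<bullet> x \<le> b" using that u(1) by simp
        { assume "a \<bullet> x < b"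
          then have "(1-u) * (a \<bullet> x) < (1-u) * b" using u(2) by simp
          then show "a \<bullet> z < b" using yy \<open>a \<bullet> x < b\<close> zz by (simp add: algebra_simps) }
        { assume "a \<bullet> x = b" then show "a \<bullet> z \<le> b" using yy zz by (simp add: algebra_simps) }
      qed
      have "sgn (a \<bullet> x - b) = sgn (a \<bullet> z - b)" if "(a,b) \<in> G" for a b
        using *[OF that] *[OF sym[OF that]] by (cases "a \<bullet> x" b rule: linorder_cases) (auto simp: sgn_if)
      then show "z \<in> cell G x" by (auto simp: cell_def same_side_def)
    qed
    then have "open_segment x y \<subseteq> frontier P" using cell_subset[OF fr that] by blast
    then have "closure (open_segment x y) \<subseteq> frontier P" by (rule closure_minimal) simp
    then show "y \<in> frontier P" using that by (cases "x = y") (auto simp: closure_open_segment)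
  qed
  have C_self: "x \<in> C x" for x by (auto simp: C_def)
  have C_poly: "polyhedron (C x)" for x
  proof -
    have "C x = \<Inter>((\<lambda>(a,b). {y. a \<bullet> y \<le> b}) ` {(a,b)\<in>G. a \<bullet> x \<le> b})" by (auto simp: C_def)
    moreover have "finite {(a,b)\<in>G. a \<bullet> x \<le> b}" using fin by (rule rev_finite_subset) auto
    ultimately show ?thesis by (auto intro!: polyhedron_Inter polyhedron_halfspace_le)
  qed
  define \<F> where "\<F> = C ` X"
  have "\<F> = (\<lambda>c. C (SOME x. cell G x = c)) ` (cell G ` X)"
  proof -
    have "C (SOME x'. cell G x' = cell G x) = C x" for x
      by (rule C_eq) (metis (mono_tags, lifting) someI)
    then show ?thesis unfolding \<F>_def by (auto simp: image_image)
  qed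
  then have finF: "finite \<F>" using finite_cells[OF fin] by (metis finite_imageI finite_subset image_mono subset_UNIV)
  have bddP: "bounded (frontier P)"
    using P(1) \<open>closed P\<close> compact_imp_bounded frontier_subset_closed bounded_subset by blast
  have "polytope F \<and> aff_dim F = 2" if F_in: "F \<in> \<F>" for F
  proof -
    obtain x where x: "x \<in> frontier P" "aligned_at G x" "F = C x" using F_in unfolding \<F>_def X_def by blast
    have "polytope F" unfolding x(3) polytope_eq_bounded_polyhedron
      using C_poly C_sub[OF x(1)] bddP bounded_subset by blast
    obtain a b where ab: "(a,b) \<in> G" "a \<bullet> x = b"
      using flat_if_aligned[OF G \<open>closed P\<close> _ x(1,2)] P(3) by blast
    have "a \<noteq> 0" using n1[OF ab(1)] by auto
    obtain r where r: "r > 0" "\<And>v a b. norm v < r \<Longrightarrow> (a,b) \<in> G \<Longrightarrow>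
       sgn (a \<bullet> (x + v) - b) = (if a \<bullet> x = b then sgn (a \<bullet> v) else sgn (a \<bullet> x - b))"
      using signs_near[OF fin] by blast
    have "{y. a \<bullet> y = b} \<inter> ball x r \<subseteq> C x"
    proof
      fix y assume y: "y \<in> {y. a \<bullet> y = b} \<inter> ball x r"
      have "a' \<bullet> y \<le> b'" if a'b': "(a',b') \<in> G" "a' \<bullet> x \<le> b'" for a' b'
      proof (cases "a' \<bullet> x = b'")
        case True
        then obtain k where "a' = k *\<^sub>R a" using x(2) ab a'b' unfolding aligned_at_def by blast
        then show ?thesis using True y ab(2) by auto
      next
        case False
        then show ?thesis using r(2)[of "y - x", OF _ a'b'(1)] a'b'(2) y
          by (auto simp: dist_norm norm_minus_commute sgn_if split: if_splits)
      qed
      then show "y \<in> C x" by (auto simp: C_def)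
    qed
    then have "aff_dim ({y. a \<bullet> y = b} \<inter> ball x r) \<le> aff_dim (C x)" by (rule aff_dim_subset)
    moreover have "aff_dim ({y. a \<bullet> y = b} \<inter> ball x r) = aff_dim {y. a \<bullet> y = b}"
      using ab(2) r(1) by (intro aff_dim_convex_Int_open) (auto simp: convex_hyperplane)
    moreover have "C x \<subseteq> {y. a \<bullet> y = b}"
    proof
      fix y assume "y \<in> C x"
      then have "a \<bullet> y \<le> b" "(-a) \<bullet> y \<le> -b" using ab sym[OF ab(1)] unfolding C_def by fastforce+
      then show "y \<in> {y. a \<bullet> y = b}" by simp
    qed
    then have "aff_dim (C x) \<le> aff_dim {y. a \<bullet> y = b}" by (rule aff_dim_subset)
    moreover have "aff_dim {y. a \<bullet> y = b} = 2" using \<open>a \<noteq> 0\<close> by simp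
    ultimately show ?thesis using \<open>polytope F\<close> x(3) by simp
  qed
  moreover have "frontier P = \<Union>\<F>"
  proof
    show "\<Union>\<F> \<subseteq> frontier P" using C_sub by (auto simp: \<F>_def X_def)
    show "frontier P \<subseteq> \<Union>\<F>"
    proof
      fix x assume x: "x \<in> frontier P"
      have "x \<in> closure (\<Union>\<F>)"
        unfolding closure_approachable
      proof (intro allI impI)
        fix e :: real assume "e > 0"
        then obtain q' where "q' \<in> frontier P" "q' \<in> ball x e" "aligned_at G q'"
          using aligned_frontier_dense[OF arr _ \<open>closed P\<close> x] P(3) by blast
        then show "\<exists>y\<in>\<Union>\<F>. dist y x < e" using C_self by (auto simp: \<F>_def X_def dist_commute)
      qed
      moreover have "closed (\<Union>\<F>)"
        using finF C_poly polyhedron_imp_closed by (intro closed_Union) (auto simp: \<F>_def)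
      ultimately show "x \<in> \<Union>\<F>" by simp
    qed
  qed
  ultimately show ?thesis unfolding solid_polyhedron_def using P finF by blast
qed

section \<open>Lines and one-dimensional measure\<close>

lemma perp_cross:
  fixes a a' w :: "real^3"
  assumes "a \<bullet> w = 0" "a' \<bullet> w = 0" "cross3 a a' \<noteq> 0"
  obtains c where "w = c *\<^sub>R cross3 a a'"
proof -
  let ?c = "cross3 a a'"
  define u where "u = w - ((w \<bullet> ?c) / (?c \<bullet> ?c)) *\<^sub>R ?c"
  have "?c \<bullet> a = 0" "?c \<bullet> a' = 0" by (simp_all add: dot_cross_self)
  moreover have "w \<bullet> a = 0" "w \<bullet> a' = 0" using assms(1,2) by (simp_all add: inner_commute)
  ultimately have "u \<bullet> a = 0" "u \<bullet> a' = 0" by (simp_all add: u_def inner_diff_left)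
  then have "cross3 u ?c = 0" by (simp add: Lagrange)
  moreover have "u \<bullet> ?c = 0" using assms(3) by (simp add: u_def inner_diff_left)
  ultimately have "u = 0" using norm_and_cross_eq_0 assms(3) by blast
  then show ?thesis using that unfolding u_def by auto
qed

lemma parallel_if_cross_0:
  fixes a a' :: "real^3"
  assumes "cross3 a a' = 0" "a \<noteq> 0" obtains k where "a' = k *\<^sub>R a"
proof -
  have "cross3 a (cross3 a a') = 0" using assms by simp
  then have "(a \<bullet> a') *\<^sub>R a - (a \<bullet> a) *\<^sub>R a' = 0" by (simp add: Lagrange)
  then have "(a \<bullet> a) *\<^sub>R a' = (a \<bullet> a') *\<^sub>R a" by simp
  then have "(1 / (a \<bullet> a)) *\<^sub>R ((a \<bullet> a) *\<^sub>R a') = (1 / (a \<bullet> a)) *\<^sub>R ((a \<bullet> a') *\<^sub>R a)" by simp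
  then have "a' = ((a \<bullet> a') / (a \<bullet> a)) *\<^sub>R a" using assms(2) by simp
  then show ?thesis using that by blast
qed

definition line_of :: "(real^3) \<times> (real^3) \<Rightarrow> (real^3) set" where
  "line_of l = range (\<lambda>s. fst l + s *\<^sub>R snd l)"

lemma plane_Int_plane:
  fixes a a' :: "real^3"
  assumes "cross3 a a' \<noteq> 0" "a \<bullet> p = b" "a' \<bullet> p = b'"
  shows "{y. a \<bullet> y = b \<and> a' \<bullet> y = b'} = line_of (p, cross3 a a' /\<^sub>R norm (cross3 a a'))"
proof (intro equalityI subsetI)
  fix y assume "y \<in> {y. a \<bullet> y = b \<and> a' \<bullet> y = b'}"
  then have "a \<bullet> (y - p) = 0" "a' \<bullet> (y - p) = 0" using assms by (auto simp: inner_diff_right)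
  then obtain c where "y - p = c *\<^sub>R cross3 a a'" using perp_cross assms(1) by blast
  then have "y = p + (c * norm (cross3 a a')) *\<^sub>R (cross3 a a' /\<^sub>R norm (cross3 a a'))"
    using assms(1) by (simp add: algebra_simps)
  then show "y \<in> line_of (p, cross3 a a' /\<^sub>R norm (cross3 a a'))" unfolding line_of_def by auto
next
  fix y assume "y \<in> line_of (p, cross3 a a' /\<^sub>R norm (cross3 a a'))"
  then show "y \<in> {y. a \<bullet> y = b \<and> a' \<bullet> y = b'}"
    using assms by (auto simp: line_of_def inner_add_right dot_cross_self)
qed

text \<open>A frontier point is flat unless two planes of the arrangement cross there, so the skeleton lies on
the pairwise intersections.\<close>

lemma skeleton_subset_lines:
  assumes "solid_polyhedron P"
  obtains \<L> where "finite \<L>" "\<forall>l\<in>\<L>. norm (snd l) = 1" "skeleton P \<subseteq> (\<Union>l\<in>\<L>. line_of l)"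
proof -
  obtain H0 where "arrangement H0" "union_of_cells H0 P" using solid_polyhedron_union_of_cells[OF assms] .
  then obtain H where H: "unit_arrangement H" "union_of_cells H P" using unit_arrangement_exists by blast
  have P: "closed P" "P \<subseteq> closure (interior P)"
    using assms compact_imp_closed by (auto simp: solid_polyhedron_def)
  define L where "L p q = {y. fst p \<bullet> y = snd p \<and> fst q \<bullet> y = snd q}" for p q :: "(real^3) \<times> real"
  define l where "l p q = (SOME y. y \<in> L p q, cross3 (fst p) (fst q) /\<^sub>R norm (cross3 (fst p) (fst q)))" for p q
  define \<L> where "\<L> = (\<lambda>(p,q). l p q) ` {(p,q)\<in>H\<times>H. cross3 (fst p) (fst q) \<noteq> 0}"
  show ?thesis
  proof (rule that)
    have "finite {(p,q)\<in>H\<times>H. cross3 (fst p) (fst q) \<noteq> 0}"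
      by (rule finite_subset[of _ "H\<times>H"]) (use H(1) in \<open>auto simp: unit_arrangement_def\<close>)
    then show "finite \<L>" by (simp add: \<L>_def)
    show "\<forall>l\<in>\<L>. norm (snd l) = 1" by (auto simp: \<L>_def l_def)
    show "skeleton P \<subseteq> (\<Union>l\<in>\<L>. line_of l)"
    proof
      fix x assume x: "x \<in> skeleton P"
      have "\<not> aligned_at H x"
      proof
        assume "aligned_at H x"
        moreover have "x \<in> frontier P" using x by (simp add: skeleton_def)
        ultimately obtain a b r where "(a,b) \<in> H" "a \<bullet> x = b" "r > 0" "\<And>v. norm v < r \<Longrightarrow> (x + v \<in> P \<longleftrightarrow> a \<bullet> v \<le> 0)"
          using flat_if_aligned[OF H P] by metis
        moreover have "a \<noteq> 0" using \<open>(a,b) \<in> H\<close> H(1) by (auto simp: unit_arrangement_def)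
        ultimately have "x \<in> flat_points P" unfolding mem_flat_points by blast
        then show False using x by (simp add: skeleton_def)
      qed
      then obtain a b a' b' where ab: "(a,b) \<in> H" "(a',b') \<in> H" "a \<bullet> x = b" "a' \<bullet> x = b'" "\<not> (\<exists>k. a' = k *\<^sub>R a)"
        unfolding aligned_at_def by blast
      have "a \<noteq> 0" using ab(1) H(1) by (auto simp: unit_arrangement_def)
      then have c: "cross3 a a' \<noteq> 0" using parallel_if_cross_0 ab(5) by blast
      have "x \<in> L (a,b) (a',b')" using ab by (simp add: L_def)
      define y0 where "y0 = (SOME y. y \<in> L (a,b) (a',b'))"
      have "y0 \<in> L (a,b) (a',b')" unfolding y0_def using \<open>x \<in> L (a,b) (a',b')\<close> by (rule someI)
      then have "L (a,b) (a',b') = line_of (y0, cross3 a a' /\<^sub>R norm (cross3 a a'))"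
        unfolding L_def fst_conv snd_conv by (intro plane_Int_plane[OF c]) auto
      then have "L (a,b) (a',b') = line_of (l (a,b) (a',b'))" by (simp add: l_def y0_def)
      moreover have "l (a,b) (a',b') \<in> \<L>" unfolding \<L>_def using ab c by force
      ultimately show "x \<in> (\<Union>l\<in>\<L>. line_of l)" using \<open>x \<in> L (a,b) (a',b')\<close> by blast
    qed
  qed
qed

definition line_family :: "((real^3) \<times> (real^3)) set \<Rightarrow> bool" where
  "line_family \<L> \<longleftrightarrow> finite \<L> \<and> (\<forall>l\<in>\<L>. norm (snd l) = 1) \<and> inj_on line_of \<L>"

definition on_line :: "(real^3) \<times> (real^3) \<Rightarrow> (real^3) set \<Rightarrow> real set" where
  "on_line l S = {s. fst l + s *\<^sub>R snd l \<in> S}"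

text \<open>One-dimensional measure of a set that is contained in the lines of \<open>\<L>\<close>.  Distinct lines share at
most one point, so no part of positive length is counted twice.\<close>

definition len :: "((real^3) \<times> (real^3)) set \<Rightarrow> (real^3) set \<Rightarrow> real" where
  "len \<L> S = (\<Sum>l\<in>\<L>. measure lebesgue (on_line l S))"

definition covered :: "((real^3) \<times> (real^3)) set \<Rightarrow> (real^3) set" where
  "covered \<L> = (\<Union>l\<in>\<L>. line_of l)"

lemma line_family_exists:
  assumes "finite M" "\<forall>l\<in>M. norm (snd l) = 1"
  obtains \<L> where "line_family \<L>" "covered \<L> = covered M"
proof -
  obtain \<L> where "\<L> \<subseteq> M" "inj_on line_of \<L>" "line_of ` M = line_of ` \<L>"
    using subset_image_inj[of "line_of ` M" line_of M] by auto
  show ?thesis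
  proof (rule that)
    show "line_family \<L>"
      unfolding line_family_def using \<open>\<L> \<subseteq> M\<close> \<open>inj_on line_of \<L>\<close> assms finite_subset[of \<L> M] by auto
    show "covered \<L> = covered M" unfolding covered_def using \<open>line_of ` M = line_of ` \<L>\<close> by simp
  qed
qed

lemma line_of_two_points:
  assumes "x \<in> line_of l" "y \<in> line_of l" "x \<noteq> y"
  shows "line_of l = range (\<lambda>s. x + s *\<^sub>R (y - x))"
proof -
  obtain s t where s: "x = fst l + s *\<^sub>R snd l" and t: "y = fst l + t *\<^sub>R snd l"
    using assms(1,2) unfolding line_of_def by blast
  have st: "s \<noteq> t" using assms(3) s t by auto
  have yx: "y - x = (t - s) *\<^sub>R snd l" by (simp add: s t scaleR_diff_left)
  show ?thesis
  proof (intro equalityI subsetI)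
    fix z assume "z \<in> line_of l"
    then obtain c where "z = fst l + c *\<^sub>R snd l" unfolding line_of_def by blast
    then have "z = x + ((c - s) / (t - s)) *\<^sub>R (y - x)"
      unfolding yx scaleR_scaleR using st by (simp add: s scaleR_diff_left)
    then show "z \<in> range (\<lambda>s. x + s *\<^sub>R (y - x))" by blast
  next
    fix z assume "z \<in> range (\<lambda>s. x + s *\<^sub>R (y - x))"
    then obtain c where "z = x + c *\<^sub>R (y - x)" by blast
    then have "z = x + (c * (t - s)) *\<^sub>R snd l" by (simp add: yx)
    then have "z = fst l + (s + c * (t - s)) *\<^sub>R snd l" by (simp add: s scaleR_add_left)
    then show "z \<in> line_of l" unfolding line_of_def by blast
  qed
qed

lemma line_of_eqI:
  assumes "x \<in> line_of l" "y \<in> line_of l" "x \<in> line_of m" "y \<in> line_of m" "x \<noteq> y"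
  shows "line_of l = line_of m"
  using line_of_two_points assms by metis

text \<open>One of the finitely many lines contains two of the infinitely many points.\<close>

lemma finitely_many_lines:
  assumes "finite \<L>" "infinite A" "v \<noteq> 0" "\<And>s. s \<in> A \<Longrightarrow> p + s *\<^sub>R v \<in> covered \<L>"
  obtains l where "l \<in> \<L>" "line_of l = range (\<lambda>s. p + s *\<^sub>R v)"
proof -
  have "\<forall>s\<in>A. \<exists>l\<in>\<L>. p + s *\<^sub>R v \<in> line_of l" using assms(4) unfolding covered_def by blast
  then obtain f where f: "\<And>s. s \<in> A \<Longrightarrow> f s \<in> \<L> \<and> p + s *\<^sub>R v \<in> line_of (f s)" by metis
  have "finite (f ` A)" using f assms(1) by (meson finite_subset image_subsetI)
  then obtain a where a: "a \<in> A" "infinite {s\<in>A. f s = f a}" using pigeonhole_infinite[OF assms(2)] by blast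
  have "\<not> {s\<in>A. f s = f a} \<subseteq> {a}" using a(2) finite_subset by blast
  then obtain b where b: "b \<in> A" "f b = f a" "b \<noteq> a" by blast
  define m where "m = (p, v)"
  have "line_of (f a) = line_of m"
  proof (rule line_of_eqI)
    show "p + a *\<^sub>R v \<in> line_of (f a)" "p + b *\<^sub>R v \<in> line_of (f a)" using f[OF a(1)] f[OF b(1)] b(2) by auto
    show "p + a *\<^sub>R v \<in> line_of m" "p + b *\<^sub>R v \<in> line_of m" by (auto simp: m_def line_of_def)
    show "p + a *\<^sub>R v \<noteq> p + b *\<^sub>R v" using b(3) assms(3) by simp
  qed
  then have "line_of (f a) = range (\<lambda>s. p + s *\<^sub>R v)" by (simp add: m_def line_of_def)
  then show ?thesis using that f[OF a(1)] by blast
qed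

lemma inj_line: "norm (snd l) = 1 \<Longrightarrow> inj (\<lambda>s. fst l + s *\<^sub>R snd l)" for l :: "(real^3)\<times>(real^3)"
  by (auto simp: inj_on_def)

lemma on_line_finite:
  assumes "norm (snd l) = 1" "finite S" shows "finite (on_line l S)"
proof -
  have "on_line l S = (\<lambda>s. fst l + s *\<^sub>R snd l) -` S" by (auto simp: on_line_def)
  then show ?thesis using finite_vimageI[OF assms(2) inj_line[OF assms(1)]] by simp
qed

lemma on_line_measurable:
  assumes "norm (snd l) = 1" "S \<in> sets borel" "bounded S"
  shows "on_line l S \<in> lmeasurable"
proof (rule bounded_set_imp_lmeasurable)
  obtain B where B: "\<And>x. x \<in> S \<Longrightarrow> norm x \<le> B" using assms(3) bounded_iff by blast
  have "\<bar>s\<bar> \<le> B + norm (fst l)" if "s \<in> on_line l S" for s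
  proof -
    have "norm (s *\<^sub>R snd l) \<le> norm (fst l + s *\<^sub>R snd l) + norm (fst l)"
      using norm_triangle_ineq4[of "fst l + s *\<^sub>R snd l" "fst l"] by simp
    then show ?thesis using B[of "fst l + s *\<^sub>R snd l"] that assms(1) by (auto simp: on_line_def)
  qed
  then show "bounded (on_line l S)" unfolding bounded_iff by auto
  have "(\<lambda>s::real. fst l + s *\<^sub>R snd l) \<in> borel_measurable borel"
    by (intro borel_measurable_continuous_onI continuous_intros)
  then have "(\<lambda>s::real. fst l + s *\<^sub>R snd l) -` S \<inter> space borel \<in> sets borel"
    using assms(2) measurable_sets by blast
  then have "on_line l S \<in> sets borel" by (simp add: on_line_def vimage_def)
  then show "on_line l S \<in> sets lebesgue" using sets_completionI_sets[of _ lborel] by simp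
qed

lemma len_nonneg: "len \<L> S \<ge> 0"
  unfolding len_def by (intro sum_nonneg) simp

lemma len_finite:
  assumes "line_family \<L>" "finite S" shows "len \<L> S = 0"
  unfolding len_def
proof (rule sum.neutral, intro ballI)
  fix l assume "l \<in> \<L>"
  then have "negligible (on_line l S)"
    using on_line_finite assms negligible_finite unfolding line_family_def by blast
  then show "measure lebesgue (on_line l S) = 0" by (rule negligible_imp_measure0)
qed

lemma len_UN:
  assumes "line_family \<L>" "finite I" "\<And>i. i \<in> I \<Longrightarrow> A i \<in> sets borel" "\<And>i. i \<in> I \<Longrightarrow> bounded (A i)"
    and "\<And>i j. i \<in> I \<Longrightarrow> j \<in> I \<Longrightarrow> i \<noteq> j \<Longrightarrow> finite (A i \<inter> A j)"
  shows "len \<L> (\<Union>i\<in>I. A i) = (\<Sum>i\<in>I. len \<L> (A i))"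
proof -
  have "measure lebesgue (on_line l (\<Union>i\<in>I. A i)) = (\<Sum>i\<in>I. measure lebesgue (on_line l (A i)))" if "l \<in> \<L>" for l
  proof -
    have n: "norm (snd l) = 1" using assms(1) that by (auto simp: line_family_def)
    have "on_line l (\<Union>i\<in>I. A i) = \<Union>((\<lambda>i. on_line l (A i)) ` I)" by (auto simp: on_line_def)
    moreover have "on_line l (A i) \<inter> on_line l (A j) = on_line l (A i \<inter> A j)" for i j by (auto simp: on_line_def)
    then have "pairwise (\<lambda>i j. negligible (on_line l (A i) \<inter> on_line l (A j))) I"
      using assms(5) on_line_finite[OF n] by (auto simp: pairwise_def intro!: negligible_finite)
    ultimately show ?thesis
      using assms(2-4) on_line_measurable[OF n] by (simp add: measure_negligible_finite_Union_image)
  qed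
  then show ?thesis unfolding len_def by (simp add: sum.swap[of _ I])
qed

lemma len_Un:
  assumes "line_family \<L>" "A \<in> sets borel" "B \<in> sets borel" "bounded A" "bounded B" "finite (A \<inter> B)"
  shows "len \<L> (A \<union> B) = len \<L> A + len \<L> B"
proof -
  have "len \<L> (\<Union>i\<in>{0,1::nat}. if i = 0 then A else B) = (\<Sum>i\<in>{0,1::nat}. len \<L> (if i = 0 then A else B))"
    using assms by (intro len_UN) (auto simp: Int_commute)
  then show ?thesis by (simp add: Un_commute)
qed

lemma len_cong:
  assumes "line_family \<L>" "A \<in> sets borel" "bounded A" "finite (A - B)" "finite (B - A)"
  shows "len \<L> A = len \<L> B"
  unfolding len_def
proof (rule sum.cong[OF refl])
  fix l assume "l \<in> \<L>"
  then have n: "norm (snd l) = 1" using assms(1) by (auto simp: line_family_def)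
  have eq: "(on_line l A - on_line l B) \<union> (on_line l B - on_line l A) = on_line l ((A - B) \<union> (B - A))"
    by (auto simp: on_line_def)
  have "measure lebesgue (on_line l B) = measure lebesgue (on_line l A)"
    using on_line_measurable[OF n assms(2,3)] on_line_finite[OF n, of "(A - B) \<union> (B - A)"] assms(4,5) eq
    by (intro measure_negligible_symdiff) (simp_all add: negligible_finite)
  then show "measure lebesgue (on_line l A) = measure lebesgue (on_line l B)" by simp
qed

lemma len_segment:
  assumes "line_family \<L>" "v \<noteq> 0" "u < w" "(\<lambda>s. p + s *\<^sub>R v) ` {u<..<w} \<subseteq> covered \<L>"
  shows "len \<L> ((\<lambda>s. p + s *\<^sub>R v) ` {u<..<w}) = (w - u) * norm v"
proof -
  let ?S = "(\<lambda>s. p + s *\<^sub>R v) ` {u<..<w}"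
  have fin: "finite \<L>" using assms(1) by (simp add: line_family_def)
  have "infinite {u<..<w}" using assms(3) by simp
  then obtain l where l: "l \<in> \<L>" "line_of l = range (\<lambda>s. p + s *\<^sub>R v)"
    using finitely_many_lines[OF fin _ assms(2)] assms(4) by blast
  have n: "norm (snd l) = 1" using l(1) assms(1) by (simp add: line_family_def)
  have other: "measure lebesgue (on_line m ?S) = 0" if m: "m \<in> \<L>" "m \<noteq> l" for m
  proof -
    have "line_of m \<noteq> line_of l" using m l(1) assms(1) unfolding line_family_def inj_on_def by blast
    then have "x = y" if "x \<in> line_of m \<inter> line_of l" "y \<in> line_of m \<inter> line_of l" for x y
      using that line_of_eqI by blast
    then have "finite (line_of m \<inter> line_of l)"
      by (metis finite.emptyI finite.insertI finite_subset singletonI subsetI)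
    moreover have nm: "norm (snd m) = 1" using m(1) assms(1) by (simp add: line_family_def)
    ultimately have "finite (on_line m (line_of m \<inter> line_of l))" using on_line_finite by blast
    moreover have "on_line m ?S \<subseteq> on_line m (line_of m \<inter> line_of l)"
      unfolding l(2) by (auto simp: on_line_def line_of_def)
    ultimately show ?thesis using finite_subset negligible_finite negligible_imp_measure0 by blast
  qed
  have "p \<in> line_of l" "p + v \<in> line_of l"
    unfolding l(2) by (auto intro: range_eqI[of _ _ 0] range_eqI[of _ _ 1])
  then obtain a b where a: "p = fst l + a *\<^sub>R snd l" and b: "p + v = fst l + b *\<^sub>R snd l"
    unfolding line_of_def by blast
  define k where "k = b - a"
  have v: "v = k *\<^sub>R snd l" using a b by (simp add: k_def scaleR_diff_left algebra_simps)
  have k: "\<bar>k\<bar> = norm v" "k \<noteq> 0" using v n assms(2) by auto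
  have "on_line l ?S = (\<lambda>s. a + s * k) ` {u<..<w}"
  proof -
    have "fst l + t *\<^sub>R snd l = p + s *\<^sub>R v \<longleftrightarrow> t = a + s * k" for s t
    proof -
      have "p + s *\<^sub>R v = fst l + (a + s * k) *\<^sub>R snd l" by (simp add: a v scaleR_add_left)
      then show ?thesis using inj_line[OF n] by (auto simp: inj_on_def)
    qed
    then show ?thesis unfolding on_line_def image_iff by blast
  qed
  also have "\<dots> = (if k > 0 then {a + u * k<..<a + w * k} else {a + w * k<..<a + u * k})"
  proof -
    have "t \<in> (\<lambda>s. a + s * k) ` {u<..<w} \<longleftrightarrow> u < (t - a) / k \<and> (t - a) / k < w" for t
    proof
      assume "u < (t - a) / k \<and> (t - a) / k < w"
      then show "t \<in> (\<lambda>s. a + s * k) ` {u<..<w}" using k(2) by (intro image_eqI[of _ _ "(t - a)/k"]) auto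
    qed (use k(2) in auto)
    then show ?thesis using k(2) by (auto simp: field_simps)
  qed
  finally have on_l: "on_line l ?S = (if k > 0 then {a + u * k<..<a + w * k} else {a + w * k<..<a + u * k})" .
  have "measure lebesgue (on_line l ?S) = (w - u) * \<bar>k\<bar>"
  proof (cases "k > 0")
    case True
    then have "u * k < w * k" using assms(3) by simp
    then show ?thesis unfolding on_l using True by (simp add: left_diff_distrib)
  next
    case False
    then have "w * k < u * k" "k < 0" using assms(3) k(2) by simp_all
    then show ?thesis unfolding on_l by (simp add: left_diff_distrib)
  qed
  then show ?thesis
    unfolding len_def using sum.remove[OF fin l(1), of "\<lambda>l. measure lebesgue (on_line l ?S)"] other k(1) by simp
qed

section \<open>Total edge length as the measure of the skeleton\<close>

definition runs_along :: "(real^3) set \<Rightarrow> (real^3) \<times> (real^3) \<Rightarrow> real^3 \<Rightarrow> bool" where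
  "runs_along S l x \<longleftrightarrow> x \<in> line_of l \<and> (\<exists>r>0. S \<inter> ball x r = line_of l \<inter> ball x r)"

lemma line_of_through:
  assumes "x \<in> line_of l" shows "line_of l = range (\<lambda>s. x + s *\<^sub>R snd l)"
proof -
  obtain a where a: "x = fst l + a *\<^sub>R snd l" using assms unfolding line_of_def by blast
  have "fst l + t *\<^sub>R snd l = x + (t - a) *\<^sub>R snd l" "x + t *\<^sub>R snd l = fst l + (t + a) *\<^sub>R snd l" for t
    by (simp_all add: a scaleR_add_left scaleR_diff_left)
  then show ?thesis unfolding line_of_def by (metis (no_types, lifting) image_cong rangeE rangeI subsetI subset_antisym)
qed

lemma edge_points_if_runs_along:
  assumes "runs_along (skeleton P) l x" "norm (snd l) = 1" shows "x \<in> edge_points P"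
proof -
  have "snd l \<noteq> 0" using assms(2) by auto
  then show ?thesis
    using assms(1) line_of_through unfolding runs_along_def edge_points_def by blast
qed

lemma runs_along_unique:
  assumes "runs_along S l x" "runs_along S m x" "norm (snd l) = 1" "norm (snd m) = 1"
  shows "line_of l = line_of m"
proof -
  obtain r where r: "r > 0" "S \<inter> ball x r = line_of l \<inter> ball x r" using assms(1) runs_along_def by blast
  obtain r' where r': "r' > 0" "S \<inter> ball x r' = line_of m \<inter> ball x r'" using assms(2) runs_along_def by blast
  define t where "t = min r r' / 2"
  have t: "t > 0" "t < r" "t < r'" using r(1) r'(1) by (auto simp: t_def min_def)
  have x: "x \<in> line_of l" "x \<in> line_of m" using assms(1,2) by (auto simp: runs_along_def)
  define y where "y = x + t *\<^sub>R snd l"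
  have "y \<in> line_of l" unfolding y_def line_of_through[OF x(1)] by blast
  moreover have d: "dist x y = t" using t(1) assms(3) by (simp add: y_def dist_norm)
  ultimately have "y \<in> line_of m" using r(2) r'(2) t by (metis IntD1 IntI mem_ball)
  moreover have "x \<noteq> y" using d t(1) by auto
  ultimately show ?thesis using line_of_eqI x \<open>y \<in> line_of l\<close> by blast
qed

lemma runs_along_nearby:
  assumes "runs_along S l x"
  obtains r where "r > 0" "S \<inter> ball x r = line_of l \<inter> ball x r" "\<And>y. y \<in> line_of l \<inter> ball x r \<Longrightarrow> runs_along S l y"
proof -
  obtain r where r: "r > 0" "S \<inter> ball x r = line_of l \<inter> ball x r" using assms runs_along_def by blast
  show ?thesis
  proof (rule that[OF r])
    fix y assume y: "y \<in> line_of l \<inter> ball x r"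
    have "ball y (r - dist x y) \<subseteq> ball x r" by (simp add: ball_subset_ball_iff dist_commute)
    then have "S \<inter> ball y (r - dist x y) = line_of l \<inter> ball y (r - dist x y)" using r(2) by blast
    moreover have "r - dist x y > 0" using y by simp
    ultimately show "runs_along S l y" using y unfolding runs_along_def by blast
  qed
qed

lemma open_interval_if_connected:
  fixes I :: "real set"
  assumes "open I" "connected I" "bounded I" "I \<noteq> {}"
  obtains u w where "u < w" "I = {u<..<w}"
proof -
  have bdd: "bdd_above I" "bdd_below I" using assms(3) bounded_imp_bdd_above bounded_imp_bdd_below by auto
  define u where "u = Inf I"
  define w where "w = Sup I"
  have "I \<subseteq> {u<..<w}"
  proof
    fix s assume "s \<in> I"
    then obtain e where e: "e > 0" "cball s e \<subseteq> I" using assms(1) open_contains_cball by blast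
    have "s - e \<in> cball s e" "s + e \<in> cball s e" using e(1) by (auto simp: dist_norm)
    then have "s - e \<in> I" "s + e \<in> I" using e(2) by blast+
    then have "u \<le> s - e" "s + e \<le> w" unfolding u_def w_def using bdd by (auto intro: cInf_lower cSup_upper)
    then show "s \<in> {u<..<w}" using e(1) by auto
  qed
  moreover have "{u<..<w} \<subseteq> I"
  proof
    fix s assume s: "s \<in> {u<..<w}"
    obtain a where a: "a \<in> I" "a < s" using s cInf_lessD[OF assms(4), of s] by (auto simp: u_def)
    obtain b where b: "b \<in> I" "s < b" using s less_cSupE[OF _ assms(4), of s] by (auto simp: w_def)
    show "s \<in> I" using connected_contains_Icc[OF assms(2) a(1) b(1)] a(2) b(2) by auto
  qed
  ultimately have "I = {u<..<w}" by blast
  then show ?thesis using that assms(4) by (metis greaterThanLessThan_empty_iff not_le)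
qed

lemma diameter_closed_segment: "diameter (closed_segment a b) = dist a b" for a b :: "'a::euclidean_space"
proof (rule antisym)
  show "diameter (closed_segment a b) \<le> dist a b"
  proof (rule diameter_le)
    fix x y assume "x \<in> closed_segment a b" "y \<in> closed_segment a b"
    then obtain u w where u: "0 \<le> u" "u \<le> 1" "x = (1-u) *\<^sub>R a + u *\<^sub>R b" and w: "0 \<le> w" "w \<le> 1" "y = (1-w) *\<^sub>R a + w *\<^sub>R b"
      by (auto simp: closed_segment_def)
    have "x - y = (w - u) *\<^sub>R (a - b)" unfolding u(3) w(3) by (simp add: algebra_simps)
    then have "norm (x - y) = \<bar>w - u\<bar> * norm (a - b)" by simp
    also have "\<dots> \<le> 1 * norm (a - b)" using u w by (intro mult_right_mono) auto
    finally show "norm (x - y) \<le> dist a b" by (simp add: dist_norm)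
  qed auto
  show "dist a b \<le> diameter (closed_segment a b)" by (intro diameter_bounded_bound compact_imp_bounded) auto
qed

text \<open>The line along which the skeleton runs is locally constant, so a component of the edge points is
an open segment, and the diameter of its closure is its length.  There are finitely many
components, because each contains a cell.  The vertices do not contribute: a cell of the
skeleton with two points consists of edge points, so every vertex is a cell by itself.\<close>

theorem total_edge_length_eq_len:
  assumes P: "solid_polyhedron P" and L: "line_family \<L>" "skeleton P \<subseteq> covered \<L>"
  shows "total_edge_length P = len \<L> (skeleton P)"
    and "skeleton P \<in> sets borel" and "bounded (skeleton P)" and "finite (vertices P)"
proof -
  obtain H where H: "arrangement H" "union_of_cells H P" using solid_polyhedron_union_of_cells[OF P] .
  have finH: "finite H" using H(1) by (simp add: arrangement_def)
  have finL: "finite \<L>" and n1: "\<And>l. l \<in> \<L> \<Longrightarrow> norm (snd l) = 1" using L(1) by (auto simp: line_family_def)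
  define S where "S = skeleton P"
  define E where "E = edge_points P"
  have SH: "union_of_cells H S" unfolding S_def
    using union_of_cells_local[where f=skeleton, OF _ finH H(2)] germ_eq_skeleton by blast
  have EH: "union_of_cells H E" unfolding E_def
    using union_of_cells_local[where f=edge_points, OF _ finH H(2)] germ_eq_edge_points by blast
  have "S \<subseteq> P" using P frontier_subset_compact by (auto simp: S_def skeleton_def solid_polyhedron_def)
  then have bddS: "bounded S" using P compact_imp_bounded bounded_subset by (auto simp: solid_polyhedron_def)
  then show "bounded (skeleton P)" by (simp add: S_def)
  have E_runs: "\<exists>l\<in>\<L>. runs_along S l x" if xE: "x \<in> E" for x
  proof -
    obtain d r where d: "d \<noteq> 0" "r > 0" "S \<inter> ball x r = range (\<lambda>s. x + s *\<^sub>R d) \<inter> ball x r"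
      using xE unfolding E_def edge_points_def S_def by blast
    have "x + s *\<^sub>R d \<in> covered \<L>" if "s \<in> {0..<r / norm d}" for s
    proof -
      have "norm (s *\<^sub>R d) < r" using that d(1) by (simp add: pos_less_divide_eq)
      then have "x + s *\<^sub>R d \<in> ball x r" by (simp add: dist_norm)
      then have "x + s *\<^sub>R d \<in> S" using d(3) by blast
      then show ?thesis using L(2) S_def by blast
    qed
    moreover have "infinite {0..<r / norm d}" using d(1,2) by simp
    ultimately obtain l where l: "l \<in> \<L>" "line_of l = range (\<lambda>s. x + s *\<^sub>R d)"
      using finitely_many_lines[OF finL _ d(1)] by blast
    moreover have "x \<in> line_of l" unfolding l(2) by (rule range_eqI[of _ _ 0]) simp
    ultimately have "runs_along S l x" using d(2,3) unfolding runs_along_def by auto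
    then show ?thesis using l(1) by blast
  qed
  have runs_E: "x \<in> E" if "runs_along S l x" "l \<in> \<L>" for l x
    using edge_points_if_runs_along that n1 by (simp add: E_def S_def)
  have ES: "E \<subseteq> S"
  proof
    fix x assume "x \<in> E"
    then obtain l r where "x \<in> line_of l" "r > 0" "S \<inter> ball x r = line_of l \<inter> ball x r"
      using E_runs unfolding runs_along_def by blast
    then show "x \<in> S" using centre_in_ball by blast
  qed
  \<comment> \<open>A translation along the cell preserves the germ of \<open>S\<close>.  As \<open>S\<close> lies on finitely many lines,
    none of which misses \<open>x\<close> and comes close to it, \<open>S\<close> is near \<open>x\<close> the line in direction \<open>d\<close>.\<close>
  have long_cell: "x \<in> E" if x: "x \<in> S" and y: "y \<in> cell H x" "y \<noteq> x" for x y
  proof -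
    define d where "d = y - x"
    have d: "d \<noteq> 0" using y(2) by (simp add: d_def)
    obtain R where R: "R > 0" "\<And>v a b. norm v < R \<Longrightarrow> (a,b) \<in> H \<Longrightarrow>
       sgn (a \<bullet> (x + v) - b) = (if a \<bullet> x = b then sgn (a \<bullet> v) else sgn (a \<bullet> x - b))"
      using signs_near[OF finH] by blast
    have shift: "x + w \<in> S" if "x + v \<in> S" "norm v < R" "norm w < R" "w = v + s *\<^sub>R d" for v w s
    proof -
      have "sgn (a \<bullet> (x + v) - b) = sgn (a \<bullet> (x + w) - b)" if ab: "(a,b) \<in> H" for a b
      proof (cases "a \<bullet> x = b")
        case True
        have "sgn (a \<bullet> x - b) = sgn (a \<bullet> y - b)" using y(1) ab by (auto simp: cell_def same_side_def)
        then have "a \<bullet> y = b" using True by (simp add: sgn_if split: if_splits)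
        then have "a \<bullet> d = 0" using True by (simp add: d_def inner_diff_right)
        then show ?thesis using R(2)[OF \<open>norm v < R\<close> ab] R(2)[OF \<open>norm w < R\<close> ab] \<open>w = v + s *\<^sub>R d\<close> True
          by (simp add: inner_add_right)
      next
        case False
        then show ?thesis using R(2)[OF \<open>norm v < R\<close> ab] R(2)[OF \<open>norm w < R\<close> ab] by simp
      qed
      then have "same_side H (x+v) (x+w)" by (auto simp: same_side_def)
      then show ?thesis using SH that(1) unfolding union_of_cells_def by blast
    qed
    let ?M = "covered {l\<in>\<L>. x \<notin> line_of l}"
    have "closed (line_of l)" for l
    proof -
      have "line_of l = (+) (fst l) ` span {snd l}" unfolding line_of_def span_singleton by (simp add: image_image)
      then show ?thesis by (simp add: closed_translation)
    qed
    then have "closed ?M" unfolding covered_def using finL by (intro closed_UN) auto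
    then have "open (- ?M)" by (rule open_Compl)
    moreover have "x \<in> - ?M" by (auto simp: covered_def)
    ultimately obtain R2 where R2: "R2 > 0" "ball x R2 \<subseteq> - ?M" using open_contains_ball by blast
    define r where "r = min R R2"
    have r: "r > 0" "r \<le> R" "r \<le> R2" using R(1) R2(1) by (auto simp: r_def)
    have "S \<inter> ball x r = range (\<lambda>s. x + s *\<^sub>R d) \<inter> ball x r"
    proof (intro equalityI subsetI)
      fix z assume "z \<in> range (\<lambda>s. x + s *\<^sub>R d) \<inter> ball x r"
      then obtain s where s: "z = x + s *\<^sub>R d" "z \<in> ball x r" by blast
      moreover have "norm (s *\<^sub>R d) < r" using s by (simp add: dist_norm)
      ultimately show "z \<in> S \<inter> ball x r" using shift[of 0 "s *\<^sub>R d" s] x R(1) r by auto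
    next
      fix z assume z: "z \<in> S \<inter> ball x r"
      define v where "v = z - x"
      have v: "norm v < r" "z = x + v" using z by (auto simp: v_def dist_norm norm_minus_commute)
      have "z + s *\<^sub>R d \<in> covered \<L>" if s: "s \<in> {0..<(r - norm v) / norm d}" for s
      proof -
        have "norm (s *\<^sub>R d) < r - norm v" using s d by (simp add: pos_less_divide_eq)
        then have "norm (v + s *\<^sub>R d) < R" using norm_triangle_ineq[of v "s *\<^sub>R d"] r by linarith
        then have "x + (v + s *\<^sub>R d) \<in> S" using shift[of v "v + s *\<^sub>R d" s] z v r by auto
        then show ?thesis using L(2) v by (auto simp: S_def add.assoc)
      qed
      moreover have "infinite {0..<(r - norm v) / norm d}" using d v(1) by simp
      ultimately obtain l where l: "l \<in> \<L>" "line_of l = range (\<lambda>s. z + s *\<^sub>R d)"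
        using finitely_many_lines[OF finL _ d] by blast
      have "z \<in> line_of l" unfolding l(2) by (rule range_eqI[of _ _ 0]) simp
      moreover have "z \<in> ball x R2" using z r by auto
      then have "z \<notin> ?M" using R2(2) by blast
      ultimately have "x \<in> line_of l" using l(1) unfolding covered_def by blast
      then obtain s where "x = z + s *\<^sub>R d" unfolding l(2) by blast
      then have "z = x + (-s) *\<^sub>R d" by simp
      then show "z \<in> range (\<lambda>s. x + s *\<^sub>R d) \<inter> ball x r" using z by blast
    qed
    then show ?thesis unfolding E_def edge_points_def S_def using d r(1) by blast
  qed
  have "inj_on (cell H) (S - E)"
  proof (rule inj_onI)
    fix x y assume "x \<in> S - E" "y \<in> S - E" "cell H x = cell H y"
    then show "x = y" using long_cell[of x y] mem_cell[of y H] by auto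
  qed
  then have finV: "finite (S - E)" using finite_cells[OF finH] inj_on_finite by (metis subset_UNIV image_mono)
  then show "finite (vertices P)" by (simp add: vertices_def S_def E_def)

  have comp_line: "\<exists>l\<in>\<L>. \<forall>x\<in>C. runs_along S l x" if C: "C \<in> components E" for C
  proof -
    obtain x0 where x0: "x0 \<in> C" using C in_components_nonempty by blast
    then have "x0 \<in> E" using C in_components_subset by blast
    then obtain l where l: "l \<in> \<L>" "runs_along S l x0" using E_runs by blast
    have "(runs_along S l x0 \<longleftrightarrow> runs_along S l x)" if "x \<in> C" for x
    proof (rule connected_equivalence_relation[where R="\<lambda>x y. runs_along S l x \<longleftrightarrow> runs_along S l y", OF in_components_connected[OF C] x0 that])
      fix a assume a: "a \<in> C"
      then obtain m where m: "m \<in> \<L>" "runs_along S m a" using E_runs C in_components_subset by blast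
      obtain r where r: "r > 0" "S \<inter> ball a r = line_of m \<inter> ball a r" "\<And>y. y \<in> line_of m \<inter> ball a r \<Longrightarrow> runs_along S m y"
        using runs_along_nearby[OF m(2)] by blast
      have CS: "C \<subseteq> S" using C ES in_components_subset by blast
      have "runs_along S l a \<longleftrightarrow> runs_along S l y" if y: "y \<in> C \<inter> ball a r" for y
      proof -
        have my: "runs_along S m y" using r(2,3) y CS by blast
        have "runs_along S l z \<longleftrightarrow> line_of l = line_of m" if "runs_along S m z" for z
          using that runs_along_unique[OF _ that n1[OF l(1)] n1[OF m(1)]] unfolding runs_along_def by metis
        then show ?thesis using m(2) my by blast
      qed
      moreover have "openin (top_of_set C) (C \<inter> ball a r)" by (simp add: openin_open_Int)
      ultimately show "\<exists>T. openin (top_of_set C) T \<and> a \<in> T \<and> (\<forall>x\<in>T. runs_along S l a = runs_along S l x)"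
        using a r(1) by (intro exI[of _ "C \<inter> ball a r"]) auto
    qed auto
    then show ?thesis using l by blast
  qed

  have comp: "\<exists>A B. A \<noteq> B \<and> C = open_segment A B \<and> len \<L> C = dist A B" if C: "C \<in> components E" for C
  proof -
    obtain l where l: "l \<in> \<L>" "\<And>x. x \<in> C \<Longrightarrow> runs_along S l x" using comp_line[OF C] by blast
    have n: "norm (snd l) = 1" using n1 l(1) .
    let ?f = "\<lambda>s. fst l + s *\<^sub>R snd l"
    define I where "I = on_line l C"
    have "C \<subseteq> line_of l" using l(2) by (auto simp: runs_along_def)
    then have CI: "C = ?f ` I" unfolding I_def on_line_def line_of_def by auto
    have "open I"
      unfolding open_contains_ball
    proof
      fix s assume s: "s \<in> I"
      let ?x = "?f s"
      have "runs_along S l ?x" using s l(2) by (simp add: I_def on_line_def)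
      then obtain r where r: "r > 0" "\<And>y. y \<in> line_of l \<inter> ball ?x r \<Longrightarrow> runs_along S l y"
        using runs_along_nearby by metis
      have "?f ` ball s r \<subseteq> line_of l \<inter> ball ?x r"
        using n by (auto simp: line_of_def dist_norm dist_real_def simp flip: scaleR_diff_left)
      then have "?f ` ball s r \<subseteq> E" using r(2) runs_E[OF _ l(1)] by blast
      moreover have "connected (?f ` ball s r)" by (intro connected_continuous_image continuous_intros) auto
      moreover have "?x \<in> C \<inter> ?f ` ball s r" using s r(1) by (auto simp: I_def on_line_def)
      ultimately have "?f ` ball s r \<subseteq> C" using components_maximal[OF C] by blast
      then show "\<exists>e>0. ball s e \<subseteq> I" using r(1) unfolding I_def on_line_def by blast
    qed
    moreover have inv: "(?f s - fst l) \<bullet> snd l = s" for s using n by (simp add: norm_eq_1)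
    have II: "I = (\<lambda>y. (y - fst l) \<bullet> snd l) ` C" unfolding CI image_image inv by simp
    have "connected I" unfolding II
      by (intro connected_continuous_image continuous_intros in_components_connected[OF C])
    moreover have "C \<subseteq> S" using C ES in_components_subset by blast
    then have "bounded C" using bddS bounded_subset by blast
    then have "bounded I"
    proof -
      obtain B where B: "\<And>y. y \<in> C \<Longrightarrow> norm y \<le> B" using \<open>bounded C\<close> bounded_iff by blast
      have "norm ((y - fst l) \<bullet> snd l) \<le> B + norm (fst l)" if "y \<in> C" for y
        using Cauchy_Schwarz_ineq2[of "y - fst l" "snd l"] norm_triangle_ineq4[of y "fst l"] B[OF that] n by simp
      then show ?thesis unfolding II bounded_iff by blast
    qed
    moreover have "I \<noteq> {}" using CI in_components_nonempty[OF C] by blast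
    ultimately obtain u w where uw: "u < w" "I = {u<..<w}" using open_interval_if_connected by blast
    have seg: "open_segment (?f u) (?f w) = ?f ` {u<..<w}"
    proof (intro equalityI subsetI)
      fix z assume "z \<in> open_segment (?f u) (?f w)"
      then obtain k where k: "0 < k" "k < 1" "z = (1-k) *\<^sub>R ?f u + k *\<^sub>R ?f w" by (auto simp: in_segment)
      have "z = ?f (u + k * (w - u))" unfolding k(3) by (simp add: algebra_simps)
      moreover have "k * (w - u) < 1 * (w - u)" using k(2) uw(1) by (intro mult_strict_right_mono) auto
      moreover have "0 < k * (w - u)" using k(1) uw(1) by simp
      ultimately show "z \<in> ?f ` {u<..<w}" by auto
    next
      fix z assume "z \<in> ?f ` {u<..<w}"
      then obtain s where s: "u < s" "s < w" "z = ?f s" by auto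
      let ?k = "(s - u) / (w - u)"
      have k: "0 < ?k" "?k < 1" "u + ?k * (w - u) = s" using s uw(1) by (auto simp: field_simps)
      have "(1-k) *\<^sub>R ?f u + k *\<^sub>R ?f w = ?f (u + k * (w - u))" for k by (simp add: algebra_simps)
      from this[of ?k] have "z = (1 - ?k) *\<^sub>R ?f u + ?k *\<^sub>R ?f w" unfolding k(3) s(3) by simp
      moreover have "?f u \<noteq> ?f w" using inj_line[OF n] uw(1) by (auto simp: inj_on_def)
      ultimately show "z \<in> open_segment (?f u) (?f w)" unfolding in_segment using k(1,2) by blast
    qed
    have "?f u - ?f w = (u - w) *\<^sub>R snd l" by (simp add: scaleR_diff_left)
    then have dist: "dist (?f u) (?f w) = w - u" using n uw(1) by (simp add: dist_norm)
    have "len \<L> C = (w - u) * norm (snd l)"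
      unfolding CI uw(2)
    proof (rule len_segment[OF L(1) _ uw(1)])
      show "snd l \<noteq> 0" using n by auto
      show "?f ` {u<..<w} \<subseteq> covered \<L>" using l(1) by (auto simp: covered_def line_of_def)
    qed
    then show ?thesis using seg CI uw dist n
      by (intro exI[of _ "?f u"] exI[of _ "?f w"]) auto
  qed
  have cl: "closure C \<noteq> closure C'" if C: "C \<in> components E" "C' \<in> components E" "C \<noteq> C'" for C C'
  proof
    assume eq: "closure C = closure C'"
    obtain A B where A: "A \<noteq> B" "C = open_segment A B" using comp[OF C(1)] by blast
    obtain A' B' where A': "A' \<noteq> B'" "C' = open_segment A' B'" using comp[OF C(2)] by blast
    have "closed_segment A B = closed_segment A' B'" using eq A A' by simp
    then have "{A,B} = {A',B'}" by simp
    then have "C = C'" unfolding A(2) A'(2) open_segment_def by (simp only: \<open>closed_segment A B = closed_segment A' B'\<close>)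
    then show False using C(3) by simp
  qed
  have fin: "finite (components E)"
  proof -
    define g where "g C = cell H (SOME x. x \<in> C)" for C :: "(real^3) set"
    have g: "(SOME x. x \<in> C) \<in> C" "g C \<subseteq> C" if "C \<in> components E" for C
    proof -
      show *: "(SOME x. x \<in> C) \<in> C" using in_components_nonempty[OF that] some_in_eq by blast
      then have "(SOME x. x \<in> C) \<in> E" using that in_components_subset by blast
      then have "g C \<subseteq> E" unfolding g_def by (rule cell_subset[OF EH])
      moreover have "C \<inter> g C \<noteq> {}" unfolding g_def using * mem_cell by blast
      ultimately show "g C \<subseteq> C" using components_maximal[OF that] connected_cell unfolding g_def by blast
    qed
    have "inj_on g (components E)"
    proof (rule inj_onI)
      fix C C' assume C: "C \<in> components E" "C' \<in> components E" "g C = g C'"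
      have "(SOME x. x \<in> C) \<in> g C" unfolding g_def by (rule mem_cell)
      then have "C \<inter> C' \<noteq> {}" using g C by blast
      then show "C = C'" using components_nonoverlap[OF C(1,2)] by blast
    qed
    moreover have "g ` components E \<subseteq> range (cell H)" unfolding g_def by blast
    ultimately show ?thesis using finite_cells[OF finH] inj_on_finite by blast
  qed
  have borelC: "C \<in> sets borel" if C: "C \<in> components E" for C
  proof -
    obtain A B where "C = open_segment A B" using comp[OF C] by blast
    then have "C = closed_segment A B - {A,B}" by (simp add: open_segment_def)
    then show ?thesis by (auto intro!: sets.Diff borel_closed)
  qed
  have EU: "E = (\<Union>C\<in>components E. C)" using Union_components[of E] by simp
  have "(\<Union>C\<in>components E. C) \<in> sets borel" using fin borelC by (rule sets.finite_UN)
  then have borelE: "E \<in> sets borel" by (simp only: EU[symmetric])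
  moreover have "S - E \<in> sets borel" using finV by (intro borel_closed finite_imp_closed)
  ultimately have "E \<union> (S - E) \<in> sets borel" by (rule sets.Un)
  moreover have SE: "E \<union> (S - E) = S" using ES by blast
  ultimately show borelS: "skeleton P \<in> sets borel" by (simp add: S_def)
  have "total_edge_length P = (\<Sum>e\<in>closure ` components E. diameter e)"
    by (simp add: total_edge_length_def edges_def E_def)
  also have "\<dots> = (\<Sum>C\<in>components E. diameter (closure C))"
    using cl by (subst sum.reindex) (auto simp: inj_on_def)
  also have "\<dots> = (\<Sum>C\<in>components E. len \<L> C)"
  proof (rule sum.cong[OF refl])
    fix C assume "C \<in> components E"
    then obtain A B where "A \<noteq> B" "C = open_segment A B" "len \<L> C = dist A B" using comp by blast
    then show "diameter (closure C) = len \<L> C" by (simp add: diameter_closed_segment)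
  qed
  also have "\<dots> = len \<L> (\<Union>C\<in>components E. C)"
  proof (rule len_UN[symmetric, OF L(1) fin borelC])
    fix C assume "C \<in> components E"
    then show "bounded C" using bddS ES in_components_subset bounded_subset by (metis subset_trans)
  next
    fix C C' assume "C \<in> components E" "C' \<in> components E" "C \<noteq> C'"
    then have "C \<inter> C' = {}" using components_nonoverlap by blast
    then show "finite (C \<inter> C')" by simp
  qed
  also have "\<dots> = len \<L> E" by (simp only: EU[symmetric])
  also have "\<dots> = len \<L> S"
    using finV ES bddS bounded_subset by (intro len_cong[OF L(1) borelE]) (auto simp: Diff_eq_empty_iff[THEN iffD2])
  finally show "total_edge_length P = len \<L> (skeleton P)" by (simp add: S_def)
qed

lemma total_edge_length_nonneg:
  assumes "solid_polyhedron S" shows "total_edge_length S \<ge> 0"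
proof -
  obtain M where M: "finite M" "\<forall>l\<in>M. norm (snd l) = 1" "skeleton S \<subseteq> covered M"
    using skeleton_subset_lines[OF assms] unfolding covered_def by blast
  obtain \<L> where "line_family \<L>" "covered \<L> = covered M" using line_family_exists[OF M(1,2)] by blast
  then show ?thesis using total_edge_length_eq_len(1)[OF assms] M(3) len_nonneg by simp
qed

section \<open>Linear algebra of facets\<close>

text \<open>The coefficients come from Cramer's rule in the plane orthogonal to \<open>d\<close>.\<close>

lemma dependent_if_perp:
  fixes v1 v2 v3 d :: "real^3"
  assumes "d \<noteq> 0" "v1 \<bullet> d = 0" "v2 \<bullet> d = 0" "v3 \<bullet> d = 0"
  obtains c1 c2 c3 where "(c1,c2,c3) \<noteq> (0,0,0::real)" "c1 *\<^sub>R v1 + c2 *\<^sub>R v2 + c3 *\<^sub>R v3 = 0"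
proof -
  define c1 where "c1 = d \<bullet> cross3 v2 v3"
  define c2 where "c2 = d \<bullet> cross3 v3 v1"
  define c3 where "c3 = d \<bullet> cross3 v1 v2"
  show ?thesis
  proof (cases "(c1,c2,c3) = (0,0,0)")
    case False
    have id: "c1 *\<^sub>R v1 + c2 *\<^sub>R v2 + c3 *\<^sub>R v3 = (v1 \<bullet> cross3 v2 v3) *\<^sub>R d"
      unfolding c1_def c2_def c3_def by (simp add: cross3_simps forall_3)
    have "(v1 \<bullet> cross3 v2 v3) * (d \<bullet> d) = (c1 *\<^sub>R v1 + c2 *\<^sub>R v2 + c3 *\<^sub>R v3) \<bullet> d"
      unfolding id by simp
    also have "\<dots> = 0" using assms by (simp add: inner_add_left)
    finally have "v1 \<bullet> cross3 v2 v3 = 0" using assms(1) by simp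
    then show ?thesis using that[OF False] id by simp
  next
    case True
    have par: "cross3 v w = 0" if vw: "v \<bullet> d = 0" "w \<bullet> d = 0" "d \<bullet> cross3 v w = 0" for v w
    proof (rule ccontr)
      assume *: "cross3 v w \<noteq> 0"
      then obtain k where "d = k *\<^sub>R cross3 v w" using perp_cross vw(1,2) by blast
      then have "d \<bullet> d = k * (d \<bullet> cross3 v w)" by (metis inner_scaleR_right)
      then show False using vw(3) assms(1) by simp
    qed
    show ?thesis
    proof (cases "v1 = 0")
      case True
      then show ?thesis using that[of 1 0 0] by simp
    next
      case False
      have "cross3 v1 v2 = 0" using par[OF assms(2,3)] True c3_def by simp
      then obtain k where "v2 = k *\<^sub>R v1" using parallel_if_cross_0 False by blast
      then show ?thesis using that[of k "-1" 0] by simp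
    qed
  qed
qed

lemma signs_force_zero:
  fixes c1 c2 c3 :: real
  assumes "c2 * a + c3 * b = 0" "c1 * c + c3 * d = 0" "c1 * e + c2 * f = 0"
    and "a < 0" "b < 0" "c < 0" "d < 0" "e < 0" "f < 0"
  shows "c1 = 0 \<and> c2 = 0 \<and> c3 = 0"
proof -
  have opp: "(x > 0 \<longleftrightarrow> y < 0) \<and> (x < 0 \<longleftrightarrow> y > 0)" if "x * u + y * v = 0" "u < 0" "v < 0" for x y u v :: real
  proof -
    have "x * u = - (y * v)" using that(1) by simp
    then show ?thesis using that(2,3)
      by (metis neg_0_less_iff_less neg_less_0_iff_less mult_less_0_iff zero_less_mult_iff not_less_iff_gr_or_eq)
  qed
  show ?thesis using opp[OF assms(1,4,5)] opp[OF assms(2,6,7)] opp[OF assms(3,8,9)] by linarith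
qed

text \<open>Evaluated at \<open>q1\<close>, the relation says that a combination of two negative numbers with coefficients
\<open>c2\<close> and \<open>c3\<close> vanishes, so \<open>c2\<close> and \<open>c3\<close> have opposite signs or are both 0; likewise for the other
pairs.  Three numbers cannot have pairwise opposite signs.\<close>

lemma three_facets_relation:
  fixes f1 f2 f3 q1 q2 q3 n :: "real^3"
  assumes rel: "c1 *\<^sub>R f1 + c2 *\<^sub>R f2 + c3 *\<^sub>R f3 = k *\<^sub>R n"
    and "n \<bullet> q1 = 0 \<or> k = 0" "n \<bullet> q2 = 0 \<or> k = 0" "n \<bullet> q3 = 0 \<or> k = 0"
    and "f1 \<bullet> q1 = 0" "f2 \<bullet> q2 = 0" "f3 \<bullet> q3 = 0"
    and "f1 \<bullet> q2 < 0" "f1 \<bullet> q3 < 0" "f2 \<bullet> q1 < 0" "f2 \<bullet> q3 < 0" "f3 \<bullet> q1 < 0" "f3 \<bullet> q2 < 0"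
  shows "c1 = 0 \<and> c2 = 0 \<and> c3 = 0"
proof -
  have "c1 * (f1 \<bullet> q) + c2 * (f2 \<bullet> q) + c3 * (f3 \<bullet> q) = k * (n \<bullet> q)" for q
    using arg_cong[OF rel, of "\<lambda>v. v \<bullet> q"] by (simp add: inner_add_left)
  from this[of q1] this[of q2] this[of q3] show ?thesis
    using assms by (intro signs_force_zero[of c2 "f2 \<bullet> q1" c3 "f3 \<bullet> q1" c1 "f1 \<bullet> q2" "f3 \<bullet> q2" "f1 \<bullet> q3" "f2 \<bullet> q3"]) auto
qed

text \<open>Three facets, each with a point \<open>q\<close> of its own that is strictly inside the other two half-spaces,
cannot contain a common line.\<close>

lemma three_facets_no_common_direction:
  fixes f1 f2 f3 q1 q2 q3 d :: "real^3"
  assumes "d \<noteq> 0" "f1 \<bullet> d = 0" "f2 \<bullet> d = 0" "f3 \<bullet> d = 0"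
    and "f1 \<bullet> q1 = 0" "f2 \<bullet> q2 = 0" "f3 \<bullet> q3 = 0"
    and "f1 \<bullet> q2 < 0" "f1 \<bullet> q3 < 0" "f2 \<bullet> q1 < 0" "f2 \<bullet> q3 < 0" "f3 \<bullet> q1 < 0" "f3 \<bullet> q2 < 0"
  shows False
proof -
  obtain c1 c2 c3 where c: "(c1,c2,c3) \<noteq> (0,0,0::real)" "c1 *\<^sub>R f1 + c2 *\<^sub>R f2 + c3 *\<^sub>R f3 = 0"
    using dependent_if_perp[OF assms(1-4)] by blast
  have "c1 = 0 \<and> c2 = 0 \<and> c3 = 0"
    by (rule three_facets_relation[where k=0 and n=0 and ?f1.0=f1 and ?f2.0=f2 and ?f3.0=f3 and ?q1.0=q1 and ?q2.0=q2 and ?q3.0=q3]) (use c(2) assms in simp_all)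
  then show False using c(1) by simp
qed

lemma common_perp_if_det_0:
  fixes x y z :: "real^3"
  assumes "x \<bullet> cross3 y z = 0"
  obtains d where "d \<noteq> 0" "x \<bullet> d = 0" "y \<bullet> d = 0" "z \<bullet> d = 0"
proof (cases "cross3 y z = 0")
  case False
  then show ?thesis using that[of "cross3 y z"] assms by (simp add: dot_cross_self)
next
  case yz: True
  show ?thesis
  proof (cases "y = 0")
    case y: True
    show ?thesis
    proof (cases "cross3 x z = 0")
      case False
      then show ?thesis using that[of "cross3 x z"] y by (simp add: dot_cross_self)
    next
      case True
      obtain w :: "real^3" where w: "w \<noteq> 0" "\<exists>k l. x = k *\<^sub>R w \<and> z = l *\<^sub>R w"
      proof (cases "x = 0")
        case x: True
        show thesis
        proof (cases "z = 0")
          case True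
          then show thesis using x that[of "axis 1 1"] by (metis axis_eq_0_iff scaleR_zero_left zero_neq_one)
        next
          case False
          then show thesis using x that[of z] by (metis scaleR_one scaleR_zero_left)
        qed
      next
        case False
        then obtain k where "z = k *\<^sub>R x" using parallel_if_cross_0 \<open>cross3 x z = 0\<close> by blast
        then show thesis using False that[of x] by (metis scaleR_one)
      qed
      obtain d where "d \<noteq> 0" "orthogonal w d" using orthogonal_to_vector_exists[of w] by auto
      then show ?thesis using that[of d] w y by (auto simp: orthogonal_def)
    qed
  next
    case False
    then obtain k where k: "z = k *\<^sub>R y" using parallel_if_cross_0 yz by blast
    show ?thesis
    proof (cases "cross3 x y = 0")
      case False
      then show ?thesis using that[of "cross3 x y"] k by (simp add: dot_cross_self)
    next
      case True
      then have "cross3 y x = 0" using cross_skew[of y x] by simp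
      then obtain l where l: "x = l *\<^sub>R y" using parallel_if_cross_0 \<open>y \<noteq> 0\<close> by blast
      obtain d where "d \<noteq> 0" "orthogonal y d" using orthogonal_to_vector_exists[of y] by auto
      then show ?thesis using that[of d] k l by (auto simp: orthogonal_def)
    qed
  qed
qed

lemma uniform_delta:
  assumes "finite S" "\<And>x. x \<in> S \<Longrightarrow> \<exists>d>0. \<forall>s. \<bar>s\<bar> \<le> d \<longrightarrow> P x s"
  shows "\<exists>d>0::real. \<forall>x\<in>S. \<forall>s. \<bar>s\<bar> \<le> d \<longrightarrow> P x s"
  using assms
proof (induction S)
  case (insert x S)
  obtain d where "d > 0" "\<forall>x\<in>S. \<forall>s. \<bar>s\<bar> \<le> d \<longrightarrow> P x s" using insert by auto
  moreover obtain d' where "d' > 0" "\<forall>s. \<bar>s\<bar> \<le> d' \<longrightarrow> P x s" using insert.prems by auto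
  ultimately show ?case by (intro exI[of _ "min d d'"]) auto
qed (auto intro: exI[of _ 1])

lemma affine_pos_near_0:
  assumes "f > (0::real)" shows "\<exists>d>0. \<forall>s. \<bar>s\<bar> \<le> d \<longrightarrow> f + g * s > 0"
proof (intro exI[of _ "f / (\<bar>g\<bar> + 1)"] conjI allI impI)
  show "f / (\<bar>g\<bar> + 1) > 0" using assms by simp
  fix s assume "\<bar>s\<bar> \<le> f / (\<bar>g\<bar> + 1)"
  then have "\<bar>s\<bar> * (\<bar>g\<bar> + 1) \<le> f" by (simp add: pos_le_divide_eq)
  show "f + g * s > 0"
  proof (cases "s = 0")
    case False
    have "\<bar>g * s\<bar> < \<bar>s\<bar> * (\<bar>g\<bar> + 1)" using False by (simp add: abs_mult algebra_simps)
    then show ?thesis using \<open>\<bar>s\<bar> * (\<bar>g\<bar> + 1) \<le> f\<close> by linarith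
  qed (use assms in simp)
qed

text \<open>Piecewise linear with a kink at 0: slope \<open>m\<close> to the right and \<open>m'\<close> to the left.\<close>

definition env :: "real \<Rightarrow> real \<Rightarrow> real \<Rightarrow> real \<Rightarrow> real" where
  "env A m m' s = A + (if s \<ge> 0 then m else m') * s"

text \<open>Among the functions that attain the maximum at 0, the steepest one wins to the right of 0 and the
flattest one to the left.\<close>

lemma upper_envelope:
  fixes f g :: "'j \<Rightarrow> real"
  assumes "finite J" "J \<noteq> {}"
  shows "\<exists>A m m' \<delta>. \<delta> > 0 \<and> m' \<le> m \<and> (\<forall>s. \<bar>s\<bar> \<le> \<delta> \<longrightarrow>
    (\<forall>j\<in>J. f j + g j * s \<le> env A m m' s) \<and> (\<exists>j\<in>J. f j + g j * s = env A m m' s))"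
proof -
  define A where "A = Max (f ` J)"
  define J0 where "J0 = {j\<in>J. f j = A}"
  define m where "m = Max (g ` J0)"
  define m' where "m' = Min (g ` J0)"
  have "A \<in> f ` J" unfolding A_def using assms by (intro Max_in) auto
  then have J0: "finite J0" "J0 \<noteq> {}" using assms(1) by (auto simp: J0_def)
  have "\<exists>d>0. \<forall>s. \<bar>s\<bar> \<le> d \<longrightarrow> f j + g j * s \<le> env A m m' s" if "j \<in> J - J0" for j
  proof -
    have "A - f j > 0" using that assms(1) Max_ge[of "f ` J" "f j"] by (auto simp: J0_def A_def less_le)
    then obtain d d' where "d > 0" "\<forall>s. \<bar>s\<bar> \<le> d \<longrightarrow> (A - f j) + (m - g j) * s > 0"
        and "d' > 0" "\<forall>s. \<bar>s\<bar> \<le> d' \<longrightarrow> (A - f j) + (m' - g j) * s > 0"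
      using affine_pos_near_0 by metis
    moreover have "f j + g j * s \<le> env A m m' s" if "(A - f j) + (m - g j) * s > 0" "(A - f j) + (m' - g j) * s > 0" for s
      using that unfolding env_def left_diff_distrib by (cases "s \<ge> 0") simp_all
    ultimately show ?thesis by (intro exI[of _ "min d d'"]) simp
  qed
  then obtain d where d: "d > 0" "\<And>s j. \<bar>s\<bar> \<le> d \<Longrightarrow> j \<in> J - J0 \<Longrightarrow> f j + g j * s \<le> env A m m' s"
    using uniform_delta[of "J - J0" "\<lambda>j s. f j + g j * s \<le> env A m m' s"] assms(1) by (metis finite_Diff)
  have le0: "f j + g j * s \<le> env A m m' s" if "j \<in> J0" for j s
  proof -
    have "m' \<le> g j" "g j \<le> m" using that J0 by (auto simp: m_def m'_def)
    then have "s \<ge> 0 \<Longrightarrow> g j * s \<le> m * s" "s < 0 \<Longrightarrow> g j * s \<le> m' * s"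
      by (auto simp: mult_right_mono mult_right_mono_neg)
    then show ?thesis using that by (auto simp: env_def J0_def)
  qed
  have "m \<in> g ` J0" "m' \<in> g ` J0" unfolding m_def m'_def using J0 by (auto intro!: Max_in Min_in)
  then obtain j j' where j: "j \<in> J0" "g j = m" "j' \<in> J0" "g j' = m'" by blast
  show ?thesis
  proof (rule exI[of _ A], rule exI[of _ m], rule exI[of _ m'], rule exI[of _ d], intro conjI allI impI ballI)
    show "d > 0" by (rule d(1))
    show "m' \<le> m" unfolding m_def m'_def using J0 Min_le Max_ge by (metis Max_in Min_le finite_imageI image_is_empty)
    show "f j + g j * s \<le> env A m m' s" if "\<bar>s\<bar> \<le> d" "j \<in> J" for s j
      using d(2)[OF that(1), of j] le0[of j s] that(2) by blast
    show "\<exists>j\<in>J. f j + g j * s = env A m m' s" for s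
    proof (cases "s \<ge> 0")
      case True
      then show ?thesis using j(1,2) by (intro bexI[of _ j]) (auto simp: env_def J0_def)
    next
      case False
      then show ?thesis using j(3,4) by (intro bexI[of _ j']) (auto simp: env_def J0_def)
    qed
  qed
qed

text \<open>The horizontal direction in a facet with normal \<open>a\<close>.\<close>

definition edir :: "real^3 \<Rightarrow> real^3 \<Rightarrow> real^3" where
  "edir n a = cross3 n a /\<^sub>R norm (cross3 n a)"

text \<open>Coordinates in a facet: \<open>\<beta>\<close> climbs by one unit of height, \<open>edir n a\<close> is horizontal.\<close>

lemma facet_frame:
  fixes n a :: "real^3"
  assumes "norm n = 1" "norm a = 1" "cross3 n a \<noteq> 0"
  obtains \<beta> where "norm (edir n a) = 1" "a \<bullet> edir n a = 0" "n \<bullet> edir n a = 0"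
    "a \<bullet> \<beta> = 0" "n \<bullet> \<beta> = 1" "edir n a \<bullet> \<beta> = 0"
    "\<And>w. a \<bullet> w = 0 \<Longrightarrow> w = (n \<bullet> w) *\<^sub>R \<beta> + (edir n a \<bullet> w) *\<^sub>R edir n a"
proof -
  define e where "e = edir n a"
  define N where "N = norm (cross3 n a)"
  have N: "N > 0" using assms(3) by (simp add: N_def)
  define \<beta> where "\<beta> = (1 / N\<^sup>2) *\<^sub>R cross3 a (cross3 n a)"
  have e: "e = (1 / N) *\<^sub>R cross3 n a" by (simp add: e_def edir_def N_def divide_inverse)
  have e1: "norm e = 1" using N by (simp add: e) (simp add: N_def)
  have ae: "a \<bullet> e = 0" "n \<bullet> e = 0" by (simp_all add: e dot_cross_self)
  have ab: "a \<bullet> \<beta> = 0" "e \<bullet> \<beta> = 0" by (simp_all add: \<beta>_def e dot_cross_self)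
  have aa: "a \<bullet> a = 1" "n \<bullet> n = 1" using assms(1,2) by (simp_all add: norm_eq_1)
  have "N\<^sup>2 = 1 - (n \<bullet> a)\<^sup>2" using norm_cross[of n a] assms(1,2) by (simp add: N_def)
  moreover have "n \<bullet> cross3 a (cross3 n a) = 1 - (n \<bullet> a)\<^sup>2"
    unfolding Lagrange using aa by (simp add: inner_diff_right inner_commute power2_eq_square)
  ultimately have "n \<bullet> cross3 a (cross3 n a) = N\<^sup>2" by simp
  then have nb: "n \<bullet> \<beta> = 1" using N by (simp add: \<beta>_def)
  show ?thesis
  proof (rule that[of \<beta>])
    fix w assume w: "a \<bullet> w = 0"
    define u where "u = w - (n \<bullet> w) *\<^sub>R \<beta> - (e \<bullet> w) *\<^sub>R e"
    have "e \<bullet> e = 1" using e1 by (simp add: norm_eq_1)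
    then have u: "n \<bullet> u = 0" "a \<bullet> u = 0" "e \<bullet> u = 0"
      using w ae ab nb by (simp_all add: u_def inner_diff_right)
    then obtain k where "u = k *\<^sub>R cross3 n a" using perp_cross assms(3) by blast
    then have "u = (k * N) *\<^sub>R e" using N by (simp add: e)
    then have "u = 0" using u(3) \<open>e \<bullet> e = 1\<close> by simp
    then show "w = (n \<bullet> w) *\<^sub>R \<beta> + (edir n a \<bullet> w) *\<^sub>R edir n a" unfolding u_def e_def by (simp add: algebra_simps)
  qed (use e1 ae ab nb in \<open>auto simp: e_def\<close>)
qed

section \<open>Facets of a convex polyhedron near a level\<close>

lemma open_interval_image_borel:
  fixes v :: "real^3"
  assumes "v \<noteq> 0" shows "(\<lambda>s. p + s *\<^sub>R v) ` {u<..<w} \<in> sets borel" and "bounded ((\<lambda>s. p + s *\<^sub>R v) ` {u<..<w})"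
proof -
  have c: "compact ((\<lambda>s. p + s *\<^sub>R v) ` {u..w})" by (intro compact_continuous_image continuous_intros) auto
  have "(\<lambda>s. p + s *\<^sub>R v) ` {u<..<w} = (\<lambda>s. p + s *\<^sub>R v) ` {u..w} - {p + u *\<^sub>R v, p + w *\<^sub>R v}"
    using assms by (auto simp: less_le)
  moreover have "(\<lambda>s. p + s *\<^sub>R v) ` {u..w} \<in> sets borel" using c compact_imp_closed borel_closed by blast
  ultimately show "(\<lambda>s. p + s *\<^sub>R v) ` {u<..<w} \<in> sets borel" by (auto intro!: sets.Diff)
  show "bounded ((\<lambda>s. p + s *\<^sub>R v) ` {u<..<w})"
    using compact_imp_bounded[OF c] by (rule bounded_subset) auto
qed

lemma len_two_segments:
  assumes "line_family \<L>" "v \<noteq> 0" "v' \<noteq> 0" "u < w"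
    and "(\<lambda>s. p + s *\<^sub>R v) ` {u<..<w} \<inter> (\<lambda>s. p' + s *\<^sub>R v') ` {u<..<w} = {}"
    and "(\<lambda>s. p + s *\<^sub>R v) ` {u<..<w} \<union> (\<lambda>s. p' + s *\<^sub>R v') ` {u<..<w} \<subseteq> covered \<L>"
  shows "len \<L> ((\<lambda>s. p + s *\<^sub>R v) ` {u<..<w} \<union> (\<lambda>s. p' + s *\<^sub>R v') ` {u<..<w}) = (w - u) * (norm v + norm v')"
proof -
  have "len \<L> ((\<lambda>s. p + s *\<^sub>R v) ` {u<..<w} \<union> (\<lambda>s. p' + s *\<^sub>R v') ` {u<..<w}) =
    len \<L> ((\<lambda>s. p + s *\<^sub>R v) ` {u<..<w}) + len \<L> ((\<lambda>s. p' + s *\<^sub>R v') ` {u<..<w})"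
    using open_interval_image_borel assms(2,3,5) by (intro len_Un[OF assms(1)]) auto
  also have "\<dots> = (w - u) * norm v + (w - u) * norm v'"
    using assms(6) len_segment[OF assms(1,2,4), of p] len_segment[OF assms(1,3,4), of p'] by simp
  finally show ?thesis by (simp add: distrib_left)
qed

lemma diameter_interval_image:
  fixes e :: "'a::euclidean_space"
  assumes "norm e = 1" shows "diameter ((\<lambda>c. z + c *\<^sub>R e) ` {u..w}) = max 0 (w - u)"
proof (cases "u \<le> w")
  case True
  have d: "dist (z + c *\<^sub>R e) (z + c' *\<^sub>R e) = \<bar>c - c'\<bar>" for c c'
    using assms by (simp add: dist_norm flip: scaleR_diff_left)
  have "diameter ((\<lambda>c. z + c *\<^sub>R e) ` {u..w}) = w - u"
  proof (rule antisym)
    show "diameter ((\<lambda>c. z + c *\<^sub>R e) ` {u..w}) \<le> w - u"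
    proof (rule diameter_le)
      fix x y assume "x \<in> (\<lambda>c. z + c *\<^sub>R e) ` {u..w}" "y \<in> (\<lambda>c. z + c *\<^sub>R e) ` {u..w}"
      then obtain c c' where "x = z + c *\<^sub>R e" "y = z + c' *\<^sub>R e" "c \<in> {u..w}" "c' \<in> {u..w}" by blast
      then show "norm (x - y) \<le> w - u" using d[of c c'] by (auto simp: dist_norm)
    qed (use True in auto)
    have "compact ((\<lambda>c. z + c *\<^sub>R e) ` {u..w})" by (intro compact_continuous_image continuous_intros) auto
    then have "dist (z + w *\<^sub>R e) (z + u *\<^sub>R e) \<le> diameter ((\<lambda>c. z + c *\<^sub>R e) ` {u..w})"
      using True by (intro diameter_bounded_bound compact_imp_bounded) auto
    then show "w - u \<le> diameter ((\<lambda>c. z + c *\<^sub>R e) ` {u..w})" unfolding d using True by simp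
  qed
  then show ?thesis using True by simp
next
  case False
  then show ?thesis by (simp add: diameter_def)
qed

definition poly_of :: "((real^3) \<times> real) set \<Rightarrow> (real^3) set" where
  "poly_of I = {y. \<forall>i\<in>I. fst i \<bullet> y \<le> snd i}"

lemma convex_poly_of: "convex (poly_of J)" and closed_poly_of: "closed (poly_of J)"
proof -
  have "poly_of J = (\<Inter>i\<in>J. {y. fst i \<bullet> y \<le> snd i})" by (auto simp: poly_of_def)
  then show "convex (poly_of J)" "closed (poly_of J)"
    by (auto intro!: convex_INT convex_halfspace_le closed_INT closed_halfspace_le)
qed

text \<open>The convex polyhedron \<open>poly_of I\<close> near its section at height \<open>h\<close>.  Every facet meets this section,
and below it has a point of its own, so there are no redundant half-spaces.  The point \<open>p0\<close> lies
in the relative interior of the section.\<close>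

locale facet_slab =
  fixes n :: "real^3" and h :: real and I :: "((real^3) \<times> real) set" and p0 :: "real^3" and \<delta>0 :: real
  assumes fin: "finite I" and n1: "norm n = 1" and a1: "i \<in> I \<Longrightarrow> norm (fst i) = 1"
    and touch: "i \<in> I \<Longrightarrow> \<exists>p\<in>poly_of I. n \<bullet> p = h \<and> fst i \<bullet> p = snd i"
    and own: "i \<in> I \<Longrightarrow> \<exists>q. fst i \<bullet> q = snd i \<and> n \<bullet> q < h \<and> (\<forall>j\<in>I-{i}. fst j \<bullet> q < snd j)"
    and centre: "n \<bullet> p0 = h" "j \<in> I \<Longrightarrow> fst j \<bullet> p0 < snd j"
    and bdd: "\<delta>0 > 0" "bounded (poly_of I \<inter> {y. \<bar>n \<bullet> y - h\<bar> \<le> \<delta>0})"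
begin

definition slice :: "(real^3) \<times> real \<Rightarrow> real \<Rightarrow> (real^3) set" where
  "slice i s = {y \<in> poly_of I. fst i \<bullet> y = snd i \<and> n \<bullet> y = h + s}"

definition ridges :: "real \<Rightarrow> real \<Rightarrow> (real^3) \<times> real \<Rightarrow> (real^3) set" where
  "ridges u w i = {y \<in> poly_of I. u < n \<bullet> y - h \<and> n \<bullet> y - h < w \<and> fst i \<bullet> y = snd i \<and> (\<exists>j\<in>I-{i}. fst j \<bullet> y = snd j)}"

lemma no_three_facets_on_line:
  assumes "i \<in> I" "j \<in> I" "k \<in> I" "i \<noteq> j" "j \<noteq> k" "i \<noteq> k"
    and "fst i \<bullet> y = snd i" "fst j \<bullet> y = snd j" "fst k \<bullet> y = snd k"
    and "fst i \<bullet> y' = snd i" "fst j \<bullet> y' = snd j" "fst k \<bullet> y' = snd k"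
  shows "y = y'"
proof (rule ccontr)
  assume "y \<noteq> y'"
  obtain qi where qi: "fst i \<bullet> qi = snd i" "\<And>j. j \<in> I - {i} \<Longrightarrow> fst j \<bullet> qi < snd j" using own assms(1) by blast
  obtain qj where qj: "fst j \<bullet> qj = snd j" "\<And>i. i \<in> I - {j} \<Longrightarrow> fst i \<bullet> qj < snd i" using own assms(2) by blast
  obtain qk where qk: "fst k \<bullet> qk = snd k" "\<And>i. i \<in> I - {k} \<Longrightarrow> fst i \<bullet> qk < snd i" using own assms(3) by blast
  show False
    by (rule three_facets_no_common_direction[where d="y' - y" and ?f1.0="fst i" and ?f2.0="fst j" and ?f3.0="fst k"
          and ?q1.0="qi - y" and ?q2.0="qj - y" and ?q3.0="qk - y"])
      (use assms qi qj qk \<open>y \<noteq> y'\<close> in \<open>simp_all add: inner_diff_right\<close>)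
qed

text \<open>Otherwise the two facets and the plane \<open>n \<bullet> y = h\<close> would contain a common line, and \<open>p0\<close> is the
point of its own for this plane.\<close>

lemma facets_cross_level:
  assumes "i \<in> I" "j \<in> I" "i \<noteq> j" "fst i \<bullet> y = snd i" "fst j \<bullet> y = snd j" "n \<bullet> y = h"
  shows "n \<bullet> cross3 (fst i) (fst j) \<noteq> 0"
proof
  assume "n \<bullet> cross3 (fst i) (fst j) = 0"
  then obtain d where d: "d \<noteq> 0" "n \<bullet> d = 0" "fst i \<bullet> d = 0" "fst j \<bullet> d = 0" by (rule common_perp_if_det_0)
  obtain qi where qi: "fst i \<bullet> qi = snd i" "n \<bullet> qi < h" "\<And>j. j \<in> I - {i} \<Longrightarrow> fst j \<bullet> qi < snd j" using own assms(1) by blast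
  obtain qj where qj: "fst j \<bullet> qj = snd j" "n \<bullet> qj < h" "\<And>i. i \<in> I - {j} \<Longrightarrow> fst i \<bullet> qj < snd i" using own assms(2) by blast
  show False
    by (rule three_facets_no_common_direction[where d=d and ?f1.0="fst i" and ?f2.0="fst j" and ?f3.0=n
          and ?q1.0="qi - y" and ?q2.0="qj - y" and ?q3.0="p0 - y"])
      (use assms qi qj d centre in \<open>simp_all add: inner_diff_right\<close>)
qed

lemma cross_nonzero:
  assumes "i \<in> I" shows "cross3 n (fst i) \<noteq> 0"
proof
  assume "cross3 n (fst i) = 0"
  moreover have "n \<noteq> 0" using n1 by auto
  ultimately obtain k where k: "fst i = k *\<^sub>R n" by (rule parallel_if_cross_0)
  obtain p where "n \<bullet> p = h" "fst i \<bullet> p = snd i" using touch[OF assms] by blast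
  then show False using centre(1) centre(2)[OF assms] k by simp
qed

text \<open>In the coordinates of \<open>facet_frame\<close> every other half-space that is not horizontal in this facet bounds the horizontal
coordinate \<open>c\<close> from above or from below by an affine function of the height \<open>s\<close>.  So the section at height
\<open>h + s\<close> reaches from the maximum of the lower bounds to the minimum of the upper bounds, and both
are linear on either side of 0 for small \<open>s\<close>.  The remaining half-spaces are inactive near the
height \<open>h\<close> by \<open>facets_cross_level\<close>.  Below \<open>h\<close> the section is a proper segment, because the facet
has a point of its own there and the length of the section is concave.\<close>

lemma facet_coordinates:
  assumes i: "i \<in> I"
  obtains p \<beta> A m m' B k k' \<delta> where
    "\<beta> \<noteq> 0" "edir n (fst i) \<bullet> \<beta> = 0" "n \<bullet> \<beta> = 1" "n \<bullet> p = h"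
    "m' \<le> m" "k \<le> k'" "A \<le> B" "\<delta> > 0"
    "\<And>y s. y \<in> poly_of I \<Longrightarrow> fst i \<bullet> y = snd i \<Longrightarrow> n \<bullet> y = h + s \<Longrightarrow> \<exists>c. y = p + s *\<^sub>R \<beta> + c *\<^sub>R edir n (fst i)"
    "\<And>s c. \<bar>s\<bar> \<le> \<delta> \<Longrightarrow> p + s *\<^sub>R \<beta> + c *\<^sub>R edir n (fst i) \<in> poly_of I \<longleftrightarrow> env A m m' s \<le> c \<and> c \<le> env B k k' s"
    "\<And>s c. fst i \<bullet> (p + s *\<^sub>R \<beta> + c *\<^sub>R edir n (fst i)) = snd i" 
    "\<And>s c. n \<bullet> (p + s *\<^sub>R \<beta> + c *\<^sub>R edir n (fst i)) = h + s" 
    "\<And>s c. \<bar>s\<bar> \<le> \<delta> \<Longrightarrow> p + s *\<^sub>R \<beta> + c *\<^sub>R edir n (fst i) \<in> poly_of I \<Longrightarrow>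
      (\<exists>j\<in>I-{i}. fst j \<bullet> (p + s *\<^sub>R \<beta> + c *\<^sub>R edir n (fst i)) = snd j) \<longleftrightarrow> c = env A m m' s \<or> c = env B k k' s"
    "\<And>s j c. \<bar>s\<bar> \<le> \<delta> \<Longrightarrow> j \<in> I-{i} \<Longrightarrow> fst j \<bullet> (p + s *\<^sub>R \<beta> + c *\<^sub>R edir n (fst i)) = snd j \<Longrightarrow> fst j \<bullet> edir n (fst i) \<noteq> 0"
    "\<And>s. -\<delta> \<le> s \<Longrightarrow> s < 0 \<Longrightarrow> env A m m' s < env B k k' s"
proof -
  define a where "a = fst i"
  define e where "e = edir n a"
  have ci: "cross3 n a \<noteq> 0" using cross_nonzero[OF i] by (simp add: a_def)
  obtain \<beta> where e1: "norm e = 1" and ae: "a \<bullet> e = 0" and ne: "n \<bullet> e = 0"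
    and ab: "a \<bullet> \<beta> = 0" and nb: "n \<bullet> \<beta> = 1" and eb: "e \<bullet> \<beta> = 0"
    and dec: "\<And>w. a \<bullet> w = 0 \<Longrightarrow> w = (n \<bullet> w) *\<^sub>R \<beta> + (e \<bullet> w) *\<^sub>R e"
    using facet_frame[OF n1 a1[OF i] ci[unfolded a_def]] unfolding e_def a_def by blast
  obtain p where p: "p \<in> poly_of I" "n \<bullet> p = h" "a \<bullet> p = snd i" using touch[OF i] unfolding a_def by blast
  obtain q where q: "a \<bullet> q = snd i" "n \<bullet> q < h" "\<And>j. j \<in> I - {i} \<Longrightarrow> fst j \<bullet> q < snd j" using own[OF i] unfolding a_def by blast
  define pt where "pt s c = p + s *\<^sub>R \<beta> + c *\<^sub>R e" for s c
  have pt_a: "a \<bullet> pt s c = snd i" and pt_n: "n \<bullet> pt s c = h + s" for s c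
    using p ab ae nb ne by (simp_all add: pt_def inner_add_right)
  have pt_ex: "y = pt (n \<bullet> y - h) (e \<bullet> (y - p))" if "a \<bullet> y = snd i" for y
    using dec[of "y - p"] that p by (simp add: pt_def inner_diff_right algebra_simps)
  define g0 where "g0 j = (snd j - fst j \<bullet> p) / (fst j \<bullet> e)" for j :: "(real^3) \<times> real"
  define g1 where "g1 j = - (fst j \<bullet> \<beta>) / (fst j \<bullet> e)" for j :: "(real^3) \<times> real"
  have val: "fst j \<bullet> pt s c = snd j + (c - (g0 j + g1 j * s)) * (fst j \<bullet> e)" if "fst j \<bullet> e \<noteq> 0" for j s c
    using that by (simp add: pt_def g0_def g1_def inner_add_right field_simps)
  define J0 where "J0 = {j\<in>I-{i}. fst j \<bullet> e = 0}"
  define Jp where "Jp = {j\<in>I-{i}. fst j \<bullet> e > 0}"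
  define Jm where "Jm = {j\<in>I-{i}. fst j \<bullet> e < 0}"
  have finJ: "finite J0" "finite Jp" "finite Jm" using fin by (auto simp: J0_def Jp_def Jm_def)
  have split: "j \<in> J0 \<or> j \<in> Jp \<or> j \<in> Jm" if "j \<in> I - {i}" for j
    using that by (auto simp: J0_def Jp_def Jm_def)
  have slack0: "fst j \<bullet> p < snd j" if "j \<in> J0" for j
  proof (rule ccontr)
    assume "\<not> fst j \<bullet> p < snd j"
    moreover have "fst j \<bullet> p \<le> snd j" using p(1) that by (auto simp: poly_of_def J0_def)
    ultimately have "n \<bullet> cross3 a (fst j) \<noteq> 0"
      unfolding a_def using that i p by (intro facets_cross_level[of i j p]) (auto simp: J0_def a_def)
    moreover have "n \<bullet> cross3 a (fst j) = fst j \<bullet> cross3 n a"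
      using cross_triple[of a "fst j" n] cross_triple[of "fst j" n a] by (simp add: inner_commute)
    moreover have "fst j \<bullet> cross3 n a = 0"
      using that ci by (simp add: J0_def e_def edir_def)
    ultimately show False by simp
  qed
  have "\<exists>d>0. \<forall>s. \<bar>s\<bar> \<le> d \<longrightarrow> fst j \<bullet> p + s * (fst j \<bullet> \<beta>) < snd j" if "j \<in> J0" for j
    using affine_pos_near_0[of "snd j - fst j \<bullet> p" "- (fst j \<bullet> \<beta>)"] slack0[OF that] by (simp add: algebra_simps)
  then obtain d0 where d0: "d0 > 0" "\<And>j s. j \<in> J0 \<Longrightarrow> \<bar>s\<bar> \<le> d0 \<Longrightarrow> fst j \<bullet> p + s * (fst j \<bullet> \<beta>) < snd j"
    using uniform_delta[OF finJ(1), of "\<lambda>j s. fst j \<bullet> p + s * (fst j \<bullet> \<beta>) < snd j"] by blast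
  have J0_slack: "fst j \<bullet> pt s c < snd j" if "j \<in> J0" "\<bar>s\<bar> \<le> d0" for j s c
    using d0(2)[OF that] that(1) by (simp add: pt_def inner_add_right J0_def)
  \<comment> \<open>A section without an upper or a lower bound would contain a ray, but the slab is bounded.\<close>
  have unb: False if "\<And>c. c \<ge> 0 \<Longrightarrow> p + (\<sigma> * c) *\<^sub>R e \<in> poly_of I" "\<sigma> = 1 \<or> \<sigma> = -1" for \<sigma> :: real
  proof -
    obtain M where M: "\<And>y. y \<in> poly_of I \<Longrightarrow> \<bar>n \<bullet> y - h\<bar> \<le> \<delta>0 \<Longrightarrow> norm y \<le> M"
      using bdd(2) unfolding bounded_iff by blast
    define c where "c = \<bar>M\<bar> + norm p + 1"
    have c: "c \<ge> 0" by (simp add: c_def)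
    have "n \<bullet> (p + (\<sigma> * c) *\<^sub>R e) = h" using p(2) ne by (simp add: inner_add_right)
    then have "norm (p + (\<sigma> * c) *\<^sub>R e) \<le> M" using M[OF that(1)[OF c]] bdd(1) by simp
    moreover have "norm ((\<sigma> * c) *\<^sub>R e) = c" using that(2) e1 c by (auto simp: abs_mult)
    ultimately have "c \<le> M + norm p" using norm_triangle_ineq4[of "p + (\<sigma> * c) *\<^sub>R e" p] by simp
    then show False unfolding c_def by linarith
  qed
  have half: "\<exists>j\<in>I-{i}. \<sigma> * (fst j \<bullet> e) > 0" if "\<sigma> = 1 \<or> \<sigma> = -1" for \<sigma> :: real
  proof (rule ccontr)
    assume *: "\<not> ?thesis"
    have "p + (\<sigma> * c) *\<^sub>R e \<in> poly_of I" if "c \<ge> 0" for c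
      unfolding poly_of_def
    proof clarify
      fix f b assume j: "(f, b) \<in> I"
      have "fst (f,b) \<bullet> p \<le> snd (f,b)" using p(1) j unfolding poly_of_def by blast
      moreover have "\<sigma> * (f \<bullet> e) \<le> 0"
      proof (cases "(f,b) = i")
        case True
        then have "f = a" by (auto simp: a_def)
        then show ?thesis using ae by simp
      next
        case False
        then have "(f,b) \<in> I - {i}" using j by blast
        then have "\<not> \<sigma> * (fst (f,b) \<bullet> e) > 0" using * by blast
        then show ?thesis by simp
      qed
      then have "c * (\<sigma> * (f \<bullet> e)) \<le> 0" by (rule mult_nonneg_nonpos[OF that])
      ultimately show "fst (f,b) \<bullet> (p + (\<sigma> * c) *\<^sub>R e) \<le> snd (f,b)" by (simp add: inner_add_right algebra_simps)
    qed
    then show False using unb that by blast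
  qed
  obtain jp jm where "jp \<in> I-{i}" "1 * (fst jp \<bullet> e) > 0" "jm \<in> I-{i}" "-1 * (fst jm \<bullet> e) > 0"
    using half[of 1] half[of "-1"] by blast
  then have "jp \<in> Jp" "jm \<in> Jm" by (simp_all add: Jp_def Jm_def)
  then have ne: "Jp \<noteq> {}" "Jm \<noteq> {}" by blast+
  obtain A m m' d1 where env1: "d1 > 0 \<and> m' \<le> m \<and> (\<forall>s. \<bar>s\<bar> \<le> d1 \<longrightarrow>
    (\<forall>j\<in>Jm. g0 j + g1 j * s \<le> env A m m' s) \<and> (\<exists>j\<in>Jm. g0 j + g1 j * s = env A m m' s))"
    using upper_envelope[OF finJ(3) ne(2), of g0 g1] by blast
  have d1: "d1 > 0" "m' \<le> m"
    "\<And>s j. \<bar>s\<bar> \<le> d1 \<Longrightarrow> j \<in> Jm \<Longrightarrow> g0 j + g1 j * s \<le> env A m m' s"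
    "\<And>s. \<bar>s\<bar> \<le> d1 \<Longrightarrow> \<exists>j\<in>Jm. g0 j + g1 j * s = env A m m' s"
    using env1 by blast+
  obtain B' k0 k0' d2 where env2: "d2 > 0 \<and> k0' \<le> k0 \<and> (\<forall>s. \<bar>s\<bar> \<le> d2 \<longrightarrow>
    (\<forall>j\<in>Jp. (- g0 j) + (- g1 j) * s \<le> env B' k0 k0' s) \<and> (\<exists>j\<in>Jp. (- g0 j) + (- g1 j) * s = env B' k0 k0' s))"
    using upper_envelope[OF finJ(2) ne(1), of "\<lambda>j. - g0 j" "\<lambda>j. - g1 j"] by blast
  have d2: "d2 > 0" "k0' \<le> k0"
    "\<And>s j. \<bar>s\<bar> \<le> d2 \<Longrightarrow> j \<in> Jp \<Longrightarrow> (- g0 j) + (- g1 j) * s \<le> env B' k0 k0' s"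
    "\<And>s. \<bar>s\<bar> \<le> d2 \<Longrightarrow> \<exists>j\<in>Jp. (- g0 j) + (- g1 j) * s = env B' k0 k0' s"
    using env2 by blast+
  define B where "B = - B'"
  define k where "k = - k0"
  define k' where "k' = - k0'"
  have envB: "env B k k' s = - env B' k0 k0' s" for s by (simp add: env_def B_def k_def k'_def)
  have Jp_le: "env B k k' s \<le> g0 j + g1 j * s" if "\<bar>s\<bar> \<le> d2" "j \<in> Jp" for s j
    using d2(3)[OF that] envB by simp
  have Jp_eq: "\<exists>j\<in>Jp. g0 j + g1 j * s = env B k k' s" if s: "\<bar>s\<bar> \<le> d2" for s
  proof -
    obtain j where "j \<in> Jp" "(- g0 j) + (- g1 j) * s = env B' k0 k0' s" using d2(4)[OF s] by blast
    then show ?thesis unfolding envB by (intro bexI[of _ j]) simp_all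
  qed
  define sq where "sq = n \<bullet> q - h"
  define cq where "cq = e \<bullet> (q - p)"
  have sq: "sq < 0" using q(2) by (simp add: sq_def)
  have q_pt: "q = pt sq cq" unfolding sq_def cq_def by (rule pt_ex[OF q(1)])
  define \<delta> where "\<delta> = min (min d0 d1) (min d2 (- sq))"
  have \<delta>: "\<delta> > 0" "\<delta> \<le> d0" "\<delta> \<le> d1" "\<delta> \<le> d2" "\<delta> \<le> - sq" using d0(1) d1(1) d2(1) sq by (auto simp: \<delta>_def)
  have Jp_iff: "fst j \<bullet> pt s c \<le> snd j \<longleftrightarrow> c \<le> g0 j + g1 j * s" "fst j \<bullet> pt s c = snd j \<longleftrightarrow> c = g0 j + g1 j * s"
     "fst j \<bullet> pt s c < snd j \<longleftrightarrow> c < g0 j + g1 j * s" if "j \<in> Jp" for j s c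
    using val[of j s c] that by (auto simp: Jp_def mult_le_0_iff mult_less_0_iff)
  have Jm_iff: "fst j \<bullet> pt s c \<le> snd j \<longleftrightarrow> g0 j + g1 j * s \<le> c" "fst j \<bullet> pt s c = snd j \<longleftrightarrow> c = g0 j + g1 j * s"
     "fst j \<bullet> pt s c < snd j \<longleftrightarrow> g0 j + g1 j * s < c" if "j \<in> Jm" for j s c
    using val[of j s c] that by (auto simp: Jm_def mult_le_0_iff mult_less_0_iff)
  have mem: "pt s c \<in> poly_of I \<longleftrightarrow> env A m m' s \<le> c \<and> c \<le> env B k k' s" if s: "\<bar>s\<bar> \<le> \<delta>" for s c
  proof
    assume *: "pt s c \<in> poly_of I"
    obtain j where j: "j \<in> Jm" "g0 j + g1 j * s = env A m m' s" using d1(4)[of s] s \<delta> by auto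
    obtain l where l: "l \<in> Jp" "g0 l + g1 l * s = env B k k' s" using Jp_eq[of s] s \<delta> by auto
    have "j \<in> I" "l \<in> I" using j(1) l(1) unfolding Jp_def Jm_def by blast+
    then have "fst j \<bullet> pt s c \<le> snd j" "fst l \<bullet> pt s c \<le> snd l"
      using * unfolding poly_of_def by blast+
    then show "env A m m' s \<le> c \<and> c \<le> env B k k' s" using Jm_iff(1)[OF j(1)] Jp_iff(1)[OF l(1)] j(2) l(2) by auto
  next
    assume *: "env A m m' s \<le> c \<and> c \<le> env B k k' s"
    have "fst j \<bullet> pt s c \<le> snd j" if "j \<in> I" for j
    proof (cases "j = i")
      case True
      then show ?thesis using pt_a by (simp add: a_def)
    next
      case False
      then consider "j \<in> J0" | "j \<in> Jp" | "j \<in> Jm" using split \<open>j \<in> I\<close> by blast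
      then show ?thesis
      proof cases
        case 1
        then show ?thesis using J0_slack[of j s c] s \<delta> by auto
      next
        case 2
        then show ?thesis using Jp_iff(1)[OF 2, of s c] Jp_le[OF _ 2, of s] * s \<delta> by auto
      next
        case 3
        then show ?thesis using Jm_iff(1)[OF 3, of s c] d1(3)[OF _ 3, of s] * s \<delta> by auto
      qed
    qed
    then show "pt s c \<in> poly_of I" by (simp add: poly_of_def)
  qed
  have act: "(\<exists>j\<in>I-{i}. fst j \<bullet> pt s c = snd j) \<longleftrightarrow> c = env A m m' s \<or> c = env B k k' s"
    if s: "\<bar>s\<bar> \<le> \<delta>" and P: "pt s c \<in> poly_of I" for s c
  proof
    assume "\<exists>j\<in>I-{i}. fst j \<bullet> pt s c = snd j"
    then obtain j where j: "j \<in> I-{i}" "fst j \<bullet> pt s c = snd j" by blast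
    have b: "env A m m' s \<le> c" "c \<le> env B k k' s" using mem[OF s] P by auto
    consider "j \<in> J0" | "j \<in> Jp" | "j \<in> Jm" using split[OF j(1)] by blast
    then show "c = env A m m' s \<or> c = env B k k' s"
    proof cases
      case 1
      then show ?thesis using J0_slack[of j s c] s \<delta> j(2) by auto
    next
      case 2
      then show ?thesis using Jp_iff(2)[OF 2, of s c] Jp_le[OF _ 2, of s] b s \<delta> j(2) by auto
    next
      case 3
      then show ?thesis using Jm_iff(2)[OF 3, of s c] d1(3)[OF _ 3, of s] b s \<delta> j(2) by auto
    qed
  next
    assume *: "c = env A m m' s \<or> c = env B k k' s"
    obtain j where j: "j \<in> Jm" "g0 j + g1 j * s = env A m m' s" using d1(4)[of s] s \<delta> by auto
    obtain l where l: "l \<in> Jp" "g0 l + g1 l * s = env B k k' s" using Jp_eq[of s] s \<delta> by auto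
    have "fst j \<bullet> pt s c = snd j \<or> fst l \<bullet> pt s c = snd l"
      using * Jm_iff(2)[OF j(1), of s c] Jp_iff(2)[OF l(1), of s c] j(2) l(2) by auto
    moreover have "j \<in> I-{i}" "l \<in> I-{i}" using j(1) l(1) unfolding Jp_def Jm_def by blast+
    ultimately show "\<exists>j\<in>I-{i}. fst j \<bullet> pt s c = snd j" by blast
  qed
  have "pt 0 0 = p" by (simp add: pt_def)
  then have AB: "A \<le> B" using mem[of 0 0] p(1) \<delta>(1) by (simp add: env_def)
  \<comment> \<open>\<open>q\<close> lies at height \<open>h + sq\<close>; between \<open>sq\<close> and 0 the gap of two bounds is a convex combination of
    a positive and a nonnegative number.\<close>
  have neg: "env A m m' s < env B k k' s" if s: "-\<delta> \<le> s" "s < 0" for s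
  proof -
    obtain j where j: "j \<in> Jm" "g0 j + g1 j * s = env A m m' s" using d1(4)[of s] s \<delta> by auto
    obtain l where l: "l \<in> Jp" "g0 l + g1 l * s = env B k k' s" using Jp_eq[of s] s \<delta> by auto
    have "j \<in> I-{i}" "l \<in> I-{i}" using j(1) l(1) unfolding Jp_def Jm_def by blast+
    then have "fst j \<bullet> q < snd j" "fst l \<bullet> q < snd l" using q(3) by blast+
    then have q1: "g0 j + g1 j * sq < g0 l + g1 l * sq"
      using Jm_iff(3)[OF j(1), of sq cq] Jp_iff(3)[OF l(1), of sq cq] unfolding q_pt by linarith
    have "g0 j \<le> A" using d1(3)[of 0 j] j(1) d1(1) by (simp add: env_def)
    moreover have "B \<le> g0 l" using Jp_le[of 0 l] l(1) d2(1) by (simp add: env_def)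
    ultimately have q0: "g0 j \<le> g0 l" using AB by linarith
    define \<theta> where "\<theta> = s / sq"
    have \<theta>: "0 < \<theta>" "\<theta> \<le> 1" "s = \<theta> * sq" using s sq \<delta>(5) by (auto simp: \<theta>_def divide_simps)
    have "(g0 l + g1 l * s) - (g0 j + g1 j * s) = (1 - \<theta>) * (g0 l - g0 j) + \<theta> * ((g0 l + g1 l * sq) - (g0 j + g1 j * sq))"
      unfolding \<theta>(3) by (simp add: algebra_simps)
    moreover have "(1 - \<theta>) * (g0 l - g0 j) \<ge> 0" using \<theta> q0 by simp
    moreover have "\<theta> * ((g0 l + g1 l * sq) - (g0 j + g1 j * sq)) > 0" using \<theta> q1 by simp
    ultimately show ?thesis using j(2) l(2) by linarith
  qed
  show ?thesis
  proof (rule that[of \<beta> p m' m k k' A B \<delta>])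
    show "\<beta> \<noteq> 0" using nb by auto
    show "edir n (fst i) \<bullet> \<beta> = 0" using eb by (simp add: e_def a_def)
    show "\<exists>c. y = p + s *\<^sub>R \<beta> + c *\<^sub>R edir n (fst i)" if "y \<in> poly_of I" "fst i \<bullet> y = snd i" "n \<bullet> y = h + s" for y s
      using pt_ex[of y] that(2,3) unfolding pt_def e_def a_def by auto
    show "fst j \<bullet> edir n (fst i) \<noteq> 0"
      if j: "\<bar>s\<bar> \<le> \<delta>" "j \<in> I-{i}" "fst j \<bullet> (p + s *\<^sub>R \<beta> + c *\<^sub>R edir n (fst i)) = snd j" for s j c
    proof
      assume "fst j \<bullet> edir n (fst i) = 0"
      then have "j \<in> J0" using j(2) by (simp add: J0_def e_def a_def)
      then have "fst j \<bullet> pt s c < snd j" using J0_slack j(1) \<delta>(2) by simp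
      then show False using j(3) by (simp add: pt_def e_def a_def)
    qed
    show "k \<le> k'" using d2(2) by (simp add: k_def k'_def)
    show "p + s *\<^sub>R \<beta> + c *\<^sub>R edir n (fst i) \<in> poly_of I \<longleftrightarrow> env A m m' s \<le> c \<and> c \<le> env B k k' s"
      if "\<bar>s\<bar> \<le> \<delta>" for s c using mem[OF that] unfolding pt_def e_def a_def .
    show "(\<exists>j\<in>I-{i}. fst j \<bullet> (p + s *\<^sub>R \<beta> + c *\<^sub>R edir n (fst i)) = snd j) \<longleftrightarrow> c = env A m m' s \<or> c = env B k k' s"
      if "\<bar>s\<bar> \<le> \<delta>" "p + s *\<^sub>R \<beta> + c *\<^sub>R edir n (fst i) \<in> poly_of I" for s c
      using act[OF that(1)] that(2) unfolding pt_def e_def a_def by blast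
    show "fst i \<bullet> (p + s *\<^sub>R \<beta> + c *\<^sub>R edir n (fst i)) = snd i" "n \<bullet> (p + s *\<^sub>R \<beta> + c *\<^sub>R edir n (fst i)) = h + s" for s c
      using pt_a pt_n unfolding pt_def e_def a_def by blast+
  qed (use nb p(2) d1(2) AB \<delta>(1) neg in simp_all)
qed

end

text \<open>The end points of the section move with velocities \<open>\<beta> + m *\<^sub>R e\<close>, \<open>\<beta> + k *\<^sub>R e\<close> above \<open>h\<close> and
\<open>\<beta> + m' *\<^sub>R e\<close>, \<open>\<beta> + k' *\<^sub>R e\<close> below, where \<open>e\<close> is horizontal and \<open>m' \<le> m\<close>, \<open>k \<le> k'\<close>.  The triangle
inequality bounds the growth of the norms by \<open>m - m'\<close> and \<open>k' - k\<close>, which is the loss in the length of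
the section.  If the section at height \<open>h\<close> is a point, the facet ends there, and the inequality
says that the section at height \<open>h - t\<close> is shorter than the other two sides of a triangle.\<close>

lemma (in facet_slab) facet_inequality:
  assumes i: "i \<in> I"
  shows "\<exists>\<delta>>0. \<exists>c\<ge>0. ((\<exists>x. slice i 0 = {x}) \<longrightarrow> c > 0) \<and>
    (\<forall>s. \<bar>s\<bar> \<le> \<delta> \<longrightarrow> (\<exists>z u w. slice i s = (\<lambda>c. z + c *\<^sub>R edir n (fst i)) ` {u..w})) \<and>
    (\<forall>s j y. \<bar>s\<bar> \<le> \<delta> \<longrightarrow> y \<in> slice i s \<longrightarrow> j \<in> I - {i} \<longrightarrow> fst j \<bullet> y = snd j \<longrightarrow> fst j \<bullet> edir n (fst i) \<noteq> 0) \<and>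
    (\<forall>t \<L>. 0 < t \<longrightarrow> t \<le> \<delta> \<longrightarrow> line_family \<L> \<longrightarrow> ridges (-t) t i \<subseteq> covered \<L> \<longrightarrow>
      len \<L> (ridges 0 t i) + diameter (slice i t) + diameter (slice i (-t)) + c * t
        \<le> len \<L> (ridges (-t) 0 i) + 2 * diameter (slice i 0))"
proof (rule facet_coordinates[OF i])
  fix \<beta> p :: "real^3" and m' m k k' A B \<delta> :: real
  define e where "e = edir n (fst i)"
  define lo where "lo = env A m m'"
  define hi where "hi = env B k k'"
  define pt where "pt s c = p + s *\<^sub>R \<beta> + c *\<^sub>R e" for s c
  assume "\<beta> \<noteq> 0" "edir n (fst i) \<bullet> \<beta> = 0" and "n \<bullet> \<beta> = 1" "n \<bullet> p = h" and mk: "m' \<le> m" "k \<le> k'" "A \<le> B" and \<delta>: "\<delta> > 0"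
    and "\<And>y s. y \<in> poly_of I \<Longrightarrow> fst i \<bullet> y = snd i \<Longrightarrow> n \<bullet> y = h + s \<Longrightarrow> \<exists>c. y = p + s *\<^sub>R \<beta> + c *\<^sub>R edir n (fst i)"
    and "\<And>s c. \<bar>s\<bar> \<le> \<delta> \<Longrightarrow> p + s *\<^sub>R \<beta> + c *\<^sub>R edir n (fst i) \<in> poly_of I \<longleftrightarrow> env A m m' s \<le> c \<and> c \<le> env B k k' s"
    and "\<And>s c. fst i \<bullet> (p + s *\<^sub>R \<beta> + c *\<^sub>R edir n (fst i)) = snd i" 
    and "\<And>s c. n \<bullet> (p + s *\<^sub>R \<beta> + c *\<^sub>R edir n (fst i)) = h + s" 
    and "\<And>s c. \<bar>s\<bar> \<le> \<delta> \<Longrightarrow> p + s *\<^sub>R \<beta> + c *\<^sub>R edir n (fst i) \<in> poly_of I \<Longrightarrow>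
      (\<exists>j\<in>I-{i}. fst j \<bullet> (p + s *\<^sub>R \<beta> + c *\<^sub>R edir n (fst i)) = snd j) \<longleftrightarrow> c = env A m m' s \<or> c = env B k k' s"
    and "\<And>s j c. \<bar>s\<bar> \<le> \<delta> \<Longrightarrow> j \<in> I-{i} \<Longrightarrow> fst j \<bullet> (p + s *\<^sub>R \<beta> + c *\<^sub>R edir n (fst i)) = snd j \<Longrightarrow> fst j \<bullet> edir n (fst i) \<noteq> 0"
    and "\<And>s. -\<delta> \<le> s \<Longrightarrow> s < 0 \<Longrightarrow> env A m m' s < env B k k' s"
  note raw = this
  have b0: "\<beta> \<noteq> 0" and eb: "e \<bullet> \<beta> = 0" using raw by (simp_all add: e_def)
  have ex: "\<exists>c. y = pt s c" if "y \<in> poly_of I" "fst i \<bullet> y = snd i" "n \<bullet> y = h + s" for y s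
    using raw(9)[OF that] by (simp add: pt_def e_def)
  have mem: "pt s c \<in> poly_of I \<longleftrightarrow> lo s \<le> c \<and> c \<le> hi s" if "\<bar>s\<bar> \<le> \<delta>" for s c
    using raw(10)[OF that] by (simp add: pt_def e_def lo_def hi_def)
  have pt_i: "fst i \<bullet> pt s c = snd i" and pt_n: "n \<bullet> pt s c = h + s" for s c
    using raw(11,12) by (simp_all add: pt_def e_def)
  have act: "(\<exists>j\<in>I-{i}. fst j \<bullet> pt s c = snd j) \<longleftrightarrow> c = lo s \<or> c = hi s" if "\<bar>s\<bar> \<le> \<delta>" "pt s c \<in> poly_of I" for s c
    using raw(13)[of s c] that unfolding pt_def e_def lo_def hi_def by blast
  have transv: "fst j \<bullet> e \<noteq> 0" if "\<bar>s\<bar> \<le> \<delta>" "j \<in> I-{i}" "fst j \<bullet> pt s c = snd j" for s j c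
    using raw(14)[of s j c] that unfolding pt_def e_def by blast
  have neg: "lo s < hi s" if "-\<delta> \<le> s" "s < 0" for s
    using raw(15)[OF that] by (simp add: lo_def hi_def)
  have e1: "norm e = 1" using cross_nonzero[OF i] by (simp add: e_def edir_def)
  have slice_eq: "slice i s = (\<lambda>c. (p + s *\<^sub>R \<beta>) + c *\<^sub>R e) ` {lo s..hi s}" if "\<bar>s\<bar> \<le> \<delta>" for s
  proof -
    have "slice i s = pt s ` {lo s..hi s}"
    proof (intro equalityI subsetI)
      fix y assume "y \<in> slice i s"
      then show "y \<in> pt s ` {lo s..hi s}" using ex[of y s] mem[OF that] unfolding slice_def by auto
    next
      fix y assume "y \<in> pt s ` {lo s..hi s}"
      then show "y \<in> slice i s" using mem[OF that] pt_i pt_n unfolding slice_def by auto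
    qed
    then show ?thesis unfolding pt_def .
  qed
  have diam: "diameter (slice i s) = max 0 (hi s - lo s)" if "\<bar>s\<bar> \<le> \<delta>" for s
    unfolding slice_eq[OF that] by (rule diameter_interval_image[OF e1])
  have ridges_eq: "ridges u w i = (\<lambda>s. pt s (lo s)) ` {s. u < s \<and> s < w \<and> lo s \<le> hi s} \<union> (\<lambda>s. pt s (hi s)) ` {s. u < s \<and> s < w \<and> lo s \<le> hi s}"
    if "-\<delta> \<le> u" "w \<le> \<delta>" for u w
  proof (intro equalityI subsetI)
    fix y assume y: "y \<in> ridges u w i"
    define s where "s = n \<bullet> y - h"
    have s: "u < s" "s < w" "\<bar>s\<bar> \<le> \<delta>" using y that by (auto simp: ridges_def s_def)
    obtain c where c: "y = pt s c" using ex[of y s] y by (auto simp: ridges_def s_def)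
    have "pt s c \<in> poly_of I" "\<exists>j\<in>I-{i}. fst j \<bullet> pt s c = snd j" using y by (auto simp: ridges_def c)
    then have "c = lo s \<or> c = hi s" "lo s \<le> hi s" using act[OF s(3)] mem[OF s(3)] by fastforce+
    then show "y \<in> (\<lambda>s. pt s (lo s)) ` {s. u < s \<and> s < w \<and> lo s \<le> hi s} \<union> (\<lambda>s. pt s (hi s)) ` {s. u < s \<and> s < w \<and> lo s \<le> hi s}"
      using c s by auto
  next
    fix y assume "y \<in> (\<lambda>s. pt s (lo s)) ` {s. u < s \<and> s < w \<and> lo s \<le> hi s} \<union> (\<lambda>s. pt s (hi s)) ` {s. u < s \<and> s < w \<and> lo s \<le> hi s}"
    then obtain s c where s: "u < s" "s < w" "lo s \<le> hi s" "y = pt s c" "c = lo s \<or> c = hi s" by blast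
    have "\<bar>s\<bar> \<le> \<delta>" using s that by auto
    moreover have "pt s c \<in> poly_of I" using mem[OF calculation] s by auto
    ultimately show "y \<in> ridges u w i" using act[of s c] s pt_i pt_n unfolding ridges_def by auto
  qed
  have seg: "len \<L> (ridges u w i) = (w - u) * (norm (\<beta> + \<mu> *\<^sub>R e) + norm (\<beta> + \<kappa> *\<^sub>R e))"
    if L: "line_family \<L>" "ridges u w i \<subseteq> covered \<L>" and uw: "-\<delta> \<le> u" "u < w" "w \<le> \<delta>"
      and lin: "\<And>s. u < s \<Longrightarrow> s < w \<Longrightarrow> lo s = A + \<mu> * s" "\<And>s. u < s \<Longrightarrow> s < w \<Longrightarrow> hi s = B + \<kappa> * s"
      and lt: "\<And>s. u < s \<Longrightarrow> s < w \<Longrightarrow> lo s < hi s" for \<L> u w \<mu> \<kappa>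
  proof -
    have S: "{s. u < s \<and> s < w \<and> lo s \<le> hi s} = {u<..<w}" using lt by (auto simp: less_imp_le)
    have lo_im: "(\<lambda>s. pt s (lo s)) ` {u<..<w} = (\<lambda>s. (p + A *\<^sub>R e) + s *\<^sub>R (\<beta> + \<mu> *\<^sub>R e)) ` {u<..<w}"
      by (rule image_cong) (auto simp: pt_def lin algebra_simps)
    have hi_im: "(\<lambda>s. pt s (hi s)) ` {u<..<w} = (\<lambda>s. (p + B *\<^sub>R e) + s *\<^sub>R (\<beta> + \<kappa> *\<^sub>R e)) ` {u<..<w}"
      by (rule image_cong) (auto simp: pt_def lin algebra_simps)
    have R: "ridges u w i = (\<lambda>s. (p + A *\<^sub>R e) + s *\<^sub>R (\<beta> + \<mu> *\<^sub>R e)) ` {u<..<w} \<union> (\<lambda>s. (p + B *\<^sub>R e) + s *\<^sub>R (\<beta> + \<kappa> *\<^sub>R e)) ` {u<..<w}"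
      unfolding ridges_eq[OF uw(1,3)] S lo_im hi_im ..
    have disj: "(\<lambda>s. pt s (lo s)) ` {u<..<w} \<inter> (\<lambda>s. pt s (hi s)) ` {u<..<w} = {}"
    proof -
      have False if s: "s \<in> {u<..<w}" "s' \<in> {u<..<w}" "pt s (lo s) = pt s' (hi s')" for s s'
      proof -
        have "s = s'" using arg_cong[OF s(3), of "\<lambda>y. n \<bullet> y"] pt_n by simp
        then have "(lo s - hi s) *\<^sub>R e = 0" using s(3) by (simp add: pt_def algebra_simps)
        then show False using e1 lt[of s] s(1) by auto
      qed
      then show ?thesis by blast
    qed
    have nz: "\<beta> + c *\<^sub>R e \<noteq> 0" for c
    proof
      assume "\<beta> + c *\<^sub>R e = 0"
      then have "(\<beta> + c *\<^sub>R e) \<bullet> \<beta> = 0" by simp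
      then show False using b0 eb by (simp add: inner_add_left)
    qed
    show ?thesis unfolding R
      by (rule len_two_segments[OF L(1) nz nz uw(2)]) (use disj L(2) R lo_im hi_im in simp_all)
  qed
  have tri1: "norm (\<beta> + m *\<^sub>R e) \<le> norm (\<beta> + m' *\<^sub>R e) + (m - m')"
  proof -
    have "norm ((\<beta> + m' *\<^sub>R e) + (m - m') *\<^sub>R e) \<le> norm (\<beta> + m' *\<^sub>R e) + norm ((m - m') *\<^sub>R e)" by (rule norm_triangle_ineq)
    moreover have "(\<beta> + m' *\<^sub>R e) + (m - m') *\<^sub>R e = \<beta> + m *\<^sub>R e" by (simp add: algebra_simps)
    moreover have "norm ((m - m') *\<^sub>R e) = m - m'" using e1 mk(1) by simp
    ultimately show ?thesis by simp
  qed
  have tri2: "norm (\<beta> + k *\<^sub>R e) \<le> norm (\<beta> + k' *\<^sub>R e) + (k' - k)"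
  proof -
    have "norm ((\<beta> + k' *\<^sub>R e) - (k' - k) *\<^sub>R e) \<le> norm (\<beta> + k' *\<^sub>R e) + norm ((k' - k) *\<^sub>R e)" by (rule norm_triangle_ineq4)
    moreover have "(\<beta> + k' *\<^sub>R e) - (k' - k) *\<^sub>R e = \<beta> + k *\<^sub>R e" by (simp add: algebra_simps)
    moreover have "norm ((k' - k) *\<^sub>R e) = k' - k" using e1 mk(2) by simp
    ultimately show ?thesis by simp
  qed
  have big: "norm (\<beta> + c *\<^sub>R e) > \<bar>c\<bar>" for c
  proof -
    have "(norm (\<beta> + c *\<^sub>R e))\<^sup>2 = (norm \<beta>)\<^sup>2 + c\<^sup>2"
    proof -
      have "e \<bullet> e = 1" "\<beta> \<bullet> e = 0" using e1 eb by (simp_all add: norm_eq_1 inner_commute)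
      then have "(\<beta> + c *\<^sub>R e) \<bullet> (\<beta> + c *\<^sub>R e) = \<beta> \<bullet> \<beta> + c * c" using eb by (simp add: inner_add_left inner_add_right)
      then show ?thesis by (simp only: power2_norm_eq_inner power2_eq_square[of c])
    qed
    then have "\<bar>c\<bar>\<^sup>2 < (norm (\<beta> + c *\<^sub>R e))\<^sup>2" using b0 by simp
    then show ?thesis by (rule power2_less_imp_less) simp
  qed
  have lo_neg: "lo s = A + m' * s" "hi s = B + k' * s" if "s < 0" for s using that by (simp_all add: lo_def hi_def env_def)
  have lo_pos: "lo s = A + m * s" "hi s = B + k * s" if "s \<ge> 0" for s using that by (simp_all add: lo_def hi_def env_def)
  have below: "len \<L> (ridges (-t) 0 i) = t * (norm (\<beta> + m' *\<^sub>R e) + norm (\<beta> + k' *\<^sub>R e))"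
    if "line_family \<L>" "ridges (-t) t i \<subseteq> covered \<L>" "0 < t" "t \<le> \<delta>" for t \<L>
  proof -
    have "ridges (-t) 0 i \<subseteq> ridges (-t) t i" using that(3) by (auto simp: ridges_def)
    then have "ridges (-t) 0 i \<subseteq> covered \<L>" using that(2) by blast
    from seg[OF that(1) this, of m' k'] show ?thesis using that(3,4) lo_neg neg \<delta> by simp
  qed
  have d_neg: "diameter (slice i (-t)) = B - A + (m' - k') * t" if "0 < t" "t \<le> \<delta>" for t
    using diam[of "-t"] neg[of "-t"] lo_neg[of "-t"] that by (simp add: algebra_simps)
  have d_0: "diameter (slice i 0) = B - A" using diam[of 0] lo_pos[of 0] mk(3) \<delta> by simp
  show ?thesis
  proof (cases "A < B")
    case True
    obtain \<delta>2 where \<delta>2: "\<delta>2 > 0" "\<And>s. \<bar>s\<bar> \<le> \<delta>2 \<Longrightarrow> (B - A) + (k - m) * s > 0"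
      using affine_pos_near_0[of "B - A" "k - m"] True by auto
    have pos: "lo s < hi s" if "0 \<le> s" "s \<le> \<delta>2" for s
      using \<delta>2(2)[of s] that lo_pos[of s] by (simp add: left_diff_distrib)
    show ?thesis
    proof (rule exI[of _ "min \<delta> \<delta>2"], intro conjI, simp add: \<delta> \<delta>2(1), rule exI[of _ 0], intro conjI allI impI)
      assume "\<exists>x. slice i 0 = {x}"
      then obtain x where "slice i 0 = {x}" by blast
      then have "p + A *\<^sub>R e = x" "p + B *\<^sub>R e = x" using slice_eq[of 0] \<delta> True lo_pos[of 0] by fastforce+
      then have "p + A *\<^sub>R e = p + B *\<^sub>R e" by (simp only:)
      then have "(B - A) *\<^sub>R e = 0" by auto
      then show "(0::real) < 0" using e1 True by auto
    next
      fix s assume "\<bar>s\<bar> \<le> min \<delta> \<delta>2"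
      then show "\<exists>z u w. slice i s = (\<lambda>c. z + c *\<^sub>R edir n (fst i)) ` {u..w}" using slice_eq[of s] unfolding e_def by auto
    next
      fix s j y assume s: "\<bar>s\<bar> \<le> min \<delta> \<delta>2" "y \<in> slice i s" "j \<in> I - {i}" "fst j \<bullet> y = snd j"
      then obtain c where "y = pt s c" using ex[of y s] unfolding slice_def by blast
      then show "fst j \<bullet> edir n (fst i) \<noteq> 0" using transv[of s j c] s unfolding e_def by auto
    next
      fix t \<L> assume t: "0 < t" "t \<le> min \<delta> \<delta>2" and L: "line_family \<L>" "ridges (-t) t i \<subseteq> covered \<L>"
      have "ridges 0 t i \<subseteq> ridges (-t) t i" using t by (auto simp: ridges_def)
      then have "ridges 0 t i \<subseteq> covered \<L>" using L(2) by blast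
      from seg[OF L(1) this, of m k] have up: "len \<L> (ridges 0 t i) = t * (norm (\<beta> + m *\<^sub>R e) + norm (\<beta> + k *\<^sub>R e))"
        using t lo_pos pos \<delta> by simp
      have dt: "diameter (slice i t) = B - A + (k - m) * t"
        using diam[of t] pos[of t] lo_pos[of t] t by (simp add: algebra_simps)
      have "t * (norm (\<beta> + m *\<^sub>R e) + norm (\<beta> + k *\<^sub>R e)) \<le> t * (norm (\<beta> + m' *\<^sub>R e) + norm (\<beta> + k' *\<^sub>R e) + (m - m') + (k' - k))"
        using tri1 tri2 t(1) by (intro mult_left_mono) auto
      then show "len \<L> (ridges 0 t i) + diameter (slice i t) + diameter (slice i (-t)) + 0 * t
        \<le> len \<L> (ridges (-t) 0 i) + 2 * diameter (slice i 0)"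
        using up dt d_neg[OF t(1)] d_0 below[OF L t(1)] t by (simp add: algebra_simps)
    qed simp
  next
    case False
    then have AB: "A = B" using mk(3) by simp
    have "lo (-\<delta>) < hi (-\<delta>)" using neg[of "-\<delta>"] \<delta> by simp
    then have "k' * \<delta> < m' * \<delta>" using lo_neg[of "-\<delta>"] \<delta> AB by simp
    then have km: "k' < m'" using \<delta> by simp
    define c where "c = norm (\<beta> + m' *\<^sub>R e) + norm (\<beta> + k' *\<^sub>R e) - (m' - k')"
    have c: "c > 0" using big[of m'] big[of k'] by (simp add: c_def)
    show ?thesis
    proof (rule exI[of _ \<delta>], intro conjI, rule \<delta>, rule exI[of _ c], intro conjI allI impI)
      fix s assume "\<bar>s\<bar> \<le> \<delta>"
      then show "\<exists>z u w. slice i s = (\<lambda>c. z + c *\<^sub>R edir n (fst i)) ` {u..w}" using slice_eq[of s] unfolding e_def by auto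
    next
      fix s j y assume s: "\<bar>s\<bar> \<le> \<delta>" "y \<in> slice i s" "j \<in> I - {i}" "fst j \<bullet> y = snd j"
      then obtain c where "y = pt s c" using ex[of y s] unfolding slice_def by blast
      then show "fst j \<bullet> edir n (fst i) \<noteq> 0" using transv[of s j c] s unfolding e_def by auto
    next
      fix t \<L> assume t: "0 < t" "t \<le> \<delta>" and L: "line_family \<L>" "ridges (-t) t i \<subseteq> covered \<L>"
      have hl: "hi s < lo s" if "0 < s" for s
      proof -
        have "k < m" using km mk by linarith
        then show ?thesis using that lo_pos[of s] AB by simp
      qed
      have "ridges 0 t i = {}" using ridges_eq[of 0 t] t hl \<delta> by fastforce
      then have "len \<L> (ridges 0 t i) = 0" using len_finite[OF L(1)] by simp
      moreover have "diameter (slice i t) = 0" using diam[of t] hl[of t] t by simp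
      ultimately show "len \<L> (ridges 0 t i) + diameter (slice i t) + diameter (slice i (-t)) + c * t
        \<le> len \<L> (ridges (-t) 0 i) + 2 * diameter (slice i 0)"
        using d_neg[OF t] d_0 below[OF L t(1,2)] AB by (simp add: c_def algebra_simps)
    qed (use c in auto)
  qed
qed

section \<open>Perimeters of sections\<close>

text \<open>The mean does not depend on the direction, because the ball is invariant under rotations.\<close>

lemma mean_abs_inner:
  obtains c where "c > 0" "\<And>e :: real^3. norm e = 1 \<Longrightarrow> integral (cball 0 1) (\<lambda>\<theta>. \<bar>e \<bullet> \<theta>\<bar>) = c"
    "\<And>e :: real^3. (\<lambda>\<theta>. \<bar>e \<bullet> \<theta>\<bar>) integrable_on cball 0 1"
proof -
  define v :: "real^3" where "v = axis 1 1"
  define F where "F e \<theta> = \<bar>e \<bullet> \<theta>\<bar> *\<^sub>R v" for e \<theta> :: "real^3"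
  have abs_int: "F e absolutely_integrable_on cball 0 1" for e
  proof -
    have "continuous_on (cball 0 1) (F e)" unfolding F_def by (intro continuous_intros)
    then have "integrable lborel (\<lambda>x. indicator (cball 0 1) x *\<^sub>R F e x)"
      by (rule borel_integrable_compact[OF compact_cball])
    then show ?thesis unfolding set_integrable_def
      by (subst integrable_completion) (auto simp: borel_measurable_integrable)
  qed
  have comp: "(\<lambda>\<theta>. F e \<theta> $ 1) = (\<lambda>\<theta>. \<bar>e \<bullet> \<theta>\<bar>)" for e by (simp add: F_def v_def fun_eq_iff)
  have int: "(\<lambda>\<theta>. \<bar>e \<bullet> \<theta>\<bar>) integrable_on cball 0 1" for e :: "real^3"
    using integrable_linear[OF set_lebesgue_integral_eq_integral(1)[OF abs_int[of e]] bounded_linear_vec_nth[of 1]]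
    by (simp add: o_def comp)
  have F1: "integral (cball 0 1) (\<lambda>\<theta>. \<bar>e \<bullet> \<theta>\<bar>) = integral (cball 0 1) (F e) $ 1" for e
    using integral_component_eq_cart[OF set_lebesgue_integral_eq_integral(1)[OF abs_int[of e]], of 1] by (simp add: comp)
  have rot: "integral (cball 0 1) (F e) = integral (cball 0 1) (F v)" if e: "norm e = 1" for e
  proof -
    have "norm v = 1" by (simp add: v_def)
    then obtain f where f: "orthogonal_transformation f" "f v = e"
      using orthogonal_transformation_exists_1 e by blast
    have lin: "linear f" using f(1) by (simp add: orthogonal_transformation_linear)
    have img: "f ` cball 0 1 = cball 0 1" using image_orthogonal_transformation_cball[OF f(1), of 0 1] lin
      by (simp add: linear_0)
    have "F e (f \<theta>) = F v \<theta>" for \<theta>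
      using f unfolding F_def orthogonal_transformation_def by metis
    then have "(\<lambda>x. \<bar>det (matrix f)\<bar> *\<^sub>R F e (f x)) = F v" using f(1) by (simp add: fun_eq_iff)
    then show ?thesis
      using has_absolute_integral_change_of_variables_linear[OF lin, where f="F e" and S="cball 0 1" and b="integral (cball 0 1) (F v)"] abs_int
      unfolding img by auto
  qed
  define c where "c = integral (cball 0 1) (\<lambda>\<theta>. \<bar>v \<bullet> \<theta>\<bar>)"
  have "c > 0"
  proof -
    define b :: "real^3" where "b = (\<chi> i. 1/3)"
    have sub: "cbox (-b) b \<subseteq> cball 0 1"
    proof
      fix x assume "x \<in> cbox (-b) b"
      then have "- (1/3) \<le> x $ i \<and> x $ i \<le> 1/3" for i by (simp add: mem_box_cart b_def)
      then have "\<bar>x $ i\<bar> \<le> 1/3" for i by (metis abs_le_iff minus_le_iff)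
      then have "(\<Sum>i\<in>UNIV. \<bar>x $ i\<bar>) \<le> (\<Sum>i\<in>(UNIV::3 set). 1/3)" by (intro sum_mono) auto
      then show "x \<in> cball 0 1" using norm_le_l1_cart[of x] by simp
    qed
    have cont: "continuous_on (cbox (-b) b) (\<lambda>\<theta>. \<bar>v \<bullet> \<theta>\<bar>)" by (intro continuous_intros)
    have le: "integral (cbox (-b) b) (\<lambda>\<theta>. \<bar>v \<bullet> \<theta>\<bar>) \<le> c"
      unfolding c_def by (rule integral_subset_le[OF sub integrable_continuous[OF cont] int]) auto
    have "integral (cbox (-b) b) (\<lambda>\<theta>. \<bar>v \<bullet> \<theta>\<bar>) \<noteq> 0"
    proof
      assume 0: "integral (cbox (-b) b) (\<lambda>\<theta>. \<bar>v \<bullet> \<theta>\<bar>) = 0"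
      have hi: "((\<lambda>\<theta>. \<bar>v \<bullet> \<theta>\<bar>) has_integral 0) (cbox (-b) b)"
        using integrable_integral[OF integrable_continuous[OF cont]] 0 by simp
      have ne: "box (-b) b \<noteq> {}"
      proof -
        have "(0::real^3) \<in> box (-b) b" by (simp add: mem_box_cart b_def)
        then show ?thesis by blast
      qed
      have "\<bar>v \<bullet> b\<bar> = 0"
        by (rule has_integral_0_cbox_imp_0[OF cont _ hi ne]) (auto simp: mem_box_cart b_def)
      then show False by (simp add: v_def b_def inner_axis')
    qed
    moreover have "integral (cbox (-b) b) (\<lambda>\<theta>. \<bar>v \<bullet> \<theta>\<bar>) \<ge> 0"
      by (intro integral_nonneg integrable_continuous cont) auto
    ultimately show ?thesis using le by linarith
  qed
  then show ?thesis using that[of c] int F1 rot unfolding c_def by auto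
qed

text \<open>Integrate over \<open>\<theta>\<close> in the unit ball: all segments of length 1 have the same mean projection.\<close>

lemma sum_nonpos_if_projections_nonpos:
  fixes e :: "'i \<Rightarrow> real^3"
  assumes "finite J" "\<And>i. i \<in> J \<Longrightarrow> norm (e i) = 1" "\<And>\<theta>. (\<Sum>i\<in>J. x i * \<bar>e i \<bullet> \<theta>\<bar>) \<le> 0"
  shows "(\<Sum>i\<in>J. x i) \<le> 0"
proof -
  obtain c where c: "c > 0" "\<And>e :: real^3. norm e = 1 \<Longrightarrow> integral (cball 0 1) (\<lambda>\<theta>. \<bar>e \<bullet> \<theta>\<bar>) = c"
    "\<And>e :: real^3. (\<lambda>\<theta>. \<bar>e \<bullet> \<theta>\<bar>) integrable_on cball 0 1" using mean_abs_inner by blast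
  have int: "(\<lambda>\<theta>. x i * \<bar>e i \<bullet> \<theta>\<bar>) integrable_on cball 0 1" for i
    using c(3) by (intro integrable_on_mult_right)
  have "integral (cball 0 1) (\<lambda>\<theta>. \<Sum>i\<in>J. x i * \<bar>e i \<bullet> \<theta>\<bar>) = (\<Sum>i\<in>J. integral (cball 0 1) (\<lambda>\<theta>. x i * \<bar>e i \<bullet> \<theta>\<bar>))"
    using int by (intro integral_sum assms(1))
  also have "\<dots> = (\<Sum>i\<in>J. x i * c)" using c(2) assms(2) by (intro sum.cong) simp_all
  finally have "integral (cball 0 1) (\<lambda>\<theta>. \<Sum>i\<in>J. x i * \<bar>e i \<bullet> \<theta>\<bar>) = (\<Sum>i\<in>J. x i) * c"
    by (simp add: sum_distrib_right)
  moreover have "integral (cball 0 1) (\<lambda>\<theta>. \<Sum>i\<in>J. x i * \<bar>e i \<bullet> \<theta>\<bar>) \<le> integral (cball 0 1) (\<lambda>\<theta>::real^3. 0)"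
    using int assms(1,3) by (intro integral_le integrable_sum integrable_0) auto
  ultimately show ?thesis using c(1) by (simp add: mult_le_0_iff)
qed

context facet_slab
begin

definition level :: "real \<Rightarrow> (real^3) set" where
  "level s = {y \<in> poly_of I. n \<bullet> y = h + s}"

lemma level_eq: "level s = poly_of I \<inter> {y. n \<bullet> y = h + s}"
  by (auto simp: level_def)

lemma convex_level: "convex (level s)"
  unfolding level_eq by (intro convex_Int convex_poly_of convex_hyperplane)

lemma compact_level: assumes "\<bar>s\<bar> \<le> \<delta>0" shows "compact (level s)"
proof -
  have "closed (level s)" unfolding level_eq by (intro closed_Int closed_poly_of closed_hyperplane)
  moreover have "bounded (level s)" using bdd(2) by (rule bounded_subset) (use assms in \<open>auto simp: level_def\<close>)
  ultimately show ?thesis using compact_eq_bounded_closed by blast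
qed

text \<open>The sides whose outer normal points towards \<open>\<tau>\<close> form the part of the boundary of the section that
is seen from infinity in direction \<open>\<tau>\<close>.  Their projections to the line spanned by \<open>\<theta>\<close>, which is
orthogonal to \<open>\<tau>\<close>, cover the projection of the section once.\<close>

lemma projection_of_facets:
  assumes sl: "\<And>i. i \<in> I \<Longrightarrow> \<exists>z u w. slice i s = (\<lambda>c. z + c *\<^sub>R edir n (fst i)) ` {u..w}"
    and overlap: "\<And>i j. i \<in> I \<Longrightarrow> j \<in> I \<Longrightarrow> i \<noteq> j \<Longrightarrow> finite (slice i s \<inter> slice j s)"
    and s: "\<bar>s\<bar> \<le> \<delta>0" and ne: "(\<lambda>y. \<theta> \<bullet> y) ` level s = {a..b}" "a \<le> b"
    and \<tau>: "\<tau> = \<sigma> *\<^sub>R cross3 n \<theta>" "\<sigma> \<noteq> 0" "cross3 n \<theta> \<noteq> 0"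
  shows "(\<Sum>i\<in>{i\<in>I. fst i \<bullet> \<tau> > 0}. diameter (slice i s) * \<bar>edir n (fst i) \<bullet> \<theta>\<bar>) = b - a"
proof -
  let ?J = "{i\<in>I. fst i \<bullet> \<tau> > 0}"
  have nt: "n \<bullet> \<tau> = 0" "\<theta> \<bullet> \<tau> = 0" by (simp_all add: \<tau>(1) dot_cross_self)
  have \<tau>0: "\<tau> \<noteq> 0" using \<tau> by simp
  let ?\<pi> = "\<lambda>y. \<theta> \<bullet> y"
  have meas: "?\<pi> ` slice i s \<in> lmeasurable \<and> measure lebesgue (?\<pi> ` slice i s) = diameter (slice i s) * \<bar>edir n (fst i) \<bullet> \<theta>\<bar>"
    if i: "i \<in> I" for i
  proof -
    obtain z u w where zuw: "slice i s = (\<lambda>c. z + c *\<^sub>R edir n (fst i)) ` {u..w}" using sl[OF i] by blast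
    let ?m = "edir n (fst i) \<bullet> \<theta>"
    have e1: "norm (edir n (fst i)) = 1" using cross_nonzero[OF i] by (simp add: edir_def)
    have d: "diameter (slice i s) = max 0 (w - u)" unfolding zuw by (rule diameter_interval_image[OF e1])
    have img: "?\<pi> ` slice i s = (\<lambda>c. ?m * c + \<theta> \<bullet> z) ` {u..w}"
      unfolding zuw image_image by (simp add: inner_add_right inner_commute algebra_simps)
    show ?thesis
    proof (cases "u \<le> w")
      case True
      then have "?\<pi> ` slice i s = (if 0 \<le> ?m then {?m * u + \<theta> \<bullet> z .. ?m * w + \<theta> \<bullet> z} else {?m * w + \<theta> \<bullet> z .. ?m * u + \<theta> \<bullet> z})"
        unfolding img image_affinity_atLeastAtMost by simp
      moreover have "0 \<le> ?m \<Longrightarrow> ?m * u \<le> ?m * w" "?m < 0 \<Longrightarrow> ?m * w \<le> ?m * u"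
        using True by (auto simp: mult_left_mono mult_left_mono_neg)
      ultimately show ?thesis using True d by (auto simp: algebra_simps)
    next
      case False
      then show ?thesis unfolding img d by simp
    qed
  qed
  have kt: "\<exists>k. y' - y = k *\<^sub>R \<tau>" if "y \<in> level s" "y' \<in> level s" "\<theta> \<bullet> y = \<theta> \<bullet> y'" for y y'
  proof -
    have "n \<bullet> (y' - y) = 0" "\<theta> \<bullet> (y' - y) = 0" using that by (auto simp: level_def inner_diff_right)
    then obtain k where "y' - y = k *\<^sub>R cross3 n \<theta>" using perp_cross[OF _ _ \<tau>(3)] by blast
    then have "y' - y = (k / \<sigma>) *\<^sub>R \<tau>" using \<tau>(1,2) by simp
    then show ?thesis by blast
  qed
  have slice_level: "slice i s \<subseteq> level s" for i by (auto simp: slice_def level_def)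
  have "measure lebesgue (\<Union>((\<lambda>i. ?\<pi> ` slice i s) ` ?J)) = (\<Sum>i\<in>?J. measure lebesgue (?\<pi> ` slice i s))"
  proof (rule measure_negligible_finite_Union_image)
    show "finite ?J" using fin by simp
    show "?\<pi> ` slice i s \<in> lmeasurable" if "i \<in> ?J" for i using meas that by blast
    show "pairwise (\<lambda>i j. negligible (?\<pi> ` slice i s \<inter> ?\<pi> ` slice j s)) ?J"
      unfolding pairwise_def
    proof (intro ballI impI)
      fix i j assume ij: "i \<in> ?J" "j \<in> ?J" "i \<noteq> j"
      have "?\<pi> ` slice i s \<inter> ?\<pi> ` slice j s \<subseteq> ?\<pi> ` (slice i s \<inter> slice j s)"
      proof
        fix r assume "r \<in> ?\<pi> ` slice i s \<inter> ?\<pi> ` slice j s"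
        then obtain y y' where y: "y \<in> slice i s" "y' \<in> slice j s" "\<theta> \<bullet> y = r" "\<theta> \<bullet> y' = r" by auto
        have "y \<in> level s" "y' \<in> level s" using y(1) y(2) by (simp_all add: slice_def level_def)
        moreover have "\<theta> \<bullet> y = \<theta> \<bullet> y'" using y(3,4) by simp
        ultimately have "y \<in> level s" "y' \<in> level s" "\<theta> \<bullet> y = \<theta> \<bullet> y'" by blast+
        from kt[OF this] obtain k where k: "y' - y = k *\<^sub>R \<tau>" by blast
        have "fst i \<bullet> (y' - y) \<le> 0" using y(1,2) ij(1) unfolding slice_def poly_of_def by (auto simp: inner_diff_right)
        then have "k \<le> 0" using ij(1) unfolding k by (simp add: mult_le_0_iff)
        moreover have "fst j \<bullet> (y' - y) \<ge> 0" using y(1,2) ij(2) unfolding slice_def poly_of_def by (auto simp: inner_diff_right)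
        then have "k \<ge> 0" using ij(2) unfolding k by (simp add: zero_le_mult_iff)
        ultimately have "y' = y" using k by simp
        then show "r \<in> ?\<pi> ` (slice i s \<inter> slice j s)" using y by blast
      qed
      then have "finite (?\<pi> ` slice i s \<inter> ?\<pi> ` slice j s)"
        using overlap[of i j] ij finite_subset by blast
      then show "negligible (?\<pi> ` slice i s \<inter> ?\<pi> ` slice j s)" by (rule negligible_finite)
    qed
  qed
  also have "\<dots> = (\<Sum>i\<in>?J. diameter (slice i s) * \<bar>edir n (fst i) \<bullet> \<theta>\<bar>)"
    using meas by (intro sum.cong) auto
  also have "\<Union>((\<lambda>i. ?\<pi> ` slice i s) ` ?J) = {a..b}"
  proof
    show "\<Union>((\<lambda>i. ?\<pi> ` slice i s) ` ?J) \<subseteq> {a..b}" using slice_level ne(1) by blast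
    show "{a..b} \<subseteq> \<Union>((\<lambda>i. ?\<pi> ` slice i s) ` ?J)"
    proof
      fix r assume "r \<in> {a..b}"
      then have "r \<in> (\<lambda>y. \<theta> \<bullet> y) ` level s" by (simp only: ne(1))
      then have "level s \<inter> {y. \<theta> \<bullet> y = r} \<noteq> {}" by blast
      moreover have "compact (level s \<inter> {y. \<theta> \<bullet> y = r})"
        by (intro compact_Int_closed compact_level[OF s] closed_hyperplane)
      moreover have "continuous_on (level s \<inter> {y. \<theta> \<bullet> y = r}) (\<lambda>y. \<tau> \<bullet> y)" by (intro continuous_intros)
      ultimately obtain y where y: "y \<in> level s \<inter> {y. \<theta> \<bullet> y = r}" "\<And>y'. y' \<in> level s \<inter> {y. \<theta> \<bullet> y = r} \<Longrightarrow> \<tau> \<bullet> y' \<le> \<tau> \<bullet> y"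
        using continuous_attains_sup[of "level s \<inter> {y. \<theta> \<bullet> y = r}" "\<lambda>y. \<tau> \<bullet> y"] by auto
      have "\<exists>i\<in>?J. fst i \<bullet> y = snd i"
      proof (rule ccontr)
        assume no: "\<not> ?thesis"
        have yP: "y \<in> poly_of I" using y(1) by (simp add: level_def)
        have "\<exists>d>0. \<forall>u. \<bar>u\<bar> \<le> d \<longrightarrow> (u \<ge> 0 \<longrightarrow> fst j \<bullet> y + u * (fst j \<bullet> \<tau>) \<le> snd j)" if j: "j \<in> I" for j
        proof (cases "fst j \<bullet> y < snd j")
          case True
          then show ?thesis using affine_pos_near_0[of "snd j - fst j \<bullet> y" "- (fst j \<bullet> \<tau>)"]
            by (force simp: algebra_simps)
        next
          case False
          then have "fst j \<bullet> y = snd j" using yP j unfolding poly_of_def by force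
          then have "\<not> fst j \<bullet> \<tau> > 0" using no j by blast
          then have "fst j \<bullet> \<tau> \<le> 0" by simp
          then show ?thesis using \<open>fst j \<bullet> y = snd j\<close>
            by (intro exI[of _ 1]) (auto simp: mult_nonneg_nonpos)
        qed
        then obtain d where d: "d > 0" "\<forall>j\<in>I. \<forall>u. \<bar>u\<bar> \<le> d \<longrightarrow> (u \<ge> 0 \<longrightarrow> fst j \<bullet> y + u * (fst j \<bullet> \<tau>) \<le> snd j)"
          using uniform_delta[OF fin, of "\<lambda>j u. u \<ge> 0 \<longrightarrow> fst j \<bullet> y + u * (fst j \<bullet> \<tau>) \<le> snd j"] by blast
        have "y + d *\<^sub>R \<tau> \<in> poly_of I" using d by (auto simp: poly_of_def inner_add_right)
        then have "y + d *\<^sub>R \<tau> \<in> level s \<inter> {y. \<theta> \<bullet> y = r}" using y(1) nt by (simp add: level_def inner_add_right)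
        then have "\<tau> \<bullet> (y + d *\<^sub>R \<tau>) \<le> \<tau> \<bullet> y" by (rule y(2))
        then have "d * (\<tau> \<bullet> \<tau>) \<le> 0" by (simp add: inner_add_right)
        moreover have "d * (\<tau> \<bullet> \<tau>) > 0" using d(1) \<tau>0 by simp
        ultimately show False by linarith
      qed
      then obtain i where "i \<in> ?J" "fst i \<bullet> y = snd i" by blast
      then have "y \<in> slice i s" "\<theta> \<bullet> y = r" using y(1) by (auto simp: slice_def level_def)
      then show "r \<in> \<Union>((\<lambda>i. ?\<pi> ` slice i s) ` ?J)" using \<open>i \<in> ?J\<close> by blast
    qed
  qed
  finally show ?thesis using ne(2) by simp
qed

text \<open>The far and the near half of the boundary each project onto the width; sides parallel to the
direction of projection contribute nothing.\<close>

lemma perimeter_projection: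
  assumes sl: "\<And>i. i \<in> I \<Longrightarrow> \<exists>z u w. slice i s = (\<lambda>c. z + c *\<^sub>R edir n (fst i)) ` {u..w}"
    and overlap: "\<And>i j. i \<in> I \<Longrightarrow> j \<in> I \<Longrightarrow> i \<noteq> j \<Longrightarrow> finite (slice i s \<inter> slice j s)"
    and s: "\<bar>s\<bar> \<le> \<delta>0" and ne: "(\<lambda>y. \<theta> \<bullet> y) ` level s = {a..b}" "a \<le> b"
  shows "(\<Sum>i\<in>I. diameter (slice i s) * \<bar>edir n (fst i) \<bullet> \<theta>\<bar>) = 2 * (b - a)"
proof (cases "cross3 n \<theta> = 0")
  case True
  moreover have "n \<noteq> 0" using n1 by auto
  ultimately obtain k where k: "\<theta> = k *\<^sub>R n" by (rule parallel_if_cross_0)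
  have "edir n (fst i) \<bullet> \<theta> = 0" for i :: "(real^3) \<times> real" by (simp add: k edir_def dot_cross_self inner_commute)
  then have "(\<Sum>i\<in>I. diameter (slice i s) * \<bar>edir n (fst i) \<bullet> \<theta>\<bar>) = 0" by simp
  moreover have "a = b"
  proof -
    have "(\<lambda>y. \<theta> \<bullet> y) ` level s \<subseteq> {k * (h + s)}" by (auto simp: k level_def)
    then have "{a..b} \<subseteq> {k * (h + s)}" by (simp only: ne(1))
    moreover have "a \<in> {a..b}" "b \<in> {a..b}" using ne(2) by simp_all
    ultimately have "a = k * (h + s)" "b = k * (h + s)" by blast+
    then show ?thesis by simp
  qed
  ultimately show ?thesis by simp
next
  case False
  let ?\<tau> = "cross3 n \<theta>"
  have 1: "(\<Sum>i\<in>{i\<in>I. fst i \<bullet> ?\<tau> > 0}. diameter (slice i s) * \<bar>edir n (fst i) \<bullet> \<theta>\<bar>) = b - a"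
    by (rule projection_of_facets[OF sl overlap s ne, of ?\<tau> 1]) (use False in auto)
  have 2: "(\<Sum>i\<in>{i\<in>I. fst i \<bullet> (- ?\<tau>) > 0}. diameter (slice i s) * \<bar>edir n (fst i) \<bullet> \<theta>\<bar>) = b - a"
    by (rule projection_of_facets[OF sl overlap s ne, of "- ?\<tau>" "-1"]) (use False in auto)
  have 0: "edir n (fst i) \<bullet> \<theta> = 0" if "fst i \<bullet> ?\<tau> = 0" for i
  proof -
    have "cross3 n (fst i) \<bullet> \<theta> = - (fst i \<bullet> cross3 n \<theta>)"
      by (simp add: cross3_simps)
    then show ?thesis using that by (simp add: edir_def)
  qed
  have I: "I = {i\<in>I. fst i \<bullet> ?\<tau> = 0} \<union> ({i\<in>I. fst i \<bullet> ?\<tau> > 0} \<union> {i\<in>I. fst i \<bullet> (- ?\<tau>) > 0})" by auto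
  let ?f = "\<lambda>i. diameter (slice i s) * \<bar>edir n (fst i) \<bullet> \<theta>\<bar>"
  have "sum ?f I = sum ?f {i\<in>I. fst i \<bullet> ?\<tau> = 0} + sum ?f ({i\<in>I. fst i \<bullet> ?\<tau> > 0} \<union> {i\<in>I. fst i \<bullet> (- ?\<tau>) > 0})"
    using fin by (subst arg_cong[OF I, of "sum ?f"], intro sum.union_disjoint) auto
  also have "sum ?f ({i\<in>I. fst i \<bullet> ?\<tau> > 0} \<union> {i\<in>I. fst i \<bullet> (- ?\<tau>) > 0}) = (b - a) + (b - a)"
    by (subst sum.union_disjoint) (use fin 1 2 in auto)
  also have "sum ?f {i\<in>I. fst i \<bullet> ?\<tau> = 0} = 0" using 0 by (intro sum.neutral) auto
  finally show ?thesis by simp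
qed

text \<open>The midpoint of a point at height \<open>h + t\<close> and a point at height \<open>h - t\<close> lies in the section at
height \<open>h\<close>, so the widths of the sections are concave in every direction.\<close>

lemma perimeter_concave:
  assumes sl: "\<And>i r. i \<in> I \<Longrightarrow> \<bar>r\<bar> \<le> t \<Longrightarrow> \<exists>z u w. slice i r = (\<lambda>c. z + c *\<^sub>R edir n (fst i)) ` {u..w}"
    and overlap: "\<And>i j r. i \<in> I \<Longrightarrow> j \<in> I \<Longrightarrow> i \<noteq> j \<Longrightarrow> \<bar>r\<bar> \<le> t \<Longrightarrow> finite (slice i r \<inter> slice j r)"
    and t: "0 < t" "t \<le> \<delta>0" and ne: "level t \<noteq> {}" "level (-t) \<noteq> {}"
  shows "(\<Sum>i\<in>I. diameter (slice i t) + diameter (slice i (-t)) - 2 * diameter (slice i 0)) \<le> 0"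
proof (rule sum_nonpos_if_projections_nonpos[where e="\<lambda>i. edir n (fst i)", OF fin])
  show "norm (edir n (fst i)) = 1" if "i \<in> I" for i using cross_nonzero[OF that] by (simp add: edir_def)
  fix \<theta> :: "real^3"
  have mid: "(1/2) *\<^sub>R (y + y') \<in> level 0" if "y \<in> level t" "y' \<in> level (-t)" for y y'
  proof -
    have "(1/2) *\<^sub>R y + (1/2) *\<^sub>R y' \<in> poly_of I"
      using that by (intro convexD[OF convex_poly_of]) (auto simp: level_def)
    then show ?thesis using that by (simp add: level_def inner_add_right scaleR_add_right field_simps)
  qed
  have iv: "\<exists>a b. (\<lambda>y. \<theta> \<bullet> y) ` level r = {a..b}" if "\<bar>r\<bar> \<le> t" for r
  proof -
    have "compact (level r)" using compact_level that t by simp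
    then have "compact ((\<lambda>y. \<theta> \<bullet> y) ` level r)" by (intro compact_continuous_image continuous_intros)
    moreover have "connected ((\<lambda>y. \<theta> \<bullet> y) ` level r)"
      by (intro connected_continuous_image continuous_intros convex_connected convex_level)
    ultimately show ?thesis using connected_compact_interval_1 by blast
  qed
  obtain a b where ab: "(\<lambda>y. \<theta> \<bullet> y) ` level t = {a..b}" using iv[of t] t by auto
  obtain a' b' where ab': "(\<lambda>y. \<theta> \<bullet> y) ` level (-t) = {a'..b'}" using iv[of "-t"] t by auto
  obtain a0 b0 where ab0: "(\<lambda>y. \<theta> \<bullet> y) ` level 0 = {a0..b0}" using iv[of 0] t by auto
  have ord: "a \<le> b" "a' \<le> b'" using ab ab' ne by force+
  have half: "(r + r') / 2 \<in> {a0..b0}" if r: "r \<in> {a..b}" "r' \<in> {a'..b'}" for r r'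
  proof -
    have "r \<in> (\<lambda>y. \<theta> \<bullet> y) ` level t" "r' \<in> (\<lambda>y. \<theta> \<bullet> y) ` level (-t)" using r by (simp_all only: ab ab')
    then obtain y y' where y: "y \<in> level t" "\<theta> \<bullet> y = r" "y' \<in> level (-t)" "\<theta> \<bullet> y' = r'" by blast
    have "\<theta> \<bullet> ((1/2) *\<^sub>R (y + y')) = (r + r') / 2" using y by (simp add: inner_add_right)
    then have "(r + r') / 2 \<in> (\<lambda>y. \<theta> \<bullet> y) ` level 0" using mid[OF y(1,3)] by force
    then show ?thesis by (simp only: ab0)
  qed
  have w: "(b - a) + (b' - a') \<le> 2 * (b0 - a0)" "a0 \<le> b0"
    using half[of a a'] half[of b b'] ord by (auto simp: field_simps)
  have P: "(\<Sum>i\<in>I. diameter (slice i t) * \<bar>edir n (fst i) \<bullet> \<theta>\<bar>) = 2 * (b - a)"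
    by (rule perimeter_projection[OF sl overlap _ ab ord(1)]) (use t in auto)
  have P': "(\<Sum>i\<in>I. diameter (slice i (-t)) * \<bar>edir n (fst i) \<bullet> \<theta>\<bar>) = 2 * (b' - a')"
    by (rule perimeter_projection[OF sl overlap _ ab' ord(2)]) (use t in auto)
  have P0: "(\<Sum>i\<in>I. diameter (slice i 0) * \<bar>edir n (fst i) \<bullet> \<theta>\<bar>) = 2 * (b0 - a0)"
    by (rule perimeter_projection[OF sl overlap _ ab0 w(2)]) (use t in auto)
  have "(\<Sum>i\<in>I. (diameter (slice i t) + diameter (slice i (-t)) - 2 * diameter (slice i 0)) * \<bar>edir n (fst i) \<bullet> \<theta>\<bar>)
    = 2 * (b - a) + 2 * (b' - a') - 2 * (2 * (b0 - a0))"
    unfolding P[symmetric] P'[symmetric] P0[symmetric]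
    by (simp add: sum_distrib_left sum.distrib[symmetric] sum_subtractf[symmetric] algebra_simps)
  then show "(\<Sum>i\<in>I. (diameter (slice i t) + diameter (slice i (-t)) - 2 * diameter (slice i 0)) * \<bar>edir n (fst i) \<bullet> \<theta>\<bar>) \<le> 0"
    using w by simp
qed

end

section \<open>Edge length of a convex polyhedron cut at a varying height\<close>

lemma finite_if_all_equal: "(\<And>x y. x \<in> S \<Longrightarrow> y \<in> S \<Longrightarrow> x = y) \<Longrightarrow> finite S"
  by (metis finite.emptyI finite.insertI finite_subset singletonI subsetI)

lemma len_interval_image:
  assumes "line_family \<L>" "norm e = 1" "(\<lambda>c. z + c *\<^sub>R e) ` {u..w} \<subseteq> covered \<L>"
  shows "len \<L> ((\<lambda>c. z + c *\<^sub>R e) ` {u..w}) = max 0 (w - u)"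
proof (cases "u < w")
  case True
  have e0: "e \<noteq> 0" using assms(2) by auto
  let ?f = "\<lambda>c. z + c *\<^sub>R e"
  have "?f ` {u<..<w} \<subseteq> ?f ` {u..w}" by (intro image_mono) auto
  then have "?f ` {u<..<w} \<subseteq> covered \<L>" using assms(3) by (rule subset_trans)
  then have "len \<L> (?f ` {u<..<w}) = (w - u) * norm e"
    using True by (intro len_segment[OF assms(1) e0])
  moreover have "len \<L> (?f ` {u<..<w}) = len \<L> (?f ` {u..w})"
  proof (rule len_cong[OF assms(1) open_interval_image_borel(1)[OF e0] open_interval_image_borel(2)[OF e0]])
    have "?f ` {u..w} - ?f ` {u<..<w} \<subseteq> {?f u, ?f w}" using e0 by (auto simp: less_le)
    then show "finite (?f ` {u..w} - ?f ` {u<..<w})" using finite_subset by blast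
    have "?f ` {u<..<w} - ?f ` {u..w} = {}" by auto
    then show "finite (?f ` {u<..<w} - ?f ` {u..w})" by (simp only: finite.emptyI)
  qed
  ultimately show ?thesis using True assms(2) by simp
next
  case False
  then have "{u..w} \<subseteq> {u}" by auto
  then have "finite {u..w}" using finite_subset by blast
  then have "finite ((\<lambda>c. z + c *\<^sub>R e) ` {u..w})" by (rule finite_imageI)
  then show ?thesis using len_finite[OF assms(1)] False by simp
qed

context facet_slab
begin

definition edge_set :: "real \<Rightarrow> real \<Rightarrow> (real^3) set" where
  "edge_set u w = (\<Union>i\<in>I. ridges u w i)"

text \<open>The part at height at least \<open>h - t\<close> of the skeleton of \<open>poly_of I\<close> cut off at height \<open>h + s\<close>: the edges
below the cut and the boundary of the new face.\<close>

definition capped :: "real \<Rightarrow> real \<Rightarrow> (real^3) set" where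
  "capped t s = {y \<in> poly_of I. - t \<le> n \<bullet> y - h \<and> n \<bullet> y - h \<le> s \<and>
     ((\<exists>i\<in>I. \<exists>j\<in>I. i \<noteq> j \<and> fst i \<bullet> y = snd i \<and> fst j \<bullet> y = snd j) \<or> (n \<bullet> y - h = s \<and> (\<exists>i\<in>I. fst i \<bullet> y = snd i)))}"

lemma slab_Int_borel:
  assumes "closed S" "S \<subseteq> poly_of I" "-\<delta>0 \<le> u" "w \<le> \<delta>0"
  shows "S \<inter> {y. u < n \<bullet> y - h \<and> n \<bullet> y - h < w} \<in> sets borel" "bounded (S \<inter> {y. u < n \<bullet> y - h \<and> n \<bullet> y - h < w})"
proof -
  have "{y. u < n \<bullet> y - h \<and> n \<bullet> y - h < w} = {y. n \<bullet> y > u + h} \<inter> {y. n \<bullet> y < w + h}" by auto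
  then have "open {y. u < n \<bullet> y - h \<and> n \<bullet> y - h < w}" by (simp add: open_Int open_halfspace_lt open_halfspace_gt)
  then show "S \<inter> {y. u < n \<bullet> y - h \<and> n \<bullet> y - h < w} \<in> sets borel" using assms(1) by (intro sets.Int) auto
  show "bounded (S \<inter> {y. u < n \<bullet> y - h \<and> n \<bullet> y - h < w})"
    using bdd(2) by (rule bounded_subset) (use assms in auto)
qed

text \<open>Up to finitely many points, every point on an edge lies in exactly two facets.\<close>

lemma len_edge_set:
  assumes L: "line_family \<L>" and uw: "-\<delta>0 \<le> u" "w \<le> \<delta>0"
  shows "2 * len \<L> (edge_set u w) = (\<Sum>i\<in>I. len \<L> (ridges u w i))" and "edge_set u w \<in> sets borel" and "bounded (edge_set u w)"
proof -
  define E where "E = {e. e \<subseteq> I \<and> card e = 2}"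
  define B where "B e = {y \<in> poly_of I. \<forall>i\<in>e. fst i \<bullet> y = snd i} \<inter> {y. u < n \<bullet> y - h \<and> n \<bullet> y - h < w}" for e
  have finE: "finite E" using fin by (auto simp: E_def)
  have cl: "closed {y \<in> poly_of I. \<forall>i\<in>e. fst i \<bullet> y = snd i}" for e
  proof -
    have "{y \<in> poly_of I. \<forall>i\<in>e. fst i \<bullet> y = snd i} = poly_of I \<inter> (\<Inter>i\<in>e. {y. fst i \<bullet> y = snd i})" by auto
    then show ?thesis by (auto intro!: closed_Int closed_poly_of closed_INT closed_hyperplane)
  qed
  have Bb: "B e \<in> sets borel" "bounded (B e)" for e
    unfolding B_def using cl uw by (auto intro!: slab_Int_borel)
  have ov: "finite (B e \<inter> B e')" if e: "e \<in> E" "e' \<in> E" "e \<noteq> e'" for e e'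
  proof (rule finite_if_all_equal)
    fix y y' assume y: "y \<in> B e \<inter> B e'" "y' \<in> B e \<inter> B e'"
    obtain i j where ij: "e = {i,j}" "i \<noteq> j" using e(1) unfolding E_def by (auto simp: card_2_iff)
    have "\<not> e' \<subseteq> e"
    proof
      assume "e' \<subseteq> e"
      moreover have "finite e" using ij by simp
      ultimately show False using e by (auto simp: E_def dest: card_subset_eq)
    qed
    then obtain k where k: "k \<in> e'" "k \<notin> e" by blast
    show "y = y'"
      by (rule no_three_facets_on_line[of i j k]) (use y e ij k in \<open>auto simp: B_def E_def\<close>)
  qed
  have R: "ridges u w i = (\<Union>e\<in>{e\<in>E. i \<in> e}. B e)" if i: "i \<in> I" for i
  proof (intro equalityI subsetI)
    fix y assume "y \<in> ridges u w i"
    then obtain j where "j \<in> I" "j \<noteq> i" "fst j \<bullet> y = snd j" "y \<in> poly_of I" "u < n \<bullet> y - h" "n \<bullet> y - h < w" "fst i \<bullet> y = snd i"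
      unfolding ridges_def by blast
    then have "{i,j} \<in> {e\<in>E. i \<in> e}" "y \<in> B {i,j}" using i by (auto simp: E_def B_def)
    then show "y \<in> (\<Union>e\<in>{e\<in>E. i \<in> e}. B e)" by blast
  next
    fix y assume "y \<in> (\<Union>e\<in>{e\<in>E. i \<in> e}. B e)"
    then obtain e where e: "e \<in> E" "i \<in> e" "y \<in> B e" by blast
    have "e \<noteq> {i}" using e(1) by (auto simp: E_def)
    then obtain j where j: "j \<in> e" "j \<noteq> i" using e(2) by blast
    then have "j \<in> I - {i}" using e(1) by (auto simp: E_def)
    then show "y \<in> ridges u w i" using e j unfolding B_def ridges_def by blast
  qed
  have S: "edge_set u w = (\<Union>e\<in>E. B e)"
  proof -
    have "\<exists>i\<in>I. i \<in> e" if "e \<in> E" for e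
    proof -
      have "e \<noteq> {}" "e \<subseteq> I" using that by (auto simp: E_def)
      then show ?thesis by blast
    qed
    then show ?thesis unfolding edge_set_def using R by blast
  qed
  show "edge_set u w \<in> sets borel" unfolding S using finE Bb by (auto intro!: sets.finite_UN)
  show "bounded (edge_set u w)" unfolding S using finE Bb by (auto intro!: bounded_UN)
  have "(\<Sum>i\<in>I. len \<L> (ridges u w i)) = (\<Sum>i\<in>I. \<Sum>e\<in>{e\<in>E. i \<in> e}. len \<L> (B e))"
  proof (rule sum.cong[OF refl])
    fix i assume "i \<in> I"
    show "len \<L> (ridges u w i) = (\<Sum>e\<in>{e\<in>E. i \<in> e}. len \<L> (B e))"
      unfolding R[OF \<open>i \<in> I\<close>] using finE Bb ov by (intro len_UN[OF L]) auto
  qed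
  also have "\<dots> = (\<Sum>e\<in>E. \<Sum>i\<in>{i\<in>I. i \<in> e}. len \<L> (B e))"
    by (rule sum.swap_restrict[OF fin finE])
  also have "\<dots> = (\<Sum>e\<in>E. 2 * len \<L> (B e))"
  proof (rule sum.cong[OF refl])
    fix e assume "e \<in> E"
    then have "{i\<in>I. i \<in> e} = e" "card e = 2" by (auto simp: E_def)
    then show "(\<Sum>i\<in>{i\<in>I. i \<in> e}. len \<L> (B e)) = 2 * len \<L> (B e)" by simp
  qed
  also have "\<dots> = 2 * len \<L> (edge_set u w)"
    unfolding S using finE Bb ov by (subst len_UN[OF L]) (auto simp: sum_distrib_left)
  finally show "2 * len \<L> (edge_set u w) = (\<Sum>i\<in>I. len \<L> (ridges u w i))" by simp
qed

text \<open>With \<open>U\<close> and \<open>D\<close> the lengths of the edges just above and just below \<open>h\<close>, and \<open>\<Delta>\<close> the second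
difference of the perimeter, \<open>facet_inequality\<close> sums to \<open>2 * U + \<Delta> + C * t \<le> 2 * D\<close>.  Adding
\<open>\<Delta> \<le> 0\<close> and halving gives the claim.\<close>

theorem slab_length:
  assumes tip: "i0 \<in> I" "slice i0 0 = {x0}"
  shows "\<exists>\<delta>>0. \<exists>c>0. \<forall>t \<L>. 0 < t \<longrightarrow> t \<le> \<delta> \<longrightarrow> line_family \<L> \<longrightarrow> capped t t \<union> capped t 0 \<union> capped t (-t) \<subseteq> covered \<L> \<longrightarrow>
    len \<L> (capped t t) + len \<L> (capped t (-t)) \<le> 2 * len \<L> (capped t 0) - c * t"
proof -
  define Q where "Q i \<delta> c \<longleftrightarrow> ((\<exists>x. slice i 0 = {x}) \<longrightarrow> c > 0) \<and>
    (\<forall>s. \<bar>s\<bar> \<le> \<delta> \<longrightarrow> (\<exists>z u w. slice i s = (\<lambda>c. z + c *\<^sub>R edir n (fst i)) ` {u..w})) \<and>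
    (\<forall>s j y. \<bar>s\<bar> \<le> \<delta> \<longrightarrow> y \<in> slice i s \<longrightarrow> j \<in> I - {i} \<longrightarrow> fst j \<bullet> y = snd j \<longrightarrow> fst j \<bullet> edir n (fst i) \<noteq> 0) \<and>
    (\<forall>t \<L>. 0 < t \<longrightarrow> t \<le> \<delta> \<longrightarrow> line_family \<L> \<longrightarrow> ridges (-t) t i \<subseteq> covered \<L> \<longrightarrow>
      len \<L> (ridges 0 t i) + diameter (slice i t) + diameter (slice i (-t)) + c * t
        \<le> len \<L> (ridges (-t) 0 i) + 2 * diameter (slice i 0))" for i \<delta> c
  have "\<exists>\<delta>>0. \<exists>c\<ge>0. Q i \<delta> c" if "i \<in> I" for i
    using facet_inequality[OF that] unfolding Q_def .
  then have "\<forall>i\<in>I. \<exists>\<delta> c. \<delta> > 0 \<and> c \<ge> 0 \<and> Q i \<delta> c" by blast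
  then obtain d c where dc: "\<And>i. i \<in> I \<Longrightarrow> d i > 0 \<and> c i \<ge> 0 \<and> Q i (d i) (c i)" by metis
  have "\<exists>e>0. \<forall>s. \<bar>s\<bar> \<le> e \<longrightarrow> fst j \<bullet> p0 + s * (fst j \<bullet> n) \<le> snd j" if "j \<in> I" for j
    using affine_pos_near_0[of "snd j - fst j \<bullet> p0" "- (fst j \<bullet> n)"] centre(2)[OF that] by (force simp: algebra_simps)
  then obtain d1 where d1: "d1 > 0" "\<And>j s. j \<in> I \<Longrightarrow> \<bar>s\<bar> \<le> d1 \<Longrightarrow> fst j \<bullet> p0 + s * (fst j \<bullet> n) \<le> snd j"
    using uniform_delta[OF fin, of "\<lambda>j s. fst j \<bullet> p0 + s * (fst j \<bullet> n) \<le> snd j"] by blast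
  have lev: "level s \<noteq> {}" if "\<bar>s\<bar> \<le> d1" for s
  proof -
    have "n \<bullet> n = 1" using n1 by (simp add: norm_eq_1)
    then have "p0 + s *\<^sub>R n \<in> level s"
      using d1(2)[OF _ that] centre(1) by (auto simp: level_def poly_of_def inner_add_right)
    then show ?thesis by blast
  qed
  define \<delta> where "\<delta> = Min (insert \<delta>0 (insert d1 (d ` I)))"
  have finS: "finite (insert \<delta>0 (insert d1 (d ` I)))" using fin by simp
  have pos: "d i > 0" if "i \<in> I" for i using dc[OF that] by blast
  have \<delta>: "\<delta> > 0" "\<delta> \<le> \<delta>0" "\<delta> \<le> d1" "\<And>i. i \<in> I \<Longrightarrow> \<delta> \<le> d i"
  proof -
    have "\<delta> \<in> insert \<delta>0 (insert d1 (d ` I))" unfolding \<delta>_def using Min_in[OF finS] by blast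
    then show "\<delta> > 0" using pos d1(1) bdd(1) by blast
    show "\<delta> \<le> \<delta>0" "\<delta> \<le> d1" unfolding \<delta>_def by (rule Min_le[OF finS], blast)+
    show "\<delta> \<le> d i" if "i \<in> I" for i unfolding \<delta>_def by (rule Min_le[OF finS]) (use that in blast)
  qed
  define C where "C = (\<Sum>i\<in>I. c i)"
  have "C > 0"
  proof -
    have "c i0 > 0" using dc[OF tip(1)] tip(2) unfolding Q_def by blast
    then show ?thesis unfolding C_def using dc fin tip(1) by (intro sum_pos2[of I i0]) auto
  qed
  have sl: "\<exists>z u w. slice i s = (\<lambda>c. z + c *\<^sub>R edir n (fst i)) ` {u..w}" if "i \<in> I" "\<bar>s\<bar> \<le> \<delta>" for i s
  proof -
    have "\<bar>s\<bar> \<le> d i" using \<delta>(4)[OF that(1)] that(2) by simp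
    then show ?thesis using dc[OF that(1)] unfolding Q_def by blast
  qed
  have ov: "finite (slice i s \<inter> slice j s)" if ij: "i \<in> I" "j \<in> I" "i \<noteq> j" and s: "\<bar>s\<bar> \<le> \<delta>" for i j s
  proof (rule finite_if_all_equal)
    fix y y' assume y: "y \<in> slice i s \<inter> slice j s" "y' \<in> slice i s \<inter> slice j s"
    obtain z u w where zuw: "slice i s = (\<lambda>c. z + c *\<^sub>R edir n (fst i)) ` {u..w}" using sl[OF ij(1) s] by blast
    then obtain a b where a: "y = z + a *\<^sub>R edir n (fst i)" and b: "y' = z + b *\<^sub>R edir n (fst i)" using y by blast
    have sd: "\<bar>s\<bar> \<le> d i" using \<delta>(4)[OF ij(1)] s by simp
    have ji: "j \<in> I - {i}" using ij by blast
    have yj: "fst j \<bullet> y = snd j" "fst j \<bullet> y' = snd j" using y by (simp_all add: slice_def)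
    have "fst j \<bullet> edir n (fst i) \<noteq> 0" using dc[OF ij(1)] sd ji yj(1) y(1) unfolding Q_def by blast
    moreover have "fst j \<bullet> (y - y') = 0" using yj by (simp add: inner_diff_right)
    then have "(a - b) * (fst j \<bullet> edir n (fst i)) = 0" by (simp add: a b inner_diff_right inner_add_right left_diff_distrib)
    ultimately show "y = y'" by (simp add: a b)
  qed
  have "len \<L> (capped t t) + len \<L> (capped t (-t)) \<le> 2 * len \<L> (capped t 0) - (C/2) * t"
    if t: "0 < t" "t \<le> \<delta>" and L: "line_family \<L>" and cov: "capped t t \<union> capped t 0 \<union> capped t (-t) \<subseteq> covered \<L>" for t \<L>
  proof -
    let ?D = "\<lambda>s i. diameter (slice i s)"
    define top where "top s = (\<Union>i\<in>I. slice i s)" for s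
    \<comment> \<open>points with two active facets at the three heights of interest\<close>
    define X where "X = (\<Union>s\<in>{-t,0,t}. \<Union>i\<in>I. \<Union>j\<in>I-{i}. slice i s \<inter> slice j s)"
    have finX: "finite X" unfolding X_def
    proof (intro finite_UN_I)
      show "finite (slice i s \<inter> slice j s)" if "s \<in> {-t,0,t}" "i \<in> I" "j \<in> I - {i}" for s i j
      proof -
        have "\<bar>s\<bar> \<le> \<delta>" using that(1) t by auto
        then show ?thesis using ov[of i j s] that(2,3) by blast
      qed
    qed (use fin in auto)
    have cl_slice: "closed (slice i s)" for i s
    proof -
      have "slice i s = poly_of I \<inter> {y. fst i \<bullet> y = snd i} \<inter> {y. n \<bullet> y = h + s}" by (auto simp: slice_def)
      then show ?thesis by (simp add: closed_Int closed_poly_of closed_hyperplane)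
    qed
    have bd_slice: "bounded (slice i s)" if "\<bar>s\<bar> \<le> t" for i s
      using bdd(2) by (rule bounded_subset) (use that t \<delta> in \<open>auto simp: slice_def\<close>)
    have len_slice: "len \<L> (slice i s) = ?D s i" if i: "i \<in> I" and s: "s \<in> {-t,0,t}" for i s
    proof -
      have "\<bar>s\<bar> \<le> \<delta>" using s t by auto
      then obtain z u w where zuw: "slice i s = (\<lambda>c. z + c *\<^sub>R edir n (fst i)) ` {u..w}" using sl[OF i] by blast
      have e1: "norm (edir n (fst i)) = 1" using cross_nonzero[OF i] by (simp add: edir_def)
      have "slice i s \<subseteq> capped t s" using i s t by (auto simp: slice_def capped_def)
      then have "slice i s \<subseteq> covered \<L>" using cov s by blast
      then have "len \<L> (slice i s) = max 0 (w - u)" unfolding zuw by (rule len_interval_image[OF L e1])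
      moreover have "?D s i = max 0 (w - u)" unfolding zuw by (rule diameter_interval_image[OF e1])
      ultimately show ?thesis by simp
    qed
    have top: "len \<L> (top s) = (\<Sum>i\<in>I. ?D s i)" "top s \<in> sets borel" "bounded (top s)" if s: "s \<in> {-t,0,t}" for s
    proof -
      have s': "\<bar>s\<bar> \<le> t" "\<bar>s\<bar> \<le> \<delta>" using s t by auto
      have "len \<L> (top s) = (\<Sum>i\<in>I. len \<L> (slice i s))"
        unfolding top_def using fin ov s' bd_slice cl_slice by (intro len_UN[OF L]) auto
      then show "len \<L> (top s) = (\<Sum>i\<in>I. ?D s i)" using len_slice s by simp
      show "top s \<in> sets borel" unfolding top_def using cl_slice fin by (auto intro!: sets.finite_UN)
      show "bounded (top s)" unfolding top_def using bd_slice s' fin by (auto intro!: bounded_UN)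
    qed
    have uw: "-\<delta>0 \<le> -t" "t \<le> \<delta>0" "(0::real) \<le> \<delta>0" "-\<delta>0 \<le> 0" using t \<delta> by auto
    note Elo = len_edge_set[OF L uw(1,3)] and Ehi = len_edge_set[OF L uw(4,2)]
    have edge_sub: "edge_set u w \<subseteq> capped t s" if "-t \<le> u" "w \<le> s" for u w s
    proof
      fix y assume "y \<in> edge_set u w"
      then obtain i j where ij: "i \<in> I" "j \<in> I" "i \<noteq> j" "fst i \<bullet> y = snd i" "fst j \<bullet> y = snd j"
        and P: "y \<in> poly_of I" "u < n \<bullet> y - h" "n \<bullet> y - h < w"
        unfolding edge_set_def ridges_def by blast
      have "- t \<le> n \<bullet> y - h" "n \<bullet> y - h \<le> s" using P that by auto
      then show "y \<in> capped t s" unfolding capped_def using ij P(1) by blast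
    qed
    have top_sub: "top s \<subseteq> capped t s" if "-t \<le> s" for s
      using that unfolding top_def slice_def capped_def by auto
    have cap_pos: "len \<L> (capped t t) = len \<L> (edge_set (-t) 0) + len \<L> (edge_set 0 t) + (\<Sum>i\<in>I. ?D t i)"
    proof -
      let ?A = "edge_set (-t) 0 \<union> edge_set 0 t"
      have 1: "len \<L> ?A = len \<L> (edge_set (-t) 0) + len \<L> (edge_set 0 t)"
      proof (rule len_Un[OF L Elo(2) Ehi(2) Elo(3) Ehi(3)])
        have "edge_set (-t) 0 \<inter> edge_set 0 t = {}" by (auto simp: edge_set_def ridges_def)
        then show "finite (edge_set (-t) 0 \<inter> edge_set 0 t)" by simp
      qed
      have 2: "len \<L> (?A \<union> top t) = len \<L> ?A + len \<L> (top t)"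
      proof (rule len_Un[OF L])
        have "?A \<inter> top t = {}" using t by (auto simp: edge_set_def ridges_def top_def slice_def)
        then show "finite (?A \<inter> top t)" by simp
      qed (use Elo Ehi top[of t] in auto)
      have "len \<L> (?A \<union> top t) = len \<L> (capped t t)"
      proof (rule len_cong[OF L])
        have "?A \<union> top t \<subseteq> capped t t"
          using edge_sub[of "-t" 0 t] edge_sub[of 0 t t] top_sub[of t] t by auto
        then have "?A \<union> top t - capped t t = {}" by blast
        then show "finite (?A \<union> top t - capped t t)" by (simp only: finite.emptyI)
        have "capped t t - (?A \<union> top t) \<subseteq> X"
        proof
          fix y assume y: "y \<in> capped t t - (?A \<union> top t)"
          then have P: "y \<in> poly_of I" "- t \<le> n \<bullet> y - h" "n \<bullet> y - h \<le> t" by (auto simp: capped_def)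
          have "n \<bullet> y - h \<noteq> t \<or> \<not> (\<exists>i\<in>I. fst i \<bullet> y = snd i)"
            using y by (auto simp: top_def slice_def capped_def)
          then obtain i j where ij: "i \<in> I" "j \<in> I" "i \<noteq> j" "fst i \<bullet> y = snd i" "fst j \<bullet> y = snd j"
            using y unfolding capped_def by blast
          then have "n \<bullet> y - h \<noteq> t" using \<open>n \<bullet> y - h \<noteq> t \<or> \<not> (\<exists>i\<in>I. fst i \<bullet> y = snd i)\<close> by blast
          moreover have "\<not> (- t < n \<bullet> y - h \<and> n \<bullet> y - h < 0)" "\<not> (0 < n \<bullet> y - h \<and> n \<bullet> y - h < t)"
            using y ij P(1) unfolding edge_set_def ridges_def by blast+
          ultimately have "n \<bullet> y - h \<in> {-t,0,t}" using P by auto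
          moreover have "y \<in> slice i (n \<bullet> y - h) \<inter> slice j (n \<bullet> y - h)" using P ij by (simp add: slice_def)
          ultimately show "y \<in> X" unfolding X_def using ij by blast
        qed
        then show "finite (capped t t - (?A \<union> top t))" using finX finite_subset by blast
      qed (use Elo Ehi top[of t] in auto)
      then show ?thesis using 1 2 top(1)[of t] by simp
    qed
    have cap_0: "len \<L> (capped t 0) = len \<L> (edge_set (-t) 0) + (\<Sum>i\<in>I. ?D 0 i)"
    proof -
      let ?A = "edge_set (-t) 0"
      have 2: "len \<L> (?A \<union> top 0) = len \<L> ?A + len \<L> (top 0)"
      proof (rule len_Un[OF L])
        have "?A \<inter> top 0 = {}" by (auto simp: edge_set_def ridges_def top_def slice_def)
        then show "finite (?A \<inter> top 0)" by simp
      qed (use Elo top[of 0] in auto)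
      have "len \<L> (?A \<union> top 0) = len \<L> (capped t 0)"
      proof (rule len_cong[OF L])
        have "?A \<union> top 0 \<subseteq> capped t 0"
          using edge_sub[of "-t" 0 0] top_sub[of 0] t by auto
        then have "?A \<union> top 0 - capped t 0 = {}" by blast
        then show "finite (?A \<union> top 0 - capped t 0)" by (simp only: finite.emptyI)
        have "capped t 0 - (?A \<union> top 0) \<subseteq> X"
        proof
          fix y assume y: "y \<in> capped t 0 - (?A \<union> top 0)"
          then have P: "y \<in> poly_of I" "- t \<le> n \<bullet> y - h" "n \<bullet> y - h \<le> 0" by (auto simp: capped_def)
          have no: "n \<bullet> y - h \<noteq> 0 \<or> \<not> (\<exists>i\<in>I. fst i \<bullet> y = snd i)"
            using y by (auto simp: top_def slice_def capped_def)
          then obtain i j where ij: "i \<in> I" "j \<in> I" "i \<noteq> j" "fst i \<bullet> y = snd i" "fst j \<bullet> y = snd j"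
            using y unfolding capped_def by blast
          then have "n \<bullet> y - h \<noteq> 0" using no by blast
          moreover have "\<not> (- t < n \<bullet> y - h \<and> n \<bullet> y - h < 0)"
            using y ij P(1) unfolding edge_set_def ridges_def by blast
          ultimately have "n \<bullet> y - h \<in> {-t,0,t}" using P by auto
          moreover have "y \<in> slice i (n \<bullet> y - h) \<inter> slice j (n \<bullet> y - h)" using P ij by (simp add: slice_def)
          ultimately show "y \<in> X" unfolding X_def using ij by blast
        qed
        then show "finite (capped t 0 - (?A \<union> top 0))" using finX finite_subset by blast
      qed (use Elo top[of 0] in auto)
      then show ?thesis using 2 top(1)[of 0] by simp
    qed
    have "capped t (-t) = top (-t)"
      unfolding capped_def top_def slice_def by auto
    then have cap_neg: "len \<L> (capped t (-t)) = (\<Sum>i\<in>I. ?D (-t) i)" using top(1)[of "-t"] by simp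
    have conc: "(\<Sum>i\<in>I. ?D t i + ?D (-t) i - 2 * ?D 0 i) \<le> 0"
    proof (rule perimeter_concave)
      show "\<exists>z u w. slice i r = (\<lambda>c. z + c *\<^sub>R edir n (fst i)) ` {u..w}" if "i \<in> I" "\<bar>r\<bar> \<le> t" for i r
        using sl[OF that(1)] that(2) t by simp
      show "finite (slice i r \<inter> slice j r)" if "i \<in> I" "j \<in> I" "i \<noteq> j" "\<bar>r\<bar> \<le> t" for i j r
        using ov[OF that(1,2,3)] that(4) t by simp
      show "level t \<noteq> {}" "level (-t) \<noteq> {}" using lev[of t] lev[of "-t"] t \<delta> by auto
    qed (use t \<delta> in auto)
    have "(\<Sum>i\<in>I. len \<L> (ridges 0 t i) + ?D t i + ?D (-t) i + c i * t) \<le> (\<Sum>i\<in>I. len \<L> (ridges (-t) 0 i) + 2 * ?D 0 i)"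
    proof (rule sum_mono)
      fix i assume i: "i \<in> I"
      have "ridges (-t) t i \<subseteq> capped t t" using i by (fastforce simp: ridges_def capped_def)
      then have "ridges (-t) t i \<subseteq> covered \<L>" using cov by blast
      moreover have "t \<le> d i" using \<delta>(4)[OF i] t by simp
      ultimately show "len \<L> (ridges 0 t i) + ?D t i + ?D (-t) i + c i * t \<le> len \<L> (ridges (-t) 0 i) + 2 * ?D 0 i"
        using dc[OF i] t(1) L unfolding Q_def by blast
    qed
    then have "2 * len \<L> (edge_set 0 t) + (\<Sum>i\<in>I. ?D t i) + (\<Sum>i\<in>I. ?D (-t) i) + C * t
        \<le> 2 * len \<L> (edge_set (-t) 0) + 2 * (\<Sum>i\<in>I. ?D 0 i)"
      by (simp add: sum.distrib Elo(1) Ehi(1) C_def sum_distrib_left sum_distrib_right)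
    moreover have "(\<Sum>i\<in>I. ?D t i) + (\<Sum>i\<in>I. ?D (-t) i) - 2 * (\<Sum>i\<in>I. ?D 0 i) \<le> 0"
      using conc by (simp add: sum.distrib sum_subtractf sum_distrib_left)
    ultimately show ?thesis unfolding cap_pos cap_0 cap_neg by simp
  qed
  then show ?thesis using \<delta>(1) \<open>C > 0\<close> by (intro exI[of _ \<delta>] conjI exI[of _ "C/2"]) auto
qed

end

section \<open>Flat points and supporting planes\<close>

definition flat_along :: "(real^3) set \<Rightarrow> real^3 \<Rightarrow> real^3 \<Rightarrow> bool" where
  "flat_along P m x \<longleftrightarrow> norm m = 1 \<and> (\<exists>r>0. \<forall>v. norm v < r \<longrightarrow> (x + v \<in> P \<longleftrightarrow> m \<bullet> v \<le> 0))"

lemma flat_along_iff: "x \<in> flat_points P \<longleftrightarrow> (\<exists>m. flat_along P m x)"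
proof
  assume "x \<in> flat_points P"
  then obtain a r where a: "a \<noteq> 0" "r > 0" "\<And>v. norm v < r \<Longrightarrow> (x + v \<in> P \<longleftrightarrow> a \<bullet> v \<le> 0)"
    unfolding mem_flat_points by blast
  have "(a /\<^sub>R norm a) \<bullet> v \<le> 0 \<longleftrightarrow> a \<bullet> v \<le> 0" for v using a(1) by (simp add: divide_le_0_iff mult_le_0_iff)
  then have "flat_along P (a /\<^sub>R norm a) x" using a unfolding flat_along_def by auto
  then show "\<exists>m. flat_along P m x" by blast
next
  assume "\<exists>m. flat_along P m x"
  then obtain m r where "norm m = 1" "r > 0" "\<forall>v. norm v < r \<longrightarrow> (x + v \<in> P \<longleftrightarrow> m \<bullet> v \<le> 0)" unfolding flat_along_def by blast
  moreover have "m \<noteq> 0" using calculation(1) by auto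
  ultimately show "x \<in> flat_points P" unfolding mem_flat_points by blast
qed

lemma flat_along_mem: "flat_along P m x \<Longrightarrow> x \<in> P"
  unfolding flat_along_def by (metis add.right_neutral inner_zero_right norm_zero order_refl)

text \<open>A point moved slightly in direction \<open>m' - m\<close> stays in \<open>P\<close>, as \<open>m \<bullet> m' \<le> 1\<close>, but leaves the half-space
with normal \<open>m'\<close> unless \<open>m' = m\<close>.\<close>

lemma support_at_flat:
  assumes "flat_along P m x" "norm m' = 1" "r > 0" "\<And>v. norm v < r \<Longrightarrow> x + v \<in> P \<Longrightarrow> m' \<bullet> v \<le> 0"
  shows "m' = m"
proof (rule ccontr)
  assume ne: "m' \<noteq> m"
  obtain r' where r': "r' > 0" "\<And>v. norm v < r' \<Longrightarrow> (x + v \<in> P \<longleftrightarrow> m \<bullet> v \<le> 0)" and m: "norm m = 1"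
    using assms(1) unfolding flat_along_def by blast
  define t where "t = min r r' / (2 * norm (m' - m))"
  define v where "v = t *\<^sub>R (m' - m)"
  have t: "t > 0" using assms(3) r'(1) ne by (simp add: t_def)
  have nv: "norm v = min r r' / 2" using ne assms(3) r'(1) by (simp add: v_def t_def)
  have mm: "m \<bullet> m = 1" "m' \<bullet> m' = 1" using m assms(2) by (simp_all add: norm_eq_1)
  have "m \<bullet> m' \<le> 1" using norm_cauchy_schwarz[of m m'] m assms(2) by simp
  then have "m \<bullet> v \<le> 0" using t mm by (simp add: v_def inner_diff_right mult_nonneg_nonpos)
  then have "x + v \<in> P" using r' nv assms(3) by simp
  then have "m' \<bullet> v \<le> 0" using assms(3,4) nv r'(1) by simp
  then have "1 \<le> m \<bullet> m'" using t mm by (simp add: v_def inner_diff_right mult_le_0_iff inner_commute)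
  then have "(m' - m) \<bullet> (m' - m) \<le> 0" using mm by (simp add: inner_diff_left inner_diff_right inner_commute)
  then show False using ne by (metis inner_eq_zero_iff inner_ge_zero order_antisym right_minus_eq)
qed

lemma flat_along_unique: "flat_along P m x \<Longrightarrow> flat_along P m' x \<Longrightarrow> m = m'"
  unfolding flat_along_def[of P m x] using support_at_flat[of P m' x m] by blast

text \<open>Points off the plane are interior or exterior, so all flat points close to \<open>x\<close> lie in the plane.\<close>

lemma flat_along_nearby:
  assumes "flat_along P m x"
  obtains r where "r > 0" "\<And>y. y \<in> ball x r \<Longrightarrow> y \<in> flat_points P \<Longrightarrow> flat_along P m y \<and> m \<bullet> y = m \<bullet> x"
proof -
  obtain r where r: "r > 0" "\<And>v. norm v < r \<Longrightarrow> (x + v \<in> P \<longleftrightarrow> m \<bullet> v \<le> 0)" and m: "norm m = 1"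
    using assms(1) unfolding flat_along_def by blast
  show ?thesis
  proof (rule that[OF r(1)])
    fix y assume y: "y \<in> ball x r" "y \<in> flat_points P"
    define v where "v = y - x"
    have v: "norm v < r" "y = x + v" using y(1) by (auto simp: v_def dist_norm norm_minus_commute)
    obtain m' where m': "flat_along P m' y" using y(2) flat_along_iff by blast
    then have le: "m \<bullet> v \<le> 0" using r(2)[OF v(1)] flat_along_mem v(2) by blast
    have sh: "y + w \<in> P \<longleftrightarrow> m \<bullet> v + m \<bullet> w \<le> 0" if "norm w < r - norm v" for w
    proof -
      have "norm (v + w) < r" using norm_triangle_ineq[of v w] that by linarith
      then show ?thesis using r(2)[of "v + w"] v(2) by (simp add: inner_add_right add.assoc)
    qed
    have "\<not> m \<bullet> v < 0"
    proof
      assume neg: "m \<bullet> v < 0"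
      obtain r' where r': "r' > 0" "\<And>v. norm v < r' \<Longrightarrow> (y + v \<in> P \<longleftrightarrow> m' \<bullet> v \<le> 0)" and n': "norm m' = 1"
        using m' unfolding flat_along_def by blast
      define t where "t = min (min (r - norm v) r') (- (m \<bullet> v)) / 2"
      have t: "t > 0" "t < r - norm v" "t < r'" "t < - (m \<bullet> v)" using v(1) r'(1) neg by (auto simp: t_def)
      have "m \<bullet> m' \<le> 1" using norm_cauchy_schwarz[of m m'] m n' by simp
      then have "m \<bullet> (t *\<^sub>R m') \<le> t" using t(1) by (simp add: mult_left_le)
      then have "m \<bullet> v + m \<bullet> (t *\<^sub>R m') \<le> 0" using t(4) by linarith
      then have "y + t *\<^sub>R m' \<in> P" using sh[of "t *\<^sub>R m'"] t n' by simp
      then have "m' \<bullet> (t *\<^sub>R m') \<le> 0" using r'(2)[of "t *\<^sub>R m'"] t n' by simp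
      then show False using t(1) n' by (simp add: norm_eq_1)
    qed
    then have mv: "m \<bullet> v = 0" using le by simp
    then have "\<forall>w. norm w < r - norm v \<longrightarrow> (y + w \<in> P \<longleftrightarrow> m \<bullet> w \<le> 0)" using sh by simp
    moreover have "r - norm v > 0" using v(1) by simp
    ultimately have "flat_along P m y" using m unfolding flat_along_def by blast
    then show "flat_along P m y \<and> m \<bullet> y = m \<bullet> x" using mv v(2) by (simp add: inner_add_right)
  qed
qed

text \<open>With exactly one active half-space a point is flat.  At a flat point every active half-space has
the normal of \<open>support_at_flat\<close>, so two distinct ones cannot both be active there.\<close>

lemma skeleton_poly_of:
  assumes N: "finite N" "\<And>i. i \<in> N \<Longrightarrow> norm (fst i) = 1"
  shows "skeleton (poly_of N) = {y \<in> poly_of N. \<exists>i\<in>N. \<exists>j\<in>N. i \<noteq> j \<and> fst i \<bullet> y = snd i \<and> fst j \<bullet> y = snd j}"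
proof (intro equalityI subsetI)
  fix y assume y: "y \<in> skeleton (poly_of N)"
  then have fr: "y \<in> frontier (poly_of N)" and nf: "y \<notin> flat_points (poly_of N)" by (auto simp: skeleton_def)
  have yP: "y \<in> poly_of N"
    using fr frontier_subset_closed[OF closed_poly_of] by blast
  obtain r where r: "r > 0" "\<And>v a b. norm v < r \<Longrightarrow> (a,b) \<in> N \<Longrightarrow>
       sgn (a \<bullet> (y + v) - b) = (if a \<bullet> y = b then sgn (a \<bullet> v) else sgn (a \<bullet> y - b))"
    using signs_near[OF N(1)] by blast
  have loc: "y + v \<in> poly_of N \<longleftrightarrow> (\<forall>i\<in>N. fst i \<bullet> y = snd i \<longrightarrow> fst i \<bullet> v \<le> 0)" if v: "norm v < r" for v
  proof -
    have "fst i \<bullet> (y + v) \<le> snd i \<longleftrightarrow> (fst i \<bullet> y = snd i \<longrightarrow> fst i \<bullet> v \<le> 0)" if i: "i \<in> N" for i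
    proof (cases "fst i \<bullet> y = snd i")
      case True
      then show ?thesis by (simp add: inner_add_right)
    next
      case False
      then have "fst i \<bullet> y < snd i" using yP i unfolding poly_of_def by force
      moreover have "sgn (fst i \<bullet> (y + v) - snd i) = sgn (fst i \<bullet> y - snd i)"
        using r(2)[OF v, of "fst i" "snd i"] i False by simp
      ultimately show ?thesis using False by (auto simp: sgn_if split: if_splits)
    qed
    then show ?thesis by (auto simp: poly_of_def)
  qed
  have "\<exists>i\<in>N. fst i \<bullet> y = snd i"
  proof (rule ccontr)
    assume "\<not> ?thesis"
    then have "y \<in> interior (poly_of N)" unfolding mem_interior_translate using loc r(1) by blast
    then show False using fr by (simp add: frontier_def)
  qed
  then obtain i where i: "i \<in> N" "fst i \<bullet> y = snd i" by blast
  have "\<exists>j\<in>N. j \<noteq> i \<and> fst j \<bullet> y = snd j"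
  proof (rule ccontr)
    assume no: "\<not> ?thesis"
    have "y + v \<in> poly_of N \<longleftrightarrow> fst i \<bullet> v \<le> 0" if "norm v < r" for v
      unfolding loc[OF that] using no i by metis
    then have "flat_along (poly_of N) (fst i) y" using r(1) N(2)[OF i(1)] unfolding flat_along_def by blast
    then show False using nf flat_along_iff by blast
  qed
  then show "y \<in> {y \<in> poly_of N. \<exists>i\<in>N. \<exists>j\<in>N. i \<noteq> j \<and> fst i \<bullet> y = snd i \<and> fst j \<bullet> y = snd j}"
    using i yP by blast
next
  fix y assume "y \<in> {y \<in> poly_of N. \<exists>i\<in>N. \<exists>j\<in>N. i \<noteq> j \<and> fst i \<bullet> y = snd i \<and> fst j \<bullet> y = snd j}"
  then obtain i j where yP: "y \<in> poly_of N" and ij: "i \<in> N" "j \<in> N" "i \<noteq> j" "fst i \<bullet> y = snd i" "fst j \<bullet> y = snd j" by blast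
  have sup: "fst k \<bullet> v \<le> 0" if "k \<in> N" "fst k \<bullet> y = snd k" "y + v \<in> poly_of N" for k v
    using that by (auto simp: poly_of_def inner_add_right)
  have "y \<notin> interior (poly_of N)"
  proof
    assume "y \<in> interior (poly_of N)"
    then obtain r where r: "r > 0" "\<And>v. norm v < r \<Longrightarrow> y + v \<in> poly_of N" unfolding mem_interior_translate by blast
    have "y + (r/2) *\<^sub>R fst i \<in> poly_of N" using r N(2)[OF ij(1)] by simp
    then have "fst i \<bullet> ((r/2) *\<^sub>R fst i) \<le> 0" using sup ij by blast
    then show False using r(1) N(2)[OF ij(1)] by (simp add: norm_eq_1)
  qed
  moreover have "y \<notin> flat_points (poly_of N)"
  proof
    assume "y \<in> flat_points (poly_of N)"
    then obtain m where m: "flat_along (poly_of N) m y" using flat_along_iff by blast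
    have "fst i = m" by (rule support_at_flat[OF m N(2)[OF ij(1)] zero_less_one]) (use sup ij in blast)
    moreover have "fst j = m" by (rule support_at_flat[OF m N(2)[OF ij(2)] zero_less_one]) (use sup ij in blast)
    ultimately show False using ij by (metis prod_eq_iff)
  qed
  ultimately show "y \<in> skeleton (poly_of N)"
    using yP closure_subset by (auto simp: skeleton_def frontier_def)
qed

lemma component_of_flat_points_planar:
  assumes C: "C \<in> components (flat_points P)"
  obtains n h where "norm n = 1" "\<And>z. z \<in> C \<Longrightarrow> flat_along P n z \<and> n \<bullet> z = h"
proof -
  obtain x0 where x0: "x0 \<in> C" using in_components_nonempty[OF C] by blast
  have Cf: "C \<subseteq> flat_points P" using in_components_subset[OF C] .
  then obtain n where n: "flat_along P n x0" using x0 flat_along_iff by blast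
  define R where "R y z \<longleftrightarrow> (\<forall>m. (flat_along P m y \<longleftrightarrow> flat_along P m z) \<and> (flat_along P m y \<longrightarrow> m \<bullet> y = m \<bullet> z))" for y z
  have "R x0 z" if "z \<in> C" for z
  proof (rule connected_equivalence_relation[OF in_components_connected[OF C] x0 that])
    fix a assume a: "a \<in> C"
    then obtain m where m: "flat_along P m a" using Cf flat_along_iff by blast
    obtain r where r: "r > 0" "\<And>y. y \<in> ball a r \<Longrightarrow> y \<in> flat_points P \<Longrightarrow> flat_along P m y \<and> m \<bullet> y = m \<bullet> a"
      using flat_along_nearby[OF m] by blast
    have "R a y" if "y \<in> C \<inter> ball a r" for y
    proof -
      have "flat_along P m y" "m \<bullet> y = m \<bullet> a" using r(2)[of y] that Cf by auto
      then show ?thesis unfolding R_def using flat_along_unique[OF m] flat_along_unique[of P m y] m by metis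
    qed
    moreover have "openin (top_of_set C) (C \<inter> ball a r)" by (simp add: openin_open_Int)
    ultimately show "\<exists>T. openin (top_of_set C) T \<and> a \<in> T \<and> (\<forall>x\<in>T. R a x)"
      using a r(1) by (intro exI[of _ "C \<inter> ball a r"]) auto
  qed (auto simp: R_def)
  then have "flat_along P n z \<and> n \<bullet> z = n \<bullet> x0" if "z \<in> C" for z
    using that n unfolding R_def by metis
  moreover have "norm n = 1" using n by (simp add: flat_along_def)
  ultimately show ?thesis using that by blast
qed

lemma small_multiple:
  fixes K e :: real
  assumes "e > 0" "K \<ge> 0" obtains t where "0 < t" "t \<le> 1" "t * K < e"
proof -
  define t where "t = min 1 (e / (2 * (K + 1)))"
  have t: "0 < t" "t \<le> 1" using assms by (auto simp: t_def)
  have "t \<le> e / (2 * (K + 1))" by (simp add: t_def)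
  then have "t * (2 * (K + 1)) \<le> e" using assms(2) by (simp add: pos_le_divide_eq)
  moreover have "t * (2 * (K + 1)) = 2 * (t * K) + 2 * t" by (simp add: algebra_simps)
  moreover have "t * K \<ge> 0" using t(1) assms(2) by simp
  ultimately have "t * K < e" using t(1) by linarith
  then show ?thesis using that t by blast
qed

lemma flat_supports_convex:
  assumes "flat_along P m q" "q \<in> U" "convex (U \<inter> P)" "y \<in> U" "y \<in> P"
  shows "m \<bullet> y \<le> m \<bullet> q"
proof -
  obtain r where r: "r > 0" "\<And>v. norm v < r \<Longrightarrow> (q + v \<in> P \<longleftrightarrow> m \<bullet> v \<le> 0)"
    using assms(1) unfolding flat_along_def by blast
  obtain t where t: "0 < t" "t \<le> 1" "t * norm (y - q) < r" using small_multiple[OF r(1) norm_ge_zero] .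
  then have nt: "norm (t *\<^sub>R (y - q)) < r" by simp
  have "(1 - t) *\<^sub>R q + t *\<^sub>R y \<in> U \<inter> P"
    using assms flat_along_mem t by (intro convexD) auto
  then have "q + t *\<^sub>R (y - q) \<in> P" by (simp add: algebra_simps)
  then have "m \<bullet> (t *\<^sub>R (y - q)) \<le> 0" using r(2)[OF nt] by simp
  then have "m \<bullet> (y - q) \<le> 0" using t(1) by (simp add: mult_le_0_iff)
  then show ?thesis by (simp add: inner_diff_right)
qed

text \<open>A point \<open>y\<close> of the right-hand side is joined to a flat point \<open>x0\<close> of \<open>C\<close> by a segment of flat
points: contracting a half-ball at \<open>x0\<close> towards \<open>y\<close> stays in \<open>P\<close> by convexity.\<close>

lemma flat_face_eq:
  assumes P: "closed P" and C: "C \<in> components (flat_points P)" and F: "closure C \<subseteq> U" "open U" "convex (U \<inter> P)"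
    and nh: "norm n = 1" "\<And>z. z \<in> C \<Longrightarrow> flat_along P n z \<and> n \<bullet> z = h"
  shows "closure C = U \<inter> P \<inter> {y. n \<bullet> y = h}"
proof
  have CP: "C \<subseteq> P" using nh(2) flat_along_mem by blast
  have "C \<subseteq> {y. n \<bullet> y = h}" using nh(2) by blast
  then have "closure C \<subseteq> {y. n \<bullet> y = h}" by (rule closure_minimal) (rule closed_hyperplane)
  moreover have "closure C \<subseteq> P" using CP P by (rule closure_minimal)
  ultimately show "closure C \<subseteq> U \<inter> P \<inter> {y. n \<bullet> y = h}" using F(1) by blast
  show "U \<inter> P \<inter> {y. n \<bullet> y = h} \<subseteq> closure C"
  proof
    fix y assume y: "y \<in> U \<inter> P \<inter> {y. n \<bullet> y = h}"
    obtain x0 where x0: "x0 \<in> C" using in_components_nonempty[OF C] by blast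
    have x0U: "x0 \<in> U" using x0 F(1) closure_subset by blast
    obtain r where r: "r > 0" "\<And>v. norm v < r \<Longrightarrow> (x0 + v \<in> P \<longleftrightarrow> n \<bullet> v \<le> 0)"
      using nh(2)[OF x0] unfolding flat_along_def by blast
    obtain r1 where r1: "r1 > 0" "ball x0 r1 \<subseteq> U" using F(2) x0U open_contains_ball by blast
    have flat: "flat_along P n ((1 - l) *\<^sub>R y + l *\<^sub>R x0)" if l: "0 < l" "l \<le> 1" for l
    proof -
      define z where "z = (1 - l) *\<^sub>R y + l *\<^sub>R x0"
      have zU: "z \<in> U \<inter> P" unfolding z_def using y x0 x0U CP l F(3) by (intro convexD) auto
      then obtain r2 where r2: "r2 > 0" "ball z r2 \<subseteq> U" using F(2) open_contains_ball by blast
      have nz: "n \<bullet> z = h" using y nh(2)[OF x0] by (simp add: z_def inner_add_right algebra_simps)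
      define r' where "r' = min r2 (l * min r r1)"
      have "r' > 0" using l r(1) r1(1) r2(1) by (simp add: r'_def)
      moreover have "z + v \<in> P \<longleftrightarrow> n \<bullet> v \<le> 0" if v: "norm v < r'" for v
      proof
        assume "z + v \<in> P"
        moreover have "z + v \<in> ball z r2" using v by (simp add: r'_def dist_norm)
        ultimately have "n \<bullet> (z + v) \<le> n \<bullet> x0"
          using flat_supports_convex[of P n x0 U "z + v"] nh(2)[OF x0] x0U F(3) r2(2) by blast
        then show "n \<bullet> v \<le> 0" using nz nh(2)[OF x0] by (simp add: inner_add_right)
      next
        assume nv: "n \<bullet> v \<le> 0"
        have "norm v < l * min r r1" using v by (simp add: r'_def)
        then have nl: "norm (v /\<^sub>R l) < min r r1" using l(1) by (simp add: divide_inverse_commute[symmetric] pos_divide_less_eq mult.commute del: min_less_iff_conj)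
        have "n \<bullet> (v /\<^sub>R l) \<le> 0" using nv l(1) by (simp add: divide_le_0_iff mult_le_0_iff)
        then have "x0 + v /\<^sub>R l \<in> P" using r(2)[of "v /\<^sub>R l"] nl by simp
        moreover have "x0 + v /\<^sub>R l \<in> U" using r1(2) nl by (auto simp: dist_norm subset_iff)
        ultimately have "(1 - l) *\<^sub>R y + l *\<^sub>R (x0 + v /\<^sub>R l) \<in> U \<inter> P"
          using y l F(3) by (intro convexD) auto
        moreover have "(1 - l) *\<^sub>R y + l *\<^sub>R (x0 + v /\<^sub>R l) = z + v" using l(1) by (simp add: z_def algebra_simps)
        ultimately show "z + v \<in> P" by simp
      qed
      ultimately show ?thesis unfolding flat_along_def z_def[symmetric] using nh(1) by blast
    qed
    \<comment> \<open>The segment without \<open>y\<close> is connected and flat, so it lies in the component of \<open>x0\<close>.\<close>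
    define T where "T = (\<lambda>l. (1 - l) *\<^sub>R y + l *\<^sub>R x0) ` {0<..1}"
    have "T \<subseteq> flat_points P" unfolding T_def using flat flat_along_iff by fastforce
    moreover have "connected T" unfolding T_def by (intro connected_continuous_image continuous_intros) auto
    moreover have "x0 \<in> T" unfolding T_def by (rule image_eqI[of _ _ 1]) auto
    ultimately have "T \<subseteq> C" using components_maximal[OF C] x0 by blast
    moreover have "y \<in> closure T"
      unfolding closure_approachable
    proof (intro allI impI)
      fix e :: real assume e: "e > 0"
      obtain l where l: "0 < l" "l \<le> 1" "l * norm (x0 - y) < e" using small_multiple[OF e norm_ge_zero] .
      have "(1 - l) *\<^sub>R y + l *\<^sub>R x0 - y = l *\<^sub>R (x0 - y)" by (simp add: algebra_simps)
      then have "dist ((1 - l) *\<^sub>R y + l *\<^sub>R x0) y = l * norm (x0 - y)" using l(1) by (simp add: dist_norm)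
      then have "dist ((1 - l) *\<^sub>R y + l *\<^sub>R x0) y < e" using l(3) by simp
      then show "\<exists>z\<in>T. dist z y < e" unfolding T_def using l by auto
    qed
    ultimately show "y \<in> closure C" using closure_mono by blast
  qed
qed

section \<open>A polyhedron near an exposed face\<close>

lemma poly_of_insert: "poly_of (insert (n,h) I) = poly_of I \<inter> {y. n \<bullet> y \<le> h}"
  by (auto simp: poly_of_def)

lemma interior_strict:
  assumes "z \<in> interior S" "norm m = 1" "\<And>y. y \<in> S \<Longrightarrow> m \<bullet> y \<le> b" shows "m \<bullet> z < b"
proof -
  obtain r where r: "r > 0" "\<And>v. norm v < r \<Longrightarrow> z + v \<in> S" using assms(1) unfolding mem_interior_translate by blast
  have "z + (r/2) *\<^sub>R m \<in> S" using r assms(2) by simp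
  then have "m \<bullet> (z + (r/2) *\<^sub>R m) \<le> b" by (rule assms(3))
  then show ?thesis using r(1) assms(2) by (simp add: inner_add_right norm_eq_1)
qed

text \<open>The half-spaces \<open>I\<close> are those that \<open>P\<close> coincides with near some flat point in the convex
neighbourhood \<open>U\<close> and whose plane meets \<open>F\<close>, except for the one of \<open>F\<close>.  They suffice to describe
\<open>P\<close> near a point \<open>p\<close> of \<open>F\<close>: a segment from the interior of \<open>P\<close> to a point outside \<open>P\<close> leaves \<open>P\<close>,
if chosen generically, at a flat point, and the plane of that point passes through \<open>p\<close>, so it
belongs to \<open>I\<close> or contains \<open>F\<close>.\<close>

lemma exposed_face_slab:
  assumes P: "solid_polyhedron P" and F: "exposed_face P F"
  shows "\<exists>n h I p0 \<delta>0 W. facet_slab n h I p0 \<delta>0 \<and> open W \<and> poly_of I \<inter> {y. \<bar>n \<bullet> y - h\<bar> \<le> \<delta>0} \<subseteq> W \<and>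
    P \<inter> W = poly_of (insert (n,h) I) \<inter> W \<and> F = poly_of I \<inter> {y. n \<bullet> y = h}"
proof -
  have clP: "closed P" and compP: "compact P" and regP: "P \<subseteq> closure (interior P)"
    using P compact_imp_closed by (auto simp: solid_polyhedron_def)
  obtain C U where C: "C \<in> components (flat_points P)" "F = closure C" and U: "open U" "F \<subseteq> U" "convex (U \<inter> P)"
    using F unfolding exposed_face_def faces_def by blast
  obtain n h where nh: "norm n = 1" "\<And>z. z \<in> C \<Longrightarrow> flat_along P n z \<and> n \<bullet> z = h"
    using component_of_flat_points_planar[OF C(1)] by blast
  have Feq: "F = U \<inter> P \<inter> {y. n \<bullet> y = h}"
    unfolding C(2) by (rule flat_face_eq[OF clP C(1) _ U(1,3) nh]) (use U(2) C(2) in simp)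
  have compF: "compact F"
  proof -
    have "closed F" by (simp add: C(2))
    moreover have "F \<subseteq> P" using Feq by blast
    ultimately show ?thesis using compP by (metis compact_Int_closed inf.absorb_iff2)
  qed
  obtain x0 where x0: "x0 \<in> C" using in_components_nonempty[OF C(1)] by blast
  have x0F: "x0 \<in> F" using x0 C(2) closure_subset by blast
  have x0flat: "flat_along P n x0" "n \<bullet> x0 = h" using nh(2)[OF x0] by auto
  have below: "n \<bullet> y \<le> h" if "y \<in> U" "y \<in> P" for y
    using flat_supports_convex[OF x0flat(1) _ U(3) that] x0F U(2) x0flat(2) by auto
  obtain H0 where "arrangement H0" "union_of_cells H0 P" using solid_polyhedron_union_of_cells[OF P] .
  then obtain H where H: "unit_arrangement H" "union_of_cells H P" using unit_arrangement_exists by blast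
  have finH: "finite H" and H1: "\<And>a b. (a,b) \<in> H \<Longrightarrow> norm a = 1" using H(1) by (auto simp: unit_arrangement_def)
  have arrH: "arrangement H" unfolding arrangement_def using finH H1 by fastforce
  define I where "I = {i\<in>H. i \<noteq> (n,h) \<and> (\<exists>q\<in>U. fst i \<bullet> q = snd i \<and> flat_along P (fst i) q) \<and> (\<exists>p\<in>F. fst i \<bullet> p = snd i)}"
  have finI: "finite I" using finH by (simp add: I_def)
  have I1: "norm (fst i) = 1" if "i \<in> I" for i using that H1[of "fst i" "snd i"] by (simp add: I_def)
  have supp: "fst i \<bullet> y \<le> snd i" if i: "i \<in> I" and y: "y \<in> U" "y \<in> P" for i y
  proof -
    obtain q where "q \<in> U" "fst i \<bullet> q = snd i" "flat_along P (fst i) q" using i unfolding I_def by blast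
    then show ?thesis using flat_supports_convex[OF _ _ U(3) y] by metis
  qed
  have PK: "U \<inter> P \<subseteq> poly_of (insert (n,h) I)"
    unfolding poly_of_insert using supp below by (auto simp: poly_of_def)
  \<comment> \<open>\<open>r1\<close> keeps every plane that misses \<open>p\<close> out of the ball.\<close>
  have near: "\<exists>r>0. ball p r \<subseteq> U \<and> P \<inter> ball p r = poly_of (insert (n,h) I) \<inter> ball p r" if p: "p \<in> F" for p
  proof -
    obtain r1 where r1: "r1 > 0" "\<And>v a b. norm v < r1 \<Longrightarrow> (a,b) \<in> H \<Longrightarrow>
       sgn (a \<bullet> (p + v) - b) = (if a \<bullet> p = b then sgn (a \<bullet> v) else sgn (a \<bullet> p - b))"
      using signs_near[OF finH] by blast
    obtain r2 where r2: "r2 > 0" "ball p r2 \<subseteq> U" using U(1,2) p open_contains_ball by blast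
    define r where "r = min r1 r2"
    have r: "r > 0" "ball p r \<subseteq> U" using r1(1) r2 by (auto simp: r_def)
    have pass: "a \<bullet> p = b" if "(a,b) \<in> H" "q \<in> ball p r" "a \<bullet> q = b" for a b q
    proof (rule ccontr)
      assume "a \<bullet> p \<noteq> b"
      moreover have "norm (q - p) < r1" using that(2) by (simp add: r_def dist_norm norm_minus_commute)
      ultimately have "sgn (a \<bullet> q - b) = sgn (a \<bullet> p - b)" using r1(2)[of "q - p" a b] that(1) by simp
      then show False using that(3) \<open>a \<bullet> p \<noteq> b\<close> by (simp add: sgn_zero_iff)
    qed
    have "poly_of (insert (n,h) I) \<inter> ball p r \<subseteq> P"
    proof
      fix y assume y: "y \<in> poly_of (insert (n,h) I) \<inter> ball p r"
      let ?K = "poly_of (insert (n,h) I)"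
      show "y \<in> P"
      proof (rule ccontr)
        assume "y \<notin> P"
        define B where "B = ball p r - P"
        have "open B" "y \<in> B" using clP y \<open>y \<notin> P\<close> by (auto simp: B_def open_Diff)
        have "p \<in> closure (interior P)" using p Feq regP by blast
        then have "\<exists>z\<in>interior P. dist z p < r" using r(1) unfolding closure_approachable by blast
        then have Z: "interior P \<inter> ball p r \<noteq> {}" by (auto simp: dist_commute)
        have "interior P \<inter> ball p r \<subseteq> ?K" using PK r(2) interior_subset by blast
        then have "interior P \<inter> ball p r \<subseteq> interior ?K" by (intro interior_maximal) auto
        then have "interior ?K \<noteq> {}" using Z by blast
        then have "closure (interior ?K) = closure ?K" using convex_closure_interior[OF convex_poly_of] by blast
        then have "y \<in> closure (interior ?K)" using y closure_subset by blast
        then have V: "interior ?K \<inter> B \<noteq> {}"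
          using \<open>open B\<close> \<open>y \<in> B\<close> by (metis Int_commute closure_iff_nhds_not_empty disjoint_iff open_Int_closure_eq_empty)
        obtain z y' u where zy: "z \<in> interior P \<inter> ball p r" "y' \<in> interior ?K \<inter> B" "0 < u" "u < 1"
            "z + u *\<^sub>R (y' - z) \<in> frontier P" "aligned_at H (z + u *\<^sub>R (y' - z))"
        proof (rule generic_crossing[OF arrH, of "interior P \<inter> ball p r" P "interior ?K \<inter> B"])
          show "interior P \<inter> ball p r \<subseteq> P" using interior_subset by blast
          show "(interior ?K \<inter> B) \<inter> P = {}" by (auto simp: B_def)
        qed (use Z V \<open>open B\<close> that in \<open>auto intro: open_Int\<close>)
        define q where "q = z + u *\<^sub>R (y' - z)"
        have qc: "q = (1 - u) *\<^sub>R z + u *\<^sub>R y'" by (simp add: q_def algebra_simps)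
        have qb: "q \<in> ball p r" unfolding qc using zy by (intro convexD) (auto simp: B_def)
        obtain a b e where ab: "(a,b) \<in> H" "a \<bullet> q = b" "e > 0" "\<And>v. norm v < e \<Longrightarrow> (q + v \<in> P \<longleftrightarrow> a \<bullet> v \<le> 0)"
          using flat_if_aligned[OF H clP regP, of q] zy(5,6) unfolding q_def by metis
        have qf: "flat_along P a q" using ab(3,4) H1[OF ab(1)] unfolding flat_along_def by blast
        have ap: "a \<bullet> p = b" using pass[OF ab(1) qb ab(2)] .
        have "a \<bullet> y' \<le> b"
        proof (cases "(a,b) = (n,h)")
          case True
          then show ?thesis using zy(2) interior_subset[of ?K] unfolding poly_of_insert by auto
        next
          case False
          have "(a,b) \<in> I" unfolding I_def using ab(1,2) False qf qb r(2) p ap by auto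
          moreover have "y' \<in> ?K" using zy(2) interior_subset[of ?K] by blast
          ultimately show ?thesis unfolding poly_of_def by force
        qed
        moreover have "a \<bullet> z < b"
        proof (rule interior_strict[of z "U \<inter> P"])
          show "z \<in> interior (U \<inter> P)" using zy(1) r(2) U(1) by (auto simp: interior_open)
          show "a \<bullet> y \<le> b" if "y \<in> U \<inter> P" for y
            using flat_supports_convex[OF qf _ U(3), of y] that qb r(2) ab(2) by auto
        qed (rule H1[OF ab(1)])
        ultimately have "(1 - u) * (a \<bullet> z) + u * (a \<bullet> y') < (1 - u) * b + u * b"
          using zy(3,4) by (intro add_less_le_mono mult_strict_left_mono mult_left_mono) auto
        then have "a \<bullet> q < b" unfolding qc by (simp add: inner_add_right algebra_simps)
        then show False using ab(2) by simp
      qed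
    qed
    moreover have "P \<inter> ball p r \<subseteq> poly_of (insert (n,h) I)" using PK r(2) by blast
    ultimately show ?thesis using r by blast
  qed
  then obtain R where R: "\<And>p. p \<in> F \<Longrightarrow> R p > 0 \<and> ball p (R p) \<subseteq> U \<and> P \<inter> ball p (R p) = poly_of (insert (n,h) I) \<inter> ball p (R p)"
    by metis
  define W0 where "W0 = (\<Union>p\<in>F. ball p (R p))"
  have W0: "open W0" "F \<subseteq> W0" "W0 \<subseteq> U" "P \<inter> W0 = poly_of (insert (n,h) I) \<inter> W0"
    unfolding W0_def using R by (auto simp: open_UN)
  have FK: "F = poly_of I \<inter> {y. n \<bullet> y = h}"
  proof
    show "F \<subseteq> poly_of I \<inter> {y. n \<bullet> y = h}" using Feq PK unfolding poly_of_insert by blast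
    show "poly_of I \<inter> {y. n \<bullet> y = h} \<subseteq> F"
    proof
      fix y assume y: "y \<in> poly_of I \<inter> {y. n \<bullet> y = h}"
      let ?S = "closed_segment x0 y"
      have x0K: "x0 \<in> poly_of I \<inter> {y. n \<bullet> y = h}" using \<open>F \<subseteq> poly_of I \<inter> {y. n \<bullet> y = h}\<close> x0F by blast
      have "convex (poly_of I \<inter> {y. n \<bullet> y = h})" by (intro convex_Int convex_poly_of convex_hyperplane)
      then have SK: "?S \<subseteq> poly_of I \<inter> {y. n \<bullet> y = h}" by (rule closed_segment_subset[OF x0K y])
      \<comment> \<open>\<open>F\<close> is open and closed in the segment.\<close>
      have eq: "?S \<inter> F = ?S \<inter> W0"
      proof
        show "?S \<inter> F \<subseteq> ?S \<inter> W0" using W0(2) by blast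
        show "?S \<inter> W0 \<subseteq> ?S \<inter> F"
        proof
          fix z assume z: "z \<in> ?S \<inter> W0"
          then have "z \<in> poly_of (insert (n,h) I)" "n \<bullet> z = h" using SK unfolding poly_of_insert by auto
          then have "z \<in> P" using W0(4) z by blast
          then show "z \<in> ?S \<inter> F" using z W0(3) \<open>n \<bullet> z = h\<close> Feq by blast
        qed
      qed
      have "openin (top_of_set ?S) (?S \<inter> F)" unfolding eq using W0(1) by (rule openin_open_Int)
      moreover have "closedin (top_of_set ?S) (?S \<inter> F)" using compF compact_imp_closed by (intro closedin_closed_Int) auto
      moreover have "?S \<inter> F \<noteq> {}" using x0F by auto
      ultimately have "?S \<inter> F = ?S" using connected_segment[of x0 y] unfolding connected_clopen by blast
      then show "y \<in> F" by auto
    qed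
  qed
  \<comment> \<open>On the part of \<open>poly_of I\<close> in the frontier of a neighbourhood of \<open>F\<close> the height differs from \<open>h\<close>, by
    compactness by a fixed amount; so a thinner slab cannot leave the neighbourhood.\<close>
  obtain e where e: "e > 0" "(\<Union>p\<in>F. ball p e) \<subseteq> W0"
    using compact_subset_open_imp_ball_epsilon_subset[OF compF W0(1,2)] by blast
  define W where "W = (\<Union>p\<in>F. ball p e)"
  have W: "open W" "W \<subseteq> W0" "F \<subseteq> W" using e by (auto simp: W_def open_UN)
  have bW: "bounded W"
  proof -
    obtain B where B: "\<And>y. y \<in> F \<Longrightarrow> norm y \<le> B" using compF compact_imp_bounded bounded_iff by metis
    have "norm y \<le> B + e" if yW: "y \<in> W" for y
    proof -
      obtain p where p: "p \<in> F" "dist p y < e" using yW unfolding W_def by auto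
      then show ?thesis using B[OF p(1)] norm_triangle_ineq2[of y p] by (simp add: dist_norm norm_minus_commute)
    qed
    then show ?thesis unfolding bounded_iff by blast
  qed
  have x0K: "x0 \<in> poly_of I" using x0F FK by blast
  define G where "G = poly_of I \<inter> frontier W"
  have compG: "compact G"
  proof -
    have "bounded (frontier W)" using bW bounded_closure frontier_def by (metis Diff_subset bounded_subset)
    then have "compact (frontier W)" using frontier_closed compact_eq_bounded_closed by blast
    then show ?thesis unfolding G_def using closed_poly_of by (metis Int_commute compact_Int_closed)
  qed
  have Gpos: "\<bar>n \<bullet> y - h\<bar> > 0" if "y \<in> G" for y
  proof (rule ccontr)
    assume "\<not> \<bar>n \<bullet> y - h\<bar> > 0"
    then have "y \<in> F" using that FK by (auto simp: G_def)
    then have "y \<in> W" using W(3) by blast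
    then show False using that W(1) by (simp add: G_def frontier_def interior_open)
  qed
  have "\<exists>\<delta>0>0. \<forall>y\<in>G. \<bar>n \<bullet> y - h\<bar> > \<delta>0"
  proof (cases "G = {}")
    case True
    then show ?thesis by (intro exI[of _ 1]) auto
  next
    case False
    have "continuous_on G (\<lambda>y. \<bar>n \<bullet> y - h\<bar>)" by (intro continuous_intros)
    then obtain g where g: "g \<in> G" "\<And>y. y \<in> G \<Longrightarrow> \<bar>n \<bullet> g - h\<bar> \<le> \<bar>n \<bullet> y - h\<bar>"
      using continuous_attains_inf[OF compG False] by blast
    have half_bound: "x \<le> y \<Longrightarrow> x / 2 < y" if "0 < x" for x y :: real using that by simp
    have "\<bar>n \<bullet> g - h\<bar> / 2 < \<bar>n \<bullet> y - h\<bar>" if "y \<in> G" for y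
      using g(2)[OF that] half_bound[OF Gpos[OF g(1)]] by blast
    then show ?thesis using Gpos[OF g(1)] by (intro exI[of _ "\<bar>n \<bullet> g - h\<bar> / 2"]) simp
  qed
  then obtain \<delta>0 where \<delta>0: "\<delta>0 > 0" "\<And>y. y \<in> G \<Longrightarrow> \<bar>n \<bullet> y - h\<bar> > \<delta>0" by blast
  have slab: "poly_of I \<inter> {y. \<bar>n \<bullet> y - h\<bar> \<le> \<delta>0} \<subseteq> W"
  proof
    fix y assume y: "y \<in> poly_of I \<inter> {y. \<bar>n \<bullet> y - h\<bar> \<le> \<delta>0}"
    show "y \<in> W"
    proof (rule ccontr)
      assume "y \<notin> W"
      have x0W: "x0 \<in> W" using x0F W(3) by blast
      have "closed_segment x0 y \<inter> frontier W \<noteq> {}"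
        using x0W \<open>y \<notin> W\<close> by (intro connected_Int_frontier) auto
      then obtain z where z: "z \<in> closed_segment x0 y" "z \<in> frontier W" by blast
      have "y \<in> poly_of I" using y by blast
      then have "z \<in> poly_of I" using closed_segment_subset[OF x0K _ convex_poly_of, of y] z(1) by blast
      then have "\<bar>n \<bullet> z - h\<bar> > \<delta>0" using \<delta>0(2) z(2) by (simp add: G_def)
      obtain u where u: "0 \<le> u" "u \<le> 1" "z = (1 - u) *\<^sub>R x0 + u *\<^sub>R y" using z(1) by (auto simp: closed_segment_def)
      have "n \<bullet> z - h = u * (n \<bullet> y - h)" unfolding u(3) using x0flat(2) by (simp add: inner_add_right algebra_simps)
      then have "\<bar>n \<bullet> z - h\<bar> = u * \<bar>n \<bullet> y - h\<bar>" using u(1) by (simp add: abs_mult)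
      also have "\<dots> \<le> 1 * \<bar>n \<bullet> y - h\<bar>" using u(2) by (intro mult_right_mono) auto
      finally show False using \<open>\<bar>n \<bullet> z - h\<bar> > \<delta>0\<close> y by simp
    qed
  qed
  \<comment> \<open>By \<open>support_at_flat\<close> a flat point lies on no second supporting plane.\<close>
  have only: "fst j \<bullet> q < snd j" if q: "flat_along P m q" "q \<in> U" "m \<bullet> q = b" and j: "j \<in> insert (n,h) I" "j \<noteq> (m,b)" for m b q j
  proof (rule ccontr)
    assume nlt: "\<not> fst j \<bullet> q < snd j"
    have le: "fst j \<bullet> y \<le> snd j" if "y \<in> U" "y \<in> P" for y using PK j(1) that unfolding poly_of_def by blast
    have qP: "q \<in> P" using flat_along_mem[OF q(1)] .
    then have eq: "fst j \<bullet> q = snd j" using le[OF q(2)] nlt by force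
    obtain r where r: "r > 0" "ball q r \<subseteq> U" using U(1) q(2) open_contains_ball by blast
    have "fst j = m"
    proof (rule support_at_flat[OF q(1) _ r(1)])
      show "norm (fst j) = 1" using j(1) I1[of j] nh(1) by auto
      fix v assume v: "norm v < r" "q + v \<in> P"
      then have "q + v \<in> U" using r(2) by (auto simp: dist_norm subset_iff)
      then show "fst j \<bullet> v \<le> 0" using le[of "q + v"] v(2) eq by (simp add: inner_add_right)
    qed
    then have "j = (m,b)" using eq q(3) by (metis prod.collapse)
    then show False using j(2) by simp
  qed
  have nhI: "(n,h) \<notin> I" by (simp add: I_def)
  have "facet_slab n h I x0 \<delta>0"
  proof
    show "finite I" by (rule finI)
    show "norm n = 1" by (rule nh(1))
    show "norm (fst i) = 1" if "i \<in> I" for i using I1[OF that] .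
    show "\<exists>p\<in>poly_of I. n \<bullet> p = h \<and> fst i \<bullet> p = snd i" if "i \<in> I" for i
      using that FK unfolding I_def by blast
    show "\<exists>q. fst i \<bullet> q = snd i \<and> n \<bullet> q < h \<and> (\<forall>j\<in>I-{i}. fst j \<bullet> q < snd j)" if i: "i \<in> I" for i
    proof -
      obtain q where q: "q \<in> U" "fst i \<bullet> q = snd i" "flat_along P (fst i) q" using i unfolding I_def by blast
      have "fst (n,h) \<bullet> q < snd (n,h)"
        by (rule only[OF q(3,1,2)]) (use nhI i in auto)
      moreover have "fst j \<bullet> q < snd j" if "j \<in> I - {i}" for j
        by (rule only[OF q(3,1,2)]) (use that in auto)
      ultimately show ?thesis using q(2) unfolding fst_conv snd_conv by blast
    qed
    show "n \<bullet> x0 = h" by (rule x0flat(2))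
    show "fst j \<bullet> x0 < snd j" if "j \<in> I" for j
      by (rule only[OF x0flat(1) _ x0flat(2)]) (use that x0F U(2) nhI in auto)
    show "\<delta>0 > 0" by (rule \<delta>0(1))
    show "bounded (poly_of I \<inter> {y. \<bar>n \<bullet> y - h\<bar> \<le> \<delta>0})" using bW slab bounded_subset by blast
  qed
  moreover have "P \<inter> W = poly_of (insert (n,h) I) \<inter> W" using W0(4) W(2) by blast
  ultimately show ?thesis using W(1) slab FK by blast
qed

section \<open>Vertices of degree greater than three\<close>

lemma one_sided_direction:
  fixes m1 m2 m3 :: "real^3"
  assumes "m3 \<bullet> cross3 m1 m2 \<noteq> 0"
  obtains d where "d \<noteq> 0" "m1 \<bullet> d = 0" "m2 \<bullet> d = 0" "m3 \<bullet> d < 0"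
    "\<And>v. m1 \<bullet> v = 0 \<Longrightarrow> m2 \<bullet> v = 0 \<Longrightarrow> m3 \<bullet> v \<le> 0 \<Longrightarrow> \<exists>l\<ge>0. v = l *\<^sub>R d"
    "\<And>v. m1 \<bullet> v = 0 \<Longrightarrow> m2 \<bullet> v = 0 \<Longrightarrow> v \<in> range (\<lambda>s. s *\<^sub>R d)"
proof -
  define c where "c = cross3 m1 m2"
  define s where "s = - sgn (m3 \<bullet> c)"
  define d where "d = s *\<^sub>R c"
  have mc: "m3 \<bullet> c \<noteq> 0" using assms by (simp add: c_def)
  have c0: "c \<noteq> 0" using mc by auto
  have s: "s * s = 1" "s \<noteq> 0" using mc by (auto simp: s_def sgn_if)
  have d0: "d \<noteq> 0" using c0 s(2) by (simp add: d_def)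
  have md: "m1 \<bullet> d = 0" "m2 \<bullet> d = 0" by (simp_all add: d_def c_def dot_cross_self)
  have m3d: "m3 \<bullet> d < 0" using mc by (simp add: d_def s_def sgn_if)
  have ex: "\<exists>l. v = l *\<^sub>R d" if v: "m1 \<bullet> v = 0" "m2 \<bullet> v = 0" for v
  proof -
    obtain k where "v = k *\<^sub>R c" using perp_cross[OF v] c0 unfolding c_def by blast
    then have "v = (k * s) *\<^sub>R d" using s(1) by (simp add: d_def mult.assoc)
    then show ?thesis by blast
  qed
  show ?thesis
  proof (rule that[OF d0 md m3d])
    fix v assume v: "m1 \<bullet> v = 0" "m2 \<bullet> v = 0" "m3 \<bullet> v \<le> 0"
    obtain l where l: "v = l *\<^sub>R d" using ex v by blast
    then have "l * (m3 \<bullet> d) \<le> 0" using v(3) by simp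
    then have "l \<ge> 0" using m3d by (simp add: mult_le_0_iff)
    then show "\<exists>l\<ge>0. v = l *\<^sub>R d" using l by blast
  next
    fix v assume "m1 \<bullet> v = 0" "m2 \<bullet> v = 0"
    then show "v \<in> range (\<lambda>s. s *\<^sub>R d)" using ex by blast
  qed
qed

text \<open>At the apex of a cone over a triangle the skeleton consists of three rays, and every edge that
ends there contains the beginning of one of them.\<close>

lemma three_edges_at_simple_vertex:
  fixes m1 m2 m3 x :: "real^3"
  assumes det: "m1 \<bullet> cross3 m2 m3 \<noteq> 0" and n: "norm m1 = 1" "norm m2 = 1" "norm m3 = 1" and r: "r > 0"
    and sk: "\<And>v. norm v < r \<Longrightarrow> (x + v \<in> skeleton P \<longleftrightarrow> (m1 \<bullet> v \<le> 0 \<and> m2 \<bullet> v \<le> 0 \<and> m3 \<bullet> v \<le> 0) \<and>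
        ((m1 \<bullet> v = 0 \<and> m2 \<bullet> v = 0) \<or> (m2 \<bullet> v = 0 \<and> m3 \<bullet> v = 0) \<or> (m3 \<bullet> v = 0 \<and> m1 \<bullet> v = 0)))"
    and x: "x \<notin> edge_points P"
  shows "vertex_degree P x \<le> 3"
proof -
  have dets: "m2 \<bullet> cross3 m3 m1 \<noteq> 0" "m3 \<bullet> cross3 m1 m2 \<noteq> 0"
    using det cross_triple[of m2 m3 m1] cross_triple[of m3 m1 m2] cross_triple[of m1 m2 m3] by (simp_all add: inner_commute)
  obtain d1 where d1: "d1 \<noteq> 0" "m2 \<bullet> d1 = 0" "m3 \<bullet> d1 = 0" "m1 \<bullet> d1 < 0"
    "\<And>v. m2 \<bullet> v = 0 \<Longrightarrow> m3 \<bullet> v = 0 \<Longrightarrow> m1 \<bullet> v \<le> 0 \<Longrightarrow> \<exists>l\<ge>0. v = l *\<^sub>R d1"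
    "\<And>v. m2 \<bullet> v = 0 \<Longrightarrow> m3 \<bullet> v = 0 \<Longrightarrow> v \<in> range (\<lambda>s. s *\<^sub>R d1)"
    using one_sided_direction[OF det] by metis
  obtain d2 where d2: "d2 \<noteq> 0" "m3 \<bullet> d2 = 0" "m1 \<bullet> d2 = 0" "m2 \<bullet> d2 < 0"
    "\<And>v. m3 \<bullet> v = 0 \<Longrightarrow> m1 \<bullet> v = 0 \<Longrightarrow> m2 \<bullet> v \<le> 0 \<Longrightarrow> \<exists>l\<ge>0. v = l *\<^sub>R d2"
    "\<And>v. m3 \<bullet> v = 0 \<Longrightarrow> m1 \<bullet> v = 0 \<Longrightarrow> v \<in> range (\<lambda>s. s *\<^sub>R d2)"
    using one_sided_direction[OF dets(1)] by metis
  obtain d3 where d3: "d3 \<noteq> 0" "m1 \<bullet> d3 = 0" "m2 \<bullet> d3 = 0" "m3 \<bullet> d3 < 0"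
    "\<And>v. m1 \<bullet> v = 0 \<Longrightarrow> m2 \<bullet> v = 0 \<Longrightarrow> m3 \<bullet> v \<le> 0 \<Longrightarrow> \<exists>l\<ge>0. v = l *\<^sub>R d3"
    "\<And>v. m1 \<bullet> v = 0 \<Longrightarrow> m2 \<bullet> v = 0 \<Longrightarrow> v \<in> range (\<lambda>s. s *\<^sub>R d3)"
    using one_sided_direction[OF dets(2)] by metis
  have ray: "x + l *\<^sub>R d \<in> edge_points P"
    if l: "0 < l" "norm (l *\<^sub>R d) < r" and d: "a \<bullet> d = 0" "b \<bullet> d = 0" "c \<bullet> d < 0" "d \<noteq> 0" and nc: "norm c = 1"
      and rng: "\<And>v. a \<bullet> v = 0 \<Longrightarrow> b \<bullet> v = 0 \<Longrightarrow> v \<in> range (\<lambda>s. s *\<^sub>R d)"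
      and sk': "\<And>v. norm v < r \<Longrightarrow> (x + v \<in> skeleton P \<longleftrightarrow> (a \<bullet> v \<le> 0 \<and> b \<bullet> v \<le> 0 \<and> c \<bullet> v \<le> 0) \<and>
        ((a \<bullet> v = 0 \<and> b \<bullet> v = 0) \<or> (b \<bullet> v = 0 \<and> c \<bullet> v = 0) \<or> (c \<bullet> v = 0 \<and> a \<bullet> v = 0)))" for l a b c d
  proof -
    define \<rho> where "\<rho> = min (r - norm (l *\<^sub>R d)) (- (l * (c \<bullet> d)))"
    have \<rho>: "\<rho> > 0" using l d(3) by (simp add: \<rho>_def mult_less_0_iff)
    have "x + l *\<^sub>R d + w \<in> skeleton P \<longleftrightarrow> w \<in> range (\<lambda>s. s *\<^sub>R d)" if w: "norm w < \<rho>" for w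
    proof -
      have nr: "norm (l *\<^sub>R d + w) < r" using norm_triangle_ineq[of "l *\<^sub>R d" w] w by (simp add: \<rho>_def)
      have "c \<bullet> w \<le> norm c * norm w" by (rule norm_cauchy_schwarz)
      then have cneg: "c \<bullet> (l *\<^sub>R d + w) < 0" using w nc by (simp add: \<rho>_def inner_add_right)
      have "x + (l *\<^sub>R d + w) \<in> skeleton P \<longleftrightarrow> a \<bullet> w = 0 \<and> b \<bullet> w = 0"
        unfolding sk'[OF nr] using cneg d(1,2) by (auto simp: inner_add_right)
      moreover have "a \<bullet> w = 0 \<and> b \<bullet> w = 0 \<longleftrightarrow> w \<in> range (\<lambda>s. s *\<^sub>R d)" using rng[of w] d(1,2) by auto
      ultimately show ?thesis by (simp add: add.assoc)
    qed
    then show ?thesis unfolding mem_edge_points using \<rho> d(4) by blast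
  qed
  define E where "E d = connected_component_set (edge_points P) (x + (r / (2 * norm d)) *\<^sub>R d)" for d
  have dirs: "x + l *\<^sub>R d \<in> edge_points P" if "d \<in> {d1,d2,d3}" "0 < l" "norm (l *\<^sub>R d) < r" for d l
  proof -
    have "x + l *\<^sub>R d1 \<in> edge_points P" if "norm (l *\<^sub>R d1) < r"
      by (rule ray[OF \<open>0 < l\<close> that d1(2,3,4,1) n(1) d1(6)]) (use sk in blast)+
    moreover have "x + l *\<^sub>R d2 \<in> edge_points P" if "norm (l *\<^sub>R d2) < r"
      by (rule ray[OF \<open>0 < l\<close> that d2(2,3,4,1) n(2) d2(6)]) (use sk in blast)+
    moreover have "x + l *\<^sub>R d3 \<in> edge_points P" if "norm (l *\<^sub>R d3) < r"
      by (rule ray[OF \<open>0 < l\<close> that d3(2,3,4,1) n(3) d3(6)]) (use sk in blast)+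
    ultimately show ?thesis using that by blast
  qed
  have ray_E: "x + l *\<^sub>R d \<in> E d" if d: "d \<in> {d1,d2,d3}" and l: "0 < l" "norm (l *\<^sub>R d) < r" for d l
  proof -
    have d0: "d \<noteq> 0" using d d1(1) d2(1) d3(1) by blast
    define T where "T = (\<lambda>l. x + l *\<^sub>R d) ` {0<..<r / norm d}"
    have "T \<subseteq> edge_points P"
    proof
      fix y assume "y \<in> T"
      then obtain k where "0 < k" "k < r / norm d" "y = x + k *\<^sub>R d" by (auto simp: T_def)
      then show "y \<in> edge_points P" using dirs[OF d, of k] d0 by (simp add: pos_less_divide_eq)
    qed
    moreover have "connected T" unfolding T_def by (intro connected_continuous_image continuous_intros) auto
    moreover have "x + (r / (2 * norm d)) *\<^sub>R d \<in> T"
      unfolding T_def using r d0 by (intro image_eqI[of _ _ "r / (2 * norm d)"]) (auto simp: field_simps)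
    moreover have "x + l *\<^sub>R d \<in> T" unfolding T_def using l d0 by (intro image_eqI[of _ _ l]) (auto simp: field_simps)
    ultimately show ?thesis unfolding E_def using connected_component_maximal by blast
  qed
  have "{e \<in> edges P. x \<in> e} \<subseteq> (\<lambda>d. closure (E d)) ` {d1,d2,d3}"
  proof
    fix e assume "e \<in> {e \<in> edges P. x \<in> e}"
    then obtain C where C: "C \<in> components (edge_points P)" "e = closure C" "x \<in> closure C" unfolding edges_def by blast
    then obtain y where y: "y \<in> C" "dist y x < r" using r unfolding closure_approachable by blast
    have yE: "y \<in> edge_points P" using y(1) C(1) in_components_subset by blast
    define v where "v = y - x"
    have v: "norm v < r" "y = x + v" using y(2) by (auto simp: v_def dist_norm)
    have v0: "v \<noteq> 0" using x yE v(2) by auto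
    have "y \<in> skeleton P"
    proof -
      obtain d' r' where "r' > 0" "\<forall>v. norm v < r' \<longrightarrow> (y + v \<in> skeleton P \<longleftrightarrow> v \<in> range (\<lambda>s. s *\<^sub>R d'))"
        using yE unfolding mem_edge_points by blast
      then have "y + 0 \<in> skeleton P \<longleftrightarrow> 0 \<in> range (\<lambda>s. s *\<^sub>R d')" by (metis norm_zero)
      moreover have "0 \<in> range (\<lambda>s. s *\<^sub>R d')" by (rule range_eqI[of _ _ 0]) simp
      ultimately show ?thesis by simp
    qed
    then have "(m1 \<bullet> v \<le> 0 \<and> m2 \<bullet> v \<le> 0 \<and> m3 \<bullet> v \<le> 0) \<and>
        ((m1 \<bullet> v = 0 \<and> m2 \<bullet> v = 0) \<or> (m2 \<bullet> v = 0 \<and> m3 \<bullet> v = 0) \<or> (m3 \<bullet> v = 0 \<and> m1 \<bullet> v = 0))"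
      using sk[OF v(1)] v(2) by simp
    then have "(\<exists>l\<ge>0. v = l *\<^sub>R d1) \<or> (\<exists>l\<ge>0. v = l *\<^sub>R d2) \<or> (\<exists>l\<ge>0. v = l *\<^sub>R d3)"
      using d1(5) d2(5) d3(5) by meson
    then obtain l d where l: "d \<in> {d1,d2,d3}" "l \<ge> 0" "v = l *\<^sub>R d" by blast
    then have "l > 0" using v0 by (cases "l = 0") auto
    then have "y \<in> E d" using ray_E[OF l(1)] v l(3) by simp
    moreover have "C = connected_component_set (edge_points P) y"
      using C(1) y(1) by (metis connected_component_eq in_components_subset components_iff)
    moreover have "E d = connected_component_set (edge_points P) y"
      using \<open>y \<in> E d\<close> unfolding E_def by (rule connected_component_eq[symmetric])
    ultimately have "e = closure (E d)" using C(2) by simp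
    then show "e \<in> (\<lambda>d. closure (E d)) ` {d1,d2,d3}" using l(1) by (rule image_eqI)
  qed
  then have "card {e \<in> edges P. x \<in> e} \<le> card ((\<lambda>d. closure (E d)) ` {d1,d2,d3})" by (intro card_mono) auto
  also have "\<dots> \<le> card {d1,d2,d3}" by (rule card_image_le) simp
  also have "\<dots> \<le> 3" by (simp add: card_insert_if)
  finally show ?thesis by (simp add: vertex_degree_def)
qed

text \<open>Suppose that every facet through \<open>x\<close> meets the plane of \<open>F\<close> in a second point.  Then three facets
through \<open>x\<close> are impossible by \<open>three_facets_relation\<close>, applied in the plane of \<open>F\<close>.  With no facet
\<open>x\<close> would be flat, with one it would be an edge point, and with two the degree is at most 3.\<close>

lemma (in facet_slab) many_edges_imp_tip:
  assumes W: "open W" "P \<inter> W = poly_of (insert (n,h) I) \<inter> W"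
    and x: "x \<in> W" "x \<in> poly_of I" "n \<bullet> x = h" "x \<in> vertices P" and deg: "vertex_degree P x > 3"
  shows "\<exists>i\<in>I. slice i 0 = {x}"
proof (rule ccontr)
  assume no_tip: "\<not> ?thesis"
  define A where "A = {i\<in>I. fst i \<bullet> x = snd i}"
  let ?N = "insert (n,h) I"
  have N: "finite ?N" "\<And>i. i \<in> ?N \<Longrightarrow> norm (fst i) = 1" using fin a1 n1 by auto
  have nhI: "(n,h) \<notin> I" using centre(1) centre(2)[of "(n,h)"] by auto
  have xsk: "x \<in> skeleton P" "x \<notin> edge_points P" using x(4) by (auto simp: vertices_def)
  have "\<exists>f. f \<in> slice i 0 \<and> f \<noteq> x" if "i \<in> A" for i
  proof -
    have "x \<in> slice i 0" using that x by (simp add: A_def slice_def)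
    moreover have "slice i 0 \<noteq> {x}" using no_tip that by (auto simp: A_def)
    ultimately show ?thesis by blast
  qed
  then obtain f where f: "\<And>i. i \<in> A \<Longrightarrow> f i \<in> slice i 0 \<and> f i \<noteq> x" by metis
  have indep: "n \<bullet> cross3 (fst i) (fst j) \<noteq> 0" if "i \<in> A" "j \<in> A" "i \<noteq> j" for i j
    using facets_cross_level[of i j x] that x(3) by (auto simp: A_def)
  have strict: "fst j \<bullet> (f i - x) < 0" if ij: "i \<in> A" "j \<in> A" "i \<noteq> j" for i j
  proof -
    have fi: "f i \<in> poly_of I" "fst i \<bullet> f i = snd i" "n \<bullet> f i = h" "f i \<noteq> x" using f[OF ij(1)] by (auto simp: slice_def)
    have "fst j \<bullet> (f i - x) \<le> 0" using fi(1) ij(2) by (auto simp: A_def poly_of_def inner_diff_right)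
    moreover have "fst j \<bullet> (f i - x) \<noteq> 0"
    proof
      assume 0: "fst j \<bullet> (f i - x) = 0"
      have "fst i \<bullet> (f i - x) = 0" using fi(2) ij(1) by (simp add: A_def inner_diff_right)
      moreover have "cross3 (fst i) (fst j) \<noteq> 0" using indep[OF ij] by auto
      ultimately obtain k where k: "f i - x = k *\<^sub>R cross3 (fst i) (fst j)" using perp_cross 0 by blast
      have "n \<bullet> (f i - x) = 0" using fi(3) x(3) by (simp add: inner_diff_right)
      then have "k = 0" using indep[OF ij] unfolding k by simp
      then show False using k fi(4) by simp
    qed
    ultimately show ?thesis by simp
  qed
  have no3: False if ijk: "i \<in> A" "j \<in> A" "k \<in> A" "i \<noteq> j" "j \<noteq> k" "i \<noteq> k" for i j k
  proof -
    \<comment> \<open>projection to the plane of \<open>F\<close>, where three vectors are dependent\<close>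
    define pr where "pr v = v - (n \<bullet> v) *\<^sub>R n" for v
    have nn: "n \<bullet> n = 1" "n \<noteq> 0" using n1 by (auto simp: norm_eq_1)
    have "n \<bullet> pr v = 0" for v using nn(1) by (simp add: pr_def inner_diff_right)
    then have "pr v \<bullet> n = 0" for v by (simp add: inner_commute)
    then obtain c1 c2 c3 where c: "(c1,c2,c3) \<noteq> (0,0,0::real)" "c1 *\<^sub>R pr (fst i) + c2 *\<^sub>R pr (fst j) + c3 *\<^sub>R pr (fst k) = 0"
      using dependent_if_perp[OF nn(2), of "pr (fst i)" "pr (fst j)" "pr (fst k)"] by blast
    define \<kappa> where "\<kappa> = c1 * (n \<bullet> fst i) + c2 * (n \<bullet> fst j) + c3 * (n \<bullet> fst k)"
    have rel: "c1 *\<^sub>R fst i + c2 *\<^sub>R fst j + c3 *\<^sub>R fst k = \<kappa> *\<^sub>R n"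
      using c(2) by (simp add: pr_def \<kappa>_def algebra_simps)
    have q0: "n \<bullet> (f m - x) = 0" "fst m \<bullet> (f m - x) = 0" if "m \<in> A" for m
      using f[OF that] that x(3) by (auto simp: slice_def A_def inner_diff_right)
    have "c1 = 0 \<and> c2 = 0 \<and> c3 = 0"
      by (rule three_facets_relation[OF rel, of "f i - x" "f j - x" "f k - x"])
        (use ijk q0 strict in auto)
    then show False using c(1) by simp
  qed
  obtain r1 where r1: "r1 > 0" "\<And>v a b. norm v < r1 \<Longrightarrow> (a,b) \<in> ?N \<Longrightarrow>
       sgn (a \<bullet> (x + v) - b) = (if a \<bullet> x = b then sgn (a \<bullet> v) else sgn (a \<bullet> x - b))"
    using signs_near[OF N(1)] by blast
  obtain r2 where r2: "r2 > 0" "ball x r2 \<subseteq> W" using W(1) x(1) open_contains_ball by blast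
  define r where "r = min r1 r2"
  have r: "r > 0" using r1(1) r2(1) by (simp add: r_def)
  have skW: "skeleton P \<inter> W = skeleton (poly_of ?N) \<inter> W"
    by (rule local_eq_on_open[where f=skeleton, OF germ_eq_skeleton W])
  have act: "(fst p \<bullet> (x + v) \<le> snd p \<longleftrightarrow> (fst p \<bullet> x = snd p \<longrightarrow> fst p \<bullet> v \<le> 0)) \<and> (fst p \<bullet> (x + v) = snd p \<longleftrightarrow> fst p \<bullet> x = snd p \<and> fst p \<bullet> v = 0)"
    if p: "p \<in> ?N" and v: "norm v < r" for p v
  proof (cases "fst p \<bullet> x = snd p")
    case True
    then show ?thesis by (auto simp: inner_add_right)
  next
    case False
    have "fst p \<bullet> x \<le> snd p" using p x(2,3) by (auto simp: poly_of_def)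
    then have "fst p \<bullet> x < snd p" using False by simp
    moreover have "sgn (fst p \<bullet> (x + v) - snd p) = sgn (fst p \<bullet> x - snd p)"
      using r1(2)[of v "fst p" "snd p"] p v False by (simp add: r_def)
    ultimately show ?thesis using False by (auto simp: sgn_if split: if_splits)
  qed
  have sk: "x + v \<in> skeleton P \<longleftrightarrow> (\<forall>p\<in>insert (n,h) A. fst p \<bullet> v \<le> 0) \<and>
      (\<exists>p\<in>insert (n,h) A. \<exists>q\<in>insert (n,h) A. p \<noteq> q \<and> fst p \<bullet> v = 0 \<and> fst q \<bullet> v = 0)" if v: "norm v < r" for v
  proof -
    have "x + v \<in> W" using v r2(2) by (auto simp: r_def dist_norm subset_iff)
    then have "x + v \<in> skeleton P \<longleftrightarrow> x + v \<in> skeleton (poly_of ?N)" using skW by blast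
    also have "\<dots> \<longleftrightarrow> x + v \<in> {y \<in> poly_of ?N. \<exists>p\<in>?N. \<exists>q\<in>?N. p \<noteq> q \<and> fst p \<bullet> y = snd p \<and> fst q \<bullet> y = snd q}"
      by (simp only: skeleton_poly_of[OF N])
    also have "\<dots> \<longleftrightarrow> (\<forall>p\<in>?N. fst p \<bullet> (x + v) \<le> snd p) \<and> (\<exists>p\<in>?N. \<exists>q\<in>?N. p \<noteq> q \<and> fst p \<bullet> (x + v) = snd p \<and> fst q \<bullet> (x + v) = snd q)"
      by (simp only: poly_of_def mem_Collect_eq)
    also have "\<dots> \<longleftrightarrow> (\<forall>p\<in>?N. fst p \<bullet> x = snd p \<longrightarrow> fst p \<bullet> v \<le> 0) \<and>
        (\<exists>p\<in>?N. \<exists>q\<in>?N. p \<noteq> q \<and> (fst p \<bullet> x = snd p \<and> fst p \<bullet> v = 0) \<and> (fst q \<bullet> x = snd q \<and> fst q \<bullet> v = 0))"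
      (is "?L1 \<and> ?L2 \<longleftrightarrow> ?R1 \<and> ?R2")
    proof -
      have "?L1 \<longleftrightarrow> ?R1"
      proof (rule ball_cong[OF refl])
        fix p assume "p \<in> ?N"
        from act[OF this v] show "fst p \<bullet> (x + v) \<le> snd p \<longleftrightarrow> (fst p \<bullet> x = snd p \<longrightarrow> fst p \<bullet> v \<le> 0)" by (rule conjunct1)
      qed
      moreover have "?L2 \<longleftrightarrow> ?R2"
      proof (rule bex_cong[OF refl], rule bex_cong[OF refl])
        fix p q assume pq: "p \<in> ?N" "q \<in> ?N"
        have "fst p \<bullet> (x + v) = snd p \<longleftrightarrow> fst p \<bullet> x = snd p \<and> fst p \<bullet> v = 0" using act[OF pq(1) v] by (rule conjunct2)
        moreover have "fst q \<bullet> (x + v) = snd q \<longleftrightarrow> fst q \<bullet> x = snd q \<and> fst q \<bullet> v = 0" using act[OF pq(2) v] by (rule conjunct2)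
        ultimately show "(p \<noteq> q \<and> fst p \<bullet> (x + v) = snd p \<and> fst q \<bullet> (x + v) = snd q) \<longleftrightarrow>
          (p \<noteq> q \<and> (fst p \<bullet> x = snd p \<and> fst p \<bullet> v = 0) \<and> (fst q \<bullet> x = snd q \<and> fst q \<bullet> v = 0))" by (simp only:)
      qed
      ultimately show ?thesis by (simp only:)
    qed
    also have "\<dots> \<longleftrightarrow> (\<forall>p\<in>insert (n,h) A. fst p \<bullet> v \<le> 0) \<and>
      (\<exists>p\<in>insert (n,h) A. \<exists>q\<in>insert (n,h) A. p \<noteq> q \<and> fst p \<bullet> v = 0 \<and> fst q \<bullet> v = 0)"
    proof -
      have "insert (n,h) A = {p\<in>?N. fst p \<bullet> x = snd p}" using x(3) by (auto simp: A_def)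
      then show ?thesis by (simp only: Ball_def Bex_def mem_Collect_eq) blast
    qed
    finally show ?thesis .
  qed
  have "\<exists>p\<in>insert (n,h) A. \<exists>q\<in>insert (n,h) A. p \<noteq> q" using sk[of 0] xsk(1) r by auto
  then obtain i where i: "i \<in> A" by blast
  show False
  proof (cases "A = {i}")
    case True
    have iI: "i \<in> I" using i by (simp add: A_def)
    have ci: "cross3 n (fst i) \<noteq> 0" by (rule cross_nonzero[OF iI])
    have ne: "(n,h) \<noteq> i" using iI nhI by blast
    have "x + v \<in> skeleton P \<longleftrightarrow> v \<in> range (\<lambda>s. s *\<^sub>R cross3 n (fst i))" if "norm v < r" for v
    proof -
      have "x + v \<in> skeleton P \<longleftrightarrow> n \<bullet> v = 0 \<and> fst i \<bullet> v = 0" unfolding sk[OF that] True using ne by auto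
      also have "\<dots> \<longleftrightarrow> v \<in> range (\<lambda>s. s *\<^sub>R cross3 n (fst i))"
      proof
        assume "n \<bullet> v = 0 \<and> fst i \<bullet> v = 0"
        then obtain c where "v = c *\<^sub>R cross3 n (fst i)" using perp_cross ci by blast
        then show "v \<in> range (\<lambda>s. s *\<^sub>R cross3 n (fst i))" by blast
      qed (auto simp: dot_cross_self)
      finally show ?thesis .
    qed
    then have "x \<in> edge_points P" unfolding mem_edge_points using ci r by blast
    then show False using xsk(2) by simp
  next
    case False
    then obtain j where j: "j \<in> A" "i \<noteq> j" using i by blast
    have A: "A = {i,j}" using no3[OF i j(1)] i j by blast
    have ne: "(n,h) \<noteq> i" "(n,h) \<noteq> j" using i j(1) nhI by (auto simp: A_def)
    have "vertex_degree P x \<le> 3"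
    proof (rule three_edges_at_simple_vertex[OF indep[OF i j(1,2)] n1 _ _ r _ xsk(2)])
      show "norm (fst i) = 1" "norm (fst j) = 1" using i j(1) a1 by (auto simp: A_def)
      show "x + v \<in> skeleton P \<longleftrightarrow> (n \<bullet> v \<le> 0 \<and> fst i \<bullet> v \<le> 0 \<and> fst j \<bullet> v \<le> 0) \<and>
        ((n \<bullet> v = 0 \<and> fst i \<bullet> v = 0) \<or> (fst i \<bullet> v = 0 \<and> fst j \<bullet> v = 0) \<or> (fst j \<bullet> v = 0 \<and> n \<bullet> v = 0))" if "norm v < r" for v
        unfolding sk[OF that] A using ne j(2) by auto
    qed
    then show False using deg by simp
  qed
qed

section \<open>Pushing the face\<close>

text \<open>As \<open>W\<close> contains the slab, the material added or removed at heights close to \<open>h\<close> stays away from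
the parts of \<open>P\<close> outside \<open>W\<close>, which may pass through the same heights.\<close>

locale pushed_face = facet_slab +
  fixes P W :: "(real^3) set"
  assumes solid: "solid_polyhedron P" and open_W: "open W"
    and slab_W: "poly_of I \<inter> {y. \<bar>n \<bullet> y - h\<bar> \<le> \<delta>0} \<subseteq> W"
    and P_W: "P \<inter> W = poly_of (insert (n,h) I) \<inter> W"
begin

definition thin :: "real \<Rightarrow> (real^3) set" where
  "thin t = poly_of I \<inter> {y. \<bar>n \<bullet> y - h\<bar> \<le> t}"

definition pushed :: "real \<Rightarrow> (real^3) set" where
  "pushed s = (P - thin \<delta>0) \<union> (poly_of I \<inter> {y. h - \<delta>0 \<le> n \<bullet> y \<and> n \<bullet> y \<le> h + s})"

lemma closed_P: "closed P" and compact_P: "compact P" and regular_P: "P = closure (interior P)"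
  using solid compact_imp_closed by (auto simp: solid_polyhedron_def)

lemma closed_thin: "closed (thin t)"
proof -
  have "{y. \<bar>n \<bullet> y - h\<bar> \<le> t} = {y. n \<bullet> y \<le> h + t} \<inter> {y. n \<bullet> y \<ge> h - t}" by auto
  then show ?thesis unfolding thin_def by (auto intro!: closed_Int closed_poly_of closed_halfspace_le closed_halfspace_ge)
qed

lemma mem_P: "y \<in> W \<Longrightarrow> y \<in> P \<longleftrightarrow> y \<in> poly_of I \<and> n \<bullet> y \<le> h"
  using P_W unfolding poly_of_insert by blast

lemma thin_W: "t \<le> \<delta>0 \<Longrightarrow> thin t \<subseteq> W"
  using slab_W by (force simp: thin_def)

lemma pushed_W:
  assumes "\<bar>s\<bar> \<le> \<delta>0" shows "pushed s \<inter> W = poly_of (insert (n,h+s) I) \<inter> W"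
proof -
  have "y \<in> pushed s \<longleftrightarrow> y \<in> poly_of I \<and> n \<bullet> y \<le> h + s" if "y \<in> W" for y
  proof -
    have "y \<in> pushed s \<longleftrightarrow> (y \<in> poly_of I \<and> n \<bullet> y \<le> h \<and> \<not> \<bar>n \<bullet> y - h\<bar> \<le> \<delta>0) \<or> (y \<in> poly_of I \<and> h - \<delta>0 \<le> n \<bullet> y \<and> n \<bullet> y \<le> h + s)"
      using mem_P[OF that] by (auto simp: pushed_def thin_def)
    then show ?thesis using assms by auto
  qed
  then show ?thesis unfolding poly_of_insert by blast
qed

lemma pushed_off:
  assumes "\<bar>s\<bar> \<le> t" "t \<le> \<delta>0" shows "pushed s \<inter> - thin t = P \<inter> - thin t"
proof -
  have "y \<in> pushed s \<longleftrightarrow> y \<in> P" if y: "y \<notin> thin t" for y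
  proof (cases "y \<in> thin \<delta>0")
    case True
    then have yW: "y \<in> W" and K: "y \<in> poly_of I" using thin_W[of \<delta>0] by (auto simp: thin_def)
    have "y \<in> pushed s \<longleftrightarrow> n \<bullet> y \<le> h + s" using pushed_W[of s] yW K assms unfolding poly_of_insert by auto
    moreover have "\<not> \<bar>n \<bullet> y - h\<bar> \<le> t" using y K by (simp add: thin_def)
    ultimately show ?thesis using mem_P[OF yW] K assms(1) by auto
  next
    case False
    then show ?thesis using assms by (auto simp: pushed_def thin_def)
  qed
  then show ?thesis by blast
qed

lemma pushed_0: "pushed 0 = P"
proof -
  have "y \<in> pushed 0 \<longleftrightarrow> y \<in> P" for y
  proof (cases "y \<in> thin \<delta>0")
    case True
    then have "y \<in> W" using thin_W[of \<delta>0] by auto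
    then show ?thesis using pushed_W[of 0] bdd(1) P_W by auto
  next
    case False
    then show ?thesis using pushed_off[of 0 \<delta>0] bdd(1) by auto
  qed
  then show ?thesis by blast
qed

text \<open>Near each point the pushed polyhedron looks like \<open>P\<close> or like a convex polyhedron; closedness and
regularity follow from this.\<close>

lemma pushed_local:
  assumes "\<bar>s\<bar> \<le> \<delta>0"
  obtains "germ_eq (pushed s) x P x" | "x \<in> W" "germ_eq (pushed s) x (poly_of (insert (n,h+s) I)) x"
proof (cases "x \<in> thin \<delta>0")
  case True
  then have "x \<in> W" using thin_W[of \<delta>0] by auto
  then show ?thesis using germ_eq_open[OF open_W pushed_W[OF assms]] that(2) by blast
next
  case False
  have "open (- thin \<delta>0)" using closed_thin by blast
  then show ?thesis using germ_eq_open[OF _ pushed_off[OF assms order_refl], of x] False that(1) by blast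
qed

lemma room:
  obtains \<delta>1 where "\<delta>1 > 0" "\<delta>1 \<le> \<delta>0" "\<And>u j. \<bar>u\<bar> \<le> \<delta>1 \<Longrightarrow> j \<in> I \<Longrightarrow> fst j \<bullet> (p0 + u *\<^sub>R n) < snd j"
proof -
  have "\<exists>e>0. \<forall>s. \<bar>s\<bar> \<le> e \<longrightarrow> fst j \<bullet> (p0 + s *\<^sub>R n) < snd j" if "j \<in> I" for j
    using affine_pos_near_0[of "snd j - fst j \<bullet> p0" "- (fst j \<bullet> n)"] centre(2)[OF that]
    by (force simp: algebra_simps inner_add_right)
  then obtain d where d: "d > 0" "\<forall>j\<in>I. \<forall>s. \<bar>s\<bar> \<le> d \<longrightarrow> fst j \<bullet> (p0 + s *\<^sub>R n) < snd j"
    using uniform_delta[OF fin, of "\<lambda>j s. fst j \<bullet> (p0 + s *\<^sub>R n) < snd j"] by blast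
  show ?thesis by (rule that[of "min d \<delta>0"]) (use d bdd(1) in auto)
qed

lemma nn: "n \<bullet> n = 1" "n \<noteq> 0"
  using n1 by (auto simp: norm_eq_1)

lemma solid_pushed:
  assumes \<delta>1: "\<delta>1 > 0" "\<delta>1 \<le> \<delta>0" "\<And>u j. \<bar>u\<bar> \<le> \<delta>1 \<Longrightarrow> j \<in> I \<Longrightarrow> fst j \<bullet> (p0 + u *\<^sub>R n) < snd j"
    and s: "\<bar>s\<bar> < \<delta>1"
  shows "solid_polyhedron (pushed s)"
proof -
  have s0: "\<bar>s\<bar> \<le> \<delta>0" using s \<delta>1 by simp
  let ?N = "insert (n,h+s) I"
  define c where "c = p0 + (-\<delta>1) *\<^sub>R n"
  have cI: "fst j \<bullet> c < snd j" if "j \<in> ?N" for j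
    using that \<delta>1(3)[of "-\<delta>1" j] \<delta>1(1) s centre(1) nn by (auto simp: c_def inner_add_right inner_diff_right)
  have "open (\<Inter>j\<in>?N. {y. fst j \<bullet> y < snd j})" using fin by (intro open_INT) (auto simp: open_halfspace_lt)
  moreover have "(\<Inter>j\<in>?N. {y. fst j \<bullet> y < snd j}) \<subseteq> poly_of ?N" unfolding poly_of_def by (auto intro: less_imp_le)
  ultimately have "(\<Inter>j\<in>?N. {y. fst j \<bullet> y < snd j}) \<subseteq> interior (poly_of ?N)" by (intro interior_maximal)
  then have cint: "c \<in> interior (poly_of ?N)" using cI by blast
  then have "interior (poly_of ?N) \<noteq> {}" by blast
  then have reg: "poly_of ?N \<subseteq> closure (interior (poly_of ?N))"
    using convex_closure_interior[OF convex_poly_of] closure_subset by metis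
  have germ_ci: "y \<in> closure (interior T)" if "germ_eq S x T y" "x \<in> closure (interior S)" for S T and x y :: "real^3"
  proof (rule germ_eq_closure[OF _ that(2)])
    show "germ_eq (interior S) x (interior T) y"
      by (rule germ_eq_local[where f=interior, OF germ_eq_interior that(1)])
  qed
  have cl: "closure (pushed s) \<subseteq> pushed s"
  proof
    fix x assume x: "x \<in> closure (pushed s)"
    show "x \<in> pushed s"
    proof (rule pushed_local[OF s0, of x])
      assume g: "germ_eq (pushed s) x P x"
      then have "x \<in> P" using germ_eq_closure[OF g x] closed_P by simp
      then show ?thesis using germ_eq_mem[OF g] by simp
    next
      assume g: "germ_eq (pushed s) x (poly_of ?N) x"
      then have "x \<in> poly_of ?N" using germ_eq_closure[OF g x] closed_poly_of by simp
      then show ?thesis using germ_eq_mem[OF g] by simp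
    qed
  qed
  have regQ: "pushed s \<subseteq> closure (interior (pushed s))"
  proof
    fix x assume x: "x \<in> pushed s"
    show "x \<in> closure (interior (pushed s))"
    proof (rule pushed_local[OF s0, of x])
      assume g: "germ_eq (pushed s) x P x"
      then have "x \<in> closure (interior P)" using x germ_eq_mem[OF g] regular_P by simp
      then show ?thesis using germ_ci[OF germ_eq_sym[OF g]] by blast
    next
      assume g: "germ_eq (pushed s) x (poly_of ?N) x"
      then have "x \<in> closure (interior (poly_of ?N))" using x germ_eq_mem[OF g] reg by blast
      then show ?thesis using germ_ci[OF germ_eq_sym[OF g]] by blast
    qed
  qed
  have clQ: "closed (pushed s)" using cl by (metis closure_subset closure_eq subset_antisym)
  have "pushed s \<subseteq> P \<union> thin \<delta>0" using s0 by (auto simp: pushed_def thin_def)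
  moreover have "bounded (P \<union> thin \<delta>0)" using compact_imp_bounded[OF compact_P] bdd(2) unfolding thin_def by simp
  ultimately have "bounded (pushed s)" using bounded_subset by blast
  then have comp: "compact (pushed s)" using clQ compact_eq_bounded_closed by blast
  have cN: "c \<in> poly_of ?N" using cint interior_subset by blast
  moreover have "n \<bullet> c = h - \<delta>1" using centre(1) nn(1) by (simp add: c_def inner_add_right inner_diff_right)
  ultimately have "c \<in> thin \<delta>0" using \<delta>1 unfolding poly_of_insert thin_def by auto
  then have "c \<in> W" using thin_W[of \<delta>0] by auto
  then have "c \<in> pushed s" using pushed_W[OF s0] cN by blast
  then have int: "interior (pushed s) \<noteq> {}" using regQ by auto
  have eq: "pushed s = closure (interior (pushed s))"
    using regQ closure_mono[OF interior_subset, of "pushed s"] clQ by auto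
  obtain H where H: "arrangement H" "union_of_cells H P" using solid_polyhedron_union_of_cells[OF solid] .
  define G where "G = H \<union> I \<union> {(n,h-\<delta>0),(n,h+\<delta>0),(n,h+s)}"
  have "a \<noteq> 0" if "(a,b) \<in> I" for a b using a1[OF that] by auto
  then have "\<forall>(a,b)\<in>I. a \<noteq> 0" by blast
  then have arrG: "arrangement G" using H(1) fin nn(2) unfolding arrangement_def G_def by auto
  have uP: "union_of_cells G P" using H(2) by (rule union_of_cells_mono) (auto simp: G_def)
  have uK: "union_of_cells G (poly_of I)"
  proof -
    have "poly_of I = \<Inter>((\<lambda>i. {y. fst i \<bullet> y \<le> snd i}) ` I)" by (auto simp: poly_of_def)
    moreover have "union_of_cells G {y. fst i \<bullet> y \<le> snd i}" if "i \<in> I" for i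
      by (rule union_of_cells_halfspace) (use that in \<open>simp add: G_def\<close>)
    then have "union_of_cells G (\<Inter>((\<lambda>i. {y. fst i \<bullet> y \<le> snd i}) ` I))" by (intro union_of_cells_Inter) blast
    ultimately show ?thesis by (simp only:)
  qed
  have u1: "union_of_cells G {y. n \<bullet> y \<le> h + \<delta>0}" "union_of_cells G {y. n \<bullet> y \<ge> h - \<delta>0}" "union_of_cells G {y. n \<bullet> y \<le> h + s}"
    by (auto simp: G_def intro!: union_of_cells_halfspace union_of_cells_halfspace_ge)
  have e1: "thin \<delta>0 = poly_of I \<inter> ({y. n \<bullet> y \<le> h + \<delta>0} \<inter> {y. n \<bullet> y \<ge> h - \<delta>0})" by (auto simp: thin_def)
  have e2: "pushed s = (P - thin \<delta>0) \<union> (poly_of I \<inter> ({y. n \<bullet> y \<ge> h - \<delta>0} \<inter> {y. n \<bullet> y \<le> h + s}))" by (auto simp: pushed_def)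
  have "union_of_cells G (pushed s)"
    unfolding e2 e1 by (intro union_of_cells_Un union_of_cells_Int union_of_cells_Diff uP uK u1)
  then show ?thesis using solid_polyhedronI[OF arrG _ comp int eq] by blast
qed

lemma level_not_facet: "(n,c) \<notin> I"
proof
  assume *: "(n,c) \<in> I"
  obtain p where "n \<bullet> p = h" "n \<bullet> p = c" using touch[OF *] by auto
  then show False using centre(2)[OF *] centre(1) by simp
qed

lemma skeleton_pushed:
  assumes t: "0 < t" "t \<le> \<delta>0" and s: "s \<in> {-t,0,t}"
  shows "skeleton (pushed s) \<inter> thin t = capped t s" and "skeleton (pushed s) - thin t = skeleton P - thin t"
proof -
  have st: "\<bar>s\<bar> \<le> t" using s t by auto
  let ?N = "insert (n,h+s) I"
  have "skeleton (pushed s) \<inter> - thin t = skeleton P \<inter> - thin t"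
    using closed_thin pushed_off[OF st t(2)] by (intro local_eq_on_open[where f=skeleton, OF germ_eq_skeleton]) auto
  then show "skeleton (pushed s) - thin t = skeleton P - thin t" by (simp add: Diff_eq)
  have N: "finite ?N" "\<And>i. i \<in> ?N \<Longrightarrow> norm (fst i) = 1" using fin a1 n1 by auto
  have "skeleton (pushed s) \<inter> W = skeleton (poly_of ?N) \<inter> W"
    using pushed_W[of s] st t by (intro local_eq_on_open[where f=skeleton, OF germ_eq_skeleton open_W]) auto
  then have "skeleton (pushed s) \<inter> thin t = skeleton (poly_of ?N) \<inter> thin t" using thin_W[OF t(2)] by blast
  also have "\<dots> = capped t s"
  proof (intro equalityI subsetI)
    fix y assume y: "y \<in> skeleton (poly_of ?N) \<inter> thin t"
    then have "y \<in> {y \<in> poly_of ?N. \<exists>i\<in>?N. \<exists>j\<in>?N. i \<noteq> j \<and> fst i \<bullet> y = snd i \<and> fst j \<bullet> y = snd j}"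
      using skeleton_poly_of[OF N] by blast
    then obtain i j where K: "y \<in> poly_of I" "n \<bullet> y \<le> h + s" and ij: "i \<in> ?N" "j \<in> ?N" "i \<noteq> j" "fst i \<bullet> y = snd i" "fst j \<bullet> y = snd j"
      unfolding poly_of_insert by blast
    have b: "- t \<le> n \<bullet> y - h" "n \<bullet> y - h \<le> s" using y K(2) by (auto simp: thin_def)
    have "(\<exists>i\<in>I. \<exists>j\<in>I. i \<noteq> j \<and> fst i \<bullet> y = snd i \<and> fst j \<bullet> y = snd j) \<or> (n \<bullet> y - h = s \<and> (\<exists>i\<in>I. fst i \<bullet> y = snd i))"
    proof (cases "i \<in> I \<and> j \<in> I")
      case True
      then show ?thesis using ij by blast
    next
      case False
      then consider "i = (n,h+s)" "j \<in> I" | "j = (n,h+s)" "i \<in> I" using ij by blast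
      then show ?thesis using ij(4,5) by cases auto
    qed
    then show "y \<in> capped t s" unfolding capped_def using K b by blast
  next
    fix y assume y: "y \<in> capped t s"
    then have K: "y \<in> poly_of I" "- t \<le> n \<bullet> y - h" "n \<bullet> y - h \<le> s" by (auto simp: capped_def)
    have "\<exists>i\<in>?N. \<exists>j\<in>?N. i \<noteq> j \<and> fst i \<bullet> y = snd i \<and> fst j \<bullet> y = snd j"
    proof (cases "\<exists>i\<in>I. \<exists>j\<in>I. i \<noteq> j \<and> fst i \<bullet> y = snd i \<and> fst j \<bullet> y = snd j")
      case True
      then show ?thesis by blast
    next
      case False
      then obtain i where i: "n \<bullet> y - h = s" "i \<in> I" "fst i \<bullet> y = snd i" using y unfolding capped_def by blast
      moreover have "fst (n,h+s) \<bullet> y = snd (n,h+s)" using i(1) by simp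
      moreover have "(n,h+s) \<noteq> i" using level_not_facet i(2) by blast
      ultimately show ?thesis by blast
    qed
    moreover have "y \<in> poly_of ?N" using K unfolding poly_of_insert by auto
    ultimately have "y \<in> skeleton (poly_of ?N)" using skeleton_poly_of[OF N] by blast
    moreover have "y \<in> thin t" using K st by (auto simp: thin_def)
    ultimately show "y \<in> skeleton (poly_of ?N) \<inter> thin t" by blast
  qed
  finally show "skeleton (pushed s) \<inter> thin t = capped t s" .
qed

text \<open>Outside the thin slab the three skeletons agree, so their lengths there cancel.\<close>

theorem edge_length_pushed:
  assumes tip: "i0 \<in> I" "slice i0 0 = {x0}"
  shows "\<exists>\<delta>>0. \<exists>c>0. \<forall>t. 0 < t \<longrightarrow> t \<le> \<delta> \<longrightarrow>
    total_edge_length (pushed t) + total_edge_length (pushed (-t)) \<le> 2 * total_edge_length P - c * t"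
proof -
  obtain \<delta> c where \<delta>c: "\<delta> > 0" "c > 0" "\<And>t \<L>. 0 < t \<Longrightarrow> t \<le> \<delta> \<Longrightarrow> line_family \<L> \<Longrightarrow> capped t t \<union> capped t 0 \<union> capped t (-t) \<subseteq> covered \<L> \<Longrightarrow>
    len \<L> (capped t t) + len \<L> (capped t (-t)) \<le> 2 * len \<L> (capped t 0) - c * t"
    using slab_length[OF tip] by metis
  obtain \<delta>1 where \<delta>1: "\<delta>1 > 0" "\<delta>1 \<le> \<delta>0" "\<And>u j. \<bar>u\<bar> \<le> \<delta>1 \<Longrightarrow> j \<in> I \<Longrightarrow> fst j \<bullet> (p0 + u *\<^sub>R n) < snd j"
    using room by metis
  have "total_edge_length (pushed t) + total_edge_length (pushed (-t)) \<le> 2 * total_edge_length P - c * t"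
    if t: "0 < t" "t \<le> min \<delta> (\<delta>1 / 2)" for t
  proof -
    have sol: "solid_polyhedron (pushed s)" if "s \<in> {-t,0,t}" for s
      by (rule solid_pushed[OF \<delta>1]) (use that t in auto)
    have "\<exists>M. finite M \<and> (\<forall>l\<in>M. norm (snd l) = 1) \<and> skeleton (pushed s) \<subseteq> covered M" if "s \<in> {-t,0,t}" for s
      using skeleton_subset_lines[OF sol[OF that]] unfolding covered_def by metis
    then obtain M where M: "\<And>s. s \<in> {-t,0,t} \<Longrightarrow> finite (M s) \<and> (\<forall>l\<in>M s. norm (snd l) = 1) \<and> skeleton (pushed s) \<subseteq> covered (M s)"
      by metis
    have "finite (\<Union>s\<in>{-t,0,t}. M s)" "\<forall>l\<in>(\<Union>s\<in>{-t,0,t}. M s). norm (snd l) = 1" using M by auto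
    then obtain \<L> where L: "line_family \<L>" "covered \<L> = covered (\<Union>s\<in>{-t,0,t}. M s)" using line_family_exists by metis
    have cov: "skeleton (pushed s) \<subseteq> covered \<L>" if "s \<in> {-t,0,t}" for s
    proof -
      have "covered (M s) \<subseteq> covered (\<Union>s\<in>{-t,0,t}. M s)" using that unfolding covered_def by blast
      then show ?thesis using M[OF that] L(2) by blast
    qed
    have t0: "t \<le> \<delta>0" using t \<delta>1(1,2) by simp
    define X where "X = skeleton P - thin t"
    have split: "total_edge_length (pushed s) = len \<L> X + len \<L> (capped t s) \<and> capped t s \<subseteq> covered \<L>" if s: "s \<in> {-t,0,t}" for s
    proof -
      note tel = total_edge_length_eq_len[OF sol[OF s] L(1) cov[OF s]]
      note sk = skeleton_pushed[OF t(1) t0 s]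
      have th: "thin t \<in> sets borel" using closed_thin by simp
      have "len \<L> (X \<union> capped t s) = len \<L> X + len \<L> (capped t s)"
      proof (rule len_Un[OF L(1)])
        show "X \<in> sets borel" unfolding X_def sk(2)[symmetric] using tel(2) th by (rule sets.Diff)
        show "capped t s \<in> sets borel" unfolding sk(1)[symmetric] using tel(2) th by (rule sets.Int)
        show "bounded X" unfolding X_def sk(2)[symmetric] using tel(3) by (rule bounded_subset) blast
        show "bounded (capped t s)" unfolding sk(1)[symmetric] using tel(3) by (rule bounded_subset) blast
        have "X \<inter> capped t s = {}" unfolding X_def sk(1)[symmetric] by blast
        then show "finite (X \<inter> capped t s)" by simp
      qed
      moreover have "X \<union> capped t s = skeleton (pushed s)" unfolding X_def sk(1)[symmetric] sk(2)[symmetric] by blast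
      moreover have "capped t s \<subseteq> covered \<L>" using cov[OF s] sk(1) by blast
      ultimately show ?thesis using tel(1) by simp
    qed
    have "len \<L> (capped t t) + len \<L> (capped t (-t)) \<le> 2 * len \<L> (capped t 0) - c * t"
      using \<delta>c(3)[OF t(1) _ L(1)] t split by simp
    then show ?thesis using split[of t] split[of "-t"] split[of 0] pushed_0 by simp
  qed
  then show ?thesis using \<delta>c(1,2) \<delta>1(1) by (intro exI[of _ "min \<delta> (\<delta>1/2)"] conjI exI[of _ c]) auto
qed

section \<open>Volume\<close>

text \<open>Rotate \<open>n\<close> to a coordinate axis and enclose the set in a box.\<close>

lemma thin_slab_measure:
  assumes "S \<subseteq> cball 0 R" "S \<subseteq> {y. a \<le> n \<bullet> y \<and> n \<bullet> y \<le> a + t}" "0 \<le> t" "0 \<le> R" "S \<in> lmeasurable"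
  shows "measure lebesgue S \<le> 4 * R\<^sup>2 * t"
proof -
  have ax: "norm (axis 1 1 :: real^3) = 1" by simp
  obtain f :: "real^3 \<Rightarrow> real^3" where f: "orthogonal_transformation f" "f (axis 1 1) = n"
    using orthogonal_transformation_exists_1[OF ax n1] by blast
  define u :: "real^3" where "u = (\<chi> i. if i = 1 then a else - R)"
  define w :: "real^3" where "w = (\<chi> i. if i = 1 then a + t else R)"
  have "S \<subseteq> f ` cbox u w"
  proof
    fix y assume y: "y \<in> S"
    have "surj f" using f(1) by (simp add: orthogonal_transformation_surj)
    then obtain x where x: "y = f x" by blast
    have "x $ 1 = n \<bullet> y" using f unfolding x orthogonal_transformation_def
      by (metis cart_eq_inner_axis inner_commute)
    then have "a \<le> x $ 1" "x $ 1 \<le> a + t" using y assms(2) by auto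
    moreover have "norm x \<le> R" using y assms(1) f(1) x by (auto simp: orthogonal_transformation_norm)
    then have "\<bar>x $ i\<bar> \<le> R" for i using component_le_norm_cart[of x i] by linarith
    then have "- R \<le> x $ i \<and> x $ i \<le> R" for i using abs_le_iff[of "x $ i" R] by force
    ultimately have "x \<in> cbox u w" by (simp add: mem_box_cart u_def w_def)
    then show "y \<in> f ` cbox u w" using x by blast
  qed
  then have "measure lebesgue S \<le> measure lebesgue (f ` cbox u w)"
    using assms(5) f(1) by (intro measure_mono_fmeasurable measurable_orthogonal_image) auto
  also have "\<dots> = measure lebesgue (cbox u w)" using f(1) by (intro measure_orthogonal_image) auto
  also have "\<dots> = (\<Prod>i\<in>UNIV. w $ i - u $ i)"
  proof -
    have "u \<in> cbox u w" using assms(3,4) by (simp add: mem_box_cart u_def w_def)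
    then have "cbox u w \<noteq> {}" by blast
    then show ?thesis by (simp add: content_cbox_cart)
  qed
  also have "\<dots> = (w $ 1 - u $ 1) * ((w $ 2 - u $ 2) * (w $ 3 - u $ 3))"
    unfolding UNIV_3 by simp
  also have "\<dots> = 4 * R\<^sup>2 * t"
  proof -
    have "u $ 1 = a" "u $ 2 = -R" "u $ 3 = -R" "w $ 1 = a + t" "w $ 2 = R" "w $ 3 = R"
      by (simp_all add: u_def w_def)
    then show ?thesis by (simp only: power2_eq_square) (simp add: algebra_simps)
  qed
  finally show ?thesis .
qed

definition upper :: "real \<Rightarrow> (real^3) set" where
  "upper t = poly_of I \<inter> {y. h \<le> n \<bullet> y \<and> n \<bullet> y \<le> h + t}"

definition lower :: "real \<Rightarrow> (real^3) set" where
  "lower t = poly_of I \<inter> {y. h - t \<le> n \<bullet> y \<and> n \<bullet> y \<le> h}"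

lemma slabs_measurable:
  assumes "0 \<le> t" "t \<le> \<delta>0" shows "upper t \<in> lmeasurable" "lower t \<in> lmeasurable" "upper t \<subseteq> thin t" "lower t \<subseteq> thin t"
proof -
  show sub: "upper t \<subseteq> thin t" "lower t \<subseteq> thin t" using assms by (auto simp: upper_def lower_def thin_def)
  have "thin t \<subseteq> poly_of I \<inter> {y. \<bar>n \<bullet> y - h\<bar> \<le> \<delta>0}" using assms by (auto simp: thin_def)
  then have "bounded (thin t)" using bdd(2) bounded_subset by blast
  then have b: "bounded (upper t)" "bounded (lower t)" using sub bounded_subset by blast+
  have "upper t = poly_of I \<inter> {y. n \<bullet> y \<ge> h} \<inter> {y. n \<bullet> y \<le> h + t}" "lower t = poly_of I \<inter> {y. n \<bullet> y \<ge> h - t} \<inter> {y. n \<bullet> y \<le> h}"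
    by (auto simp: upper_def lower_def)
  then have "closed (upper t)" "closed (lower t)" by (auto intro!: closed_Int closed_poly_of closed_halfspace_le closed_halfspace_ge)
  then show "upper t \<in> lmeasurable" "lower t \<in> lmeasurable"
    using b compact_eq_bounded_closed lmeasurable_compact by blast+
qed

lemma measure_Un_negligible:
  fixes S T :: "'a::euclidean_space set"
  assumes "S \<in> lmeasurable" "T \<in> lmeasurable" "negligible (S \<inter> T)"
  shows "measure lebesgue (S \<union> T) = measure lebesgue S + measure lebesgue T"
  using measure_Un3[OF assms(1,2)] assms(3) negligible_imp_measure0 by fastforce

lemma pushed_eq_Un:
  assumes t: "0 < t" "t \<le> \<delta>0"
  shows "pushed t = P \<union> upper t" and "P = pushed (-t) \<union> lower t"
    and "P \<inter> upper t \<subseteq> {y. n \<bullet> y = h}" and "pushed (-t) \<inter> lower t \<subseteq> {y. n \<bullet> y = h - t}"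
proof -
  have st: "\<bar>t\<bar> \<le> \<delta>0" "\<bar>-t\<bar> \<le> \<delta>0" using t by auto
  have cases: "y \<in> W \<or> y \<notin> thin t" for y using thin_W[OF t(2)] by blast
  have W: "y \<in> pushed s \<longleftrightarrow> y \<in> poly_of I \<and> n \<bullet> y \<le> h + s" if "y \<in> W" "\<bar>s\<bar> \<le> \<delta>0" for y s
    using pushed_W[OF that(2)] that(1) unfolding poly_of_insert by blast
  have off: "y \<in> pushed s \<longleftrightarrow> y \<in> P" if "y \<notin> thin t" "\<bar>s\<bar> \<le> t" for y s
    using pushed_off[OF that(2) t(2)] that(1) by blast
  have up: "upper t \<subseteq> thin t" and lo: "lower t \<subseteq> thin t" using slabs_measurable t by auto
  show "pushed t = P \<union> upper t"
  proof (rule set_eqI)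
    fix y show "y \<in> pushed t \<longleftrightarrow> y \<in> P \<union> upper t"
    proof (cases "y \<in> W")
      case True
      then show ?thesis using W[OF True st(1)] mem_P[OF True] t by (auto simp: upper_def)
    next
      case False
      then have "y \<notin> thin t" using cases by blast
      then show ?thesis using off[of y t] t up by auto
    qed
  qed
  show "P \<inter> upper t \<subseteq> {y. n \<bullet> y = h}"
  proof
    fix y assume y: "y \<in> P \<inter> upper t"
    then have "y \<in> W" using up thin_W[OF t(2)] by blast
    then show "y \<in> {y. n \<bullet> y = h}" using mem_P y by (auto simp: upper_def)
  qed
  show "P = pushed (-t) \<union> lower t"
  proof (rule set_eqI)
    fix y show "y \<in> P \<longleftrightarrow> y \<in> pushed (-t) \<union> lower t"
    proof (cases "y \<in> W")
      case True
      then show ?thesis using W[OF True st(2)] mem_P[OF True] t by (auto simp: lower_def)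
    next
      case False
      then have "y \<notin> thin t" using cases by blast
      then show ?thesis using off[of y "-t"] t lo by auto
    qed
  qed
  show "pushed (-t) \<inter> lower t \<subseteq> {y. n \<bullet> y = h - t}"
  proof
    fix y assume y: "y \<in> pushed (-t) \<inter> lower t"
    then have "y \<in> W" using lo thin_W[OF t(2)] by blast
    then show "y \<in> {y. n \<bullet> y = h - t}" using W[OF _ st(2)] y by (auto simp: lower_def)
  qed
qed

lemma volume_pushed:
  assumes t: "0 < t" "t \<le> \<delta>0" and meas: "pushed (-t) \<in> lmeasurable"
  shows "volume (pushed t) = volume P + measure lebesgue (upper t)"
    and "volume P = volume (pushed (-t)) + measure lebesgue (lower t)"
proof -
  have plane: "negligible {y. n \<bullet> y = c}" for c using nn(2) by (intro negligible_hyperplane) simp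
  have mP: "P \<in> lmeasurable" using compact_P lmeasurable_compact by blast
  note eq = pushed_eq_Un[OF t]
  have "negligible (P \<inter> upper t)" by (rule negligible_subset[OF plane eq(3)])
  then show "volume (pushed t) = volume P + measure lebesgue (upper t)"
    unfolding volume_def eq(1) using measure_Un_negligible[OF mP] slabs_measurable t by simp
  have "negligible (pushed (-t) \<inter> lower t)" by (rule negligible_subset[OF plane eq(4)])
  then have "measure lebesgue (pushed (-t) \<union> lower t) = measure lebesgue (pushed (-t)) + measure lebesgue (lower t)"
    using measure_Un_negligible[OF meas] slabs_measurable[of t] t by simp
  then show "volume P = volume (pushed (-t)) + measure lebesgue (lower t)"
    unfolding volume_def by (simp only: eq(2)[symmetric])
qed

text \<open>A contraction towards a point of \<open>poly_of I\<close> above \<open>F\<close> moves the lower slab into the upper one, and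
its ratio \<open>1 - l\<close> tends to 1 linearly in \<open>t\<close>.\<close>

lemma upper_lower:
  assumes \<delta>1: "\<delta>1 > 0" "\<delta>1 \<le> \<delta>0" "\<And>u j. \<bar>u\<bar> \<le> \<delta>1 \<Longrightarrow> j \<in> I \<Longrightarrow> fst j \<bullet> (p0 + u *\<^sub>R n) < snd j"
    and t: "0 < t" "t \<le> \<delta>0"
  shows "measure lebesgue (upper t) \<ge> (1 - 3 * (t / \<delta>1)) * measure lebesgue (lower t)"
proof -
  define c where "c = p0 + \<delta>1 *\<^sub>R n"
  \<comment> \<open>chosen so that the bottom of the lower slab moves to the height \<open>h\<close>\<close>
  define l where "l = t / (t + \<delta>1)"
  have l: "0 < l" "l < 1" "l \<le> t / \<delta>1" "l * (t + \<delta>1) = t"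
    using t(1) \<delta>1(1) by (auto simp: l_def field_simps)
  have cK: "c \<in> poly_of I" "n \<bullet> c = h + \<delta>1"
    using \<delta>1(3)[of \<delta>1] \<delta>1(1) centre(1) nn(1) by (auto simp: c_def poly_of_def inner_add_right less_imp_le)
  have "(\<lambda>y. (1 - l) *\<^sub>R y + l *\<^sub>R c) ` lower t \<subseteq> upper t"
  proof
    fix z assume "z \<in> (\<lambda>y. (1 - l) *\<^sub>R y + l *\<^sub>R c) ` lower t"
    then obtain y where y: "y \<in> poly_of I" "h - t \<le> n \<bullet> y" "n \<bullet> y \<le> h" "z = (1 - l) *\<^sub>R y + l *\<^sub>R c" by (auto simp: lower_def)
    have "z \<in> poly_of I" unfolding y(4) using y(1) cK(1) l by (intro convexD[OF convex_poly_of]) auto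
    moreover have nz: "n \<bullet> z = (1 - l) * (n \<bullet> y) + l * (h + \<delta>1)" by (simp add: y(4) inner_add_right cK(2))
    have "(1 - l) * (n \<bullet> y) \<ge> (1 - l) * (h - t)" using y(2) l(2) by (intro mult_left_mono) auto
    then have "n \<bullet> z \<ge> h" unfolding nz using l(4) by (simp add: algebra_simps)
    moreover have "(1 - l) * (n \<bullet> y) \<le> (1 - l) * h" using y(3) l(2) by (intro mult_left_mono) auto
    then have "n \<bullet> z \<le> h + l * \<delta>1" unfolding nz by (simp add: algebra_simps)
    moreover have "l * t \<ge> 0" using l(1) t(1) by simp
    then have "l * \<delta>1 \<le> t" using l(4) by (simp add: distrib_left)
    ultimately show "z \<in> upper t" by (simp add: upper_def)
  qed
  then have "measure lebesgue ((\<lambda>y. (1 - l) *\<^sub>R y + l *\<^sub>R c) ` lower t) \<le> measure lebesgue (upper t)"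
  proof (rule measure_mono_fmeasurable)
    show "(\<lambda>y. (1 - l) *\<^sub>R y + l *\<^sub>R c) ` lower t \<in> sets lebesgue"
    proof -
      have "compact (lower t)"
      proof -
        have "lower t = poly_of I \<inter> {y. n \<bullet> y \<ge> h - t} \<inter> {y. n \<bullet> y \<le> h}" by (auto simp: lower_def)
        then have "closed (lower t)" by (auto intro!: closed_Int closed_poly_of closed_halfspace_le closed_halfspace_ge)
        moreover have "bounded (lower t)" using bdd(2) by (rule bounded_subset) (use t in \<open>auto simp: lower_def\<close>)
        ultimately show ?thesis using compact_eq_bounded_closed by blast
      qed
      then have "compact ((\<lambda>y. (1 - l) *\<^sub>R y + l *\<^sub>R c) ` lower t)" by (intro compact_continuous_image continuous_intros)
      then show ?thesis using lmeasurable_compact fmeasurableD by blast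
    qed
    show "upper t \<in> lmeasurable" using slabs_measurable t by simp
  qed
  moreover have "measure lebesgue ((\<lambda>y. (1 - l) *\<^sub>R y + l *\<^sub>R c) ` lower t) = (1 - l) ^ 3 * measure lebesgue (lower t)"
    using measure_lebesgue_affine[of "1 - l" "l *\<^sub>R c" "lower t"] l(2) by simp
  moreover have "(1 - l) ^ 3 \<ge> 1 - 3 * (t / \<delta>1)"
  proof -
    have "1 + real 3 * (- l) \<le> (1 + (- l)) ^ 3" by (rule Bernoulli_inequality) (use l in auto)
    then show ?thesis using l(3) by simp
  qed
  then have "(1 - l) ^ 3 * measure lebesgue (lower t) \<ge> (1 - 3 * (t / \<delta>1)) * measure lebesgue (lower t)"
    by (intro mult_right_mono) auto
  ultimately show ?thesis by linarith
qed

theorem volume_estimates: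
  "\<exists>\<delta>>0. \<exists>C\<ge>0. \<forall>t. 0 < t \<longrightarrow> t \<le> \<delta> \<longrightarrow> solid_polyhedron (pushed t) \<and> solid_polyhedron (pushed (-t)) \<and>
    \<bar>volume (pushed t) - volume P\<bar> \<le> C * t \<and> \<bar>volume (pushed (-t)) - volume P\<bar> \<le> C * t \<and>
    volume (pushed t) + volume (pushed (-t)) \<ge> 2 * volume P - C * t\<^sup>2"
proof -
  obtain \<delta>1 where \<delta>1: "\<delta>1 > 0" "\<delta>1 \<le> \<delta>0" "\<And>u j. \<bar>u\<bar> \<le> \<delta>1 \<Longrightarrow> j \<in> I \<Longrightarrow> fst j \<bullet> (p0 + u *\<^sub>R n) < snd j"
    using room by metis
  obtain R0 where R0: "\<And>y. y \<in> poly_of I \<inter> {y. \<bar>n \<bullet> y - h\<bar> \<le> \<delta>0} \<Longrightarrow> norm y \<le> R0" using bdd(2) bounded_iff by metis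
  define R where "R = \<bar>R0\<bar>"
  have R: "R \<ge> 0" "thin \<delta>0 \<subseteq> cball 0 R"
  proof -
    show "R \<ge> 0" by (simp add: R_def)
    show "thin \<delta>0 \<subseteq> cball 0 R"
    proof
      fix y assume "y \<in> thin \<delta>0"
      then have "norm y \<le> R0" using R0 by (simp add: thin_def)
      then show "y \<in> cball 0 R" by (simp add: R_def)
    qed
  qed
  define C1 where "C1 = 4 * R\<^sup>2"
  define C where "C = C1 + 3 * C1 / \<delta>1"
  have C1: "C1 \<ge> 0" by (simp add: C1_def)
  have CC: "C \<ge> C1" "C \<ge> 3 * C1 / \<delta>1" "C \<ge> 0" using C1 \<delta>1(1) by (auto simp: C_def)
  have main: "solid_polyhedron (pushed t) \<and> solid_polyhedron (pushed (-t)) \<and>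
    \<bar>volume (pushed t) - volume P\<bar> \<le> C * t \<and> \<bar>volume (pushed (-t)) - volume P\<bar> \<le> C * t \<and>
    volume (pushed t) + volume (pushed (-t)) \<ge> 2 * volume P - C * t\<^sup>2" if t: "0 < t" "t \<le> \<delta>1 / 2" for t
  proof -
    have sol: "solid_polyhedron (pushed t)" "solid_polyhedron (pushed (-t))"
      by (rule solid_pushed[OF \<delta>1]; use t in simp)+
    have t0: "t \<le> \<delta>0" using t \<delta>1 by simp
    have "thin t \<subseteq> thin \<delta>0" using t0 by (auto simp: thin_def)
    then have sub: "upper t \<subseteq> cball 0 R" "lower t \<subseteq> cball 0 R" using slabs_measurable(3,4)[of t] t t0 R(2) by auto
    have up: "measure lebesgue (upper t) \<le> C1 * t" unfolding C1_def
      by (rule thin_slab_measure[OF sub(1), of h]) (use t t0 R(1) slabs_measurable[of t] in \<open>auto simp: upper_def\<close>)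
    have lo: "measure lebesgue (lower t) \<le> C1 * t" unfolding C1_def
      by (rule thin_slab_measure[OF sub(2), of "h - t"]) (use t t0 R(1) slabs_measurable[of t] in \<open>auto simp: lower_def\<close>)
    have m: "pushed (-t) \<in> lmeasurable" using sol(2) lmeasurable_compact by (auto simp: solid_polyhedron_def)
    note vol = volume_pushed[OF t(1) t0 m]
    have ul: "measure lebesgue (upper t) \<ge> (1 - 3 * (t / \<delta>1)) * measure lebesgue (lower t)"
      by (rule upper_lower[OF \<delta>1 t(1) t0])
    have Ct: "C1 * t \<le> C * t" using CC(1) t(1) by (intro mult_right_mono) auto
    have "3 * (t / \<delta>1) * measure lebesgue (lower t) \<le> 3 * (t / \<delta>1) * (C1 * t)"
      using lo t(1) \<delta>1(1) by (intro mult_left_mono) auto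
    also have "\<dots> = (3 * C1 / \<delta>1) * t\<^sup>2" by (simp add: power2_eq_square)
    also have "\<dots> \<le> C * t\<^sup>2" using CC(2) by (intro mult_right_mono) auto
    finally have sq: "3 * (t / \<delta>1) * measure lebesgue (lower t) \<le> C * t\<^sup>2" .
    have up0: "measure lebesgue (upper t) \<ge> 0" "measure lebesgue (lower t) \<ge> 0" by simp_all
    have "measure lebesgue (upper t) - measure lebesgue (lower t) \<ge> - C * t\<^sup>2"
      using ul sq by (simp add: left_diff_distrib)
    then show ?thesis using sol vol up lo Ct up0 by (simp add: abs_le_iff)
  qed
  show ?thesis using \<delta>1(1) CC(3) main by (intro exI[of _ "\<delta>1/2"] conjI exI[of _ C]) auto
qed

end

section \<open>Hausdorff distance\<close>

lemma hausdorff_dist_bound: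
  fixes A B :: "'a::metric_space set"
  assumes "A \<noteq> {}" "B \<noteq> {}" "\<And>a. a \<in> A \<Longrightarrow> \<exists>b\<in>B. dist a b \<le> e" "\<And>b. b \<in> B \<Longrightarrow> \<exists>a\<in>A. dist b a \<le> e"
  shows "0 \<le> hausdorff_dist A B" "hausdorff_dist A B \<le> e"
proof -
  have A: "infdist a B \<le> e" if "a \<in> A" for a using assms(3)[OF that] infdist_le2 by blast
  have B: "infdist b A \<le> e" if "b \<in> B" for b using assms(4)[OF that] infdist_le2 by blast
  have "(SUP a\<in>A. infdist a B) \<le> e" "(SUP b\<in>B. infdist b A) \<le> e"
    using A B assms(1,2) by (auto intro!: cSUP_least)
  then show "hausdorff_dist A B \<le> e" by (simp add: hausdorff_dist_def)
  obtain a where a: "a \<in> A" using assms(1) by blast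
  have "bdd_above ((\<lambda>a. infdist a B) ` A)" using A by (auto intro!: bdd_aboveI)
  then have "infdist a B \<le> (SUP a\<in>A. infdist a B)" by (rule cSUP_upper[OF a])
  then show "0 \<le> hausdorff_dist A B" using infdist_nonneg[of a B] by (simp add: hausdorff_dist_def)
qed

text \<open>A point in the difference of \<open>P\<close> and \<open>pushed t\<close> or \<open>pushed (- t)\<close> reaches the smaller set when it is moved towards
a fixed point of \<open>poly_of I\<close> below \<open>F\<close> by a fraction of order \<open>t\<close> of the distance.\<close>

theorem (in pushed_face) hausdorff_pushed:
  "\<exists>\<delta>>0. \<exists>C. \<forall>t. 0 < t \<longrightarrow> t \<le> \<delta> \<longrightarrow>
    0 \<le> hausdorff_dist (pushed t) P \<and> hausdorff_dist (pushed t) P \<le> C * t \<and>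
    0 \<le> hausdorff_dist (pushed (-t)) P \<and> hausdorff_dist (pushed (-t)) P \<le> C * t"
proof -
  obtain \<delta>1 where \<delta>1: "\<delta>1 > 0" "\<delta>1 \<le> \<delta>0" "\<And>u j. \<bar>u\<bar> \<le> \<delta>1 \<Longrightarrow> j \<in> I \<Longrightarrow> fst j \<bullet> (p0 + u *\<^sub>R n) < snd j"
    using room by metis
  obtain R where R: "\<And>y. y \<in> thin \<delta>0 \<Longrightarrow> norm y \<le> R" using bdd(2) bounded_iff unfolding thin_def by metis
  define c where "c = p0 + (-\<delta>1) *\<^sub>R n"
  have cK: "c \<in> poly_of I" "n \<bullet> c = h - \<delta>1"
    using \<delta>1(3)[of "-\<delta>1"] \<delta>1(1) centre(1) nn(1) by (auto simp: c_def poly_of_def inner_add_right inner_diff_right less_imp_le)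
  have c_thin: "c \<in> thin \<delta>0" using cK \<delta>1(1,2) by (simp add: thin_def)
  then have R0: "R \<ge> 0" using R[of c] norm_ge_zero[of c] by linarith
  define C where "C = 2 * R / \<delta>1"
  have C0: "C \<ge> 0" using R0 \<delta>1(1) by (simp add: C_def)
  have slide: "\<exists>z. z \<in> poly_of I \<and> n \<bullet> z = (1 - l) * (n \<bullet> y) + l * (h - \<delta>1) \<and> dist y z \<le> C * t"
    if y: "y \<in> thin \<delta>0" and l: "0 \<le> l" "l \<le> 1" "l \<le> t / \<delta>1" for y l t
  proof (intro exI[of _ "(1 - l) *\<^sub>R y + l *\<^sub>R c"] conjI)
    show "(1 - l) *\<^sub>R y + l *\<^sub>R c \<in> poly_of I"
      using y l cK(1) by (intro convexD[OF convex_poly_of]) (auto simp: thin_def)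
    show "n \<bullet> ((1 - l) *\<^sub>R y + l *\<^sub>R c) = (1 - l) * (n \<bullet> y) + l * (h - \<delta>1)" by (simp add: inner_add_right cK(2))
    have "y - ((1 - l) *\<^sub>R y + l *\<^sub>R c) = l *\<^sub>R (y - c)" by (simp add: algebra_simps)
    then have "dist y ((1 - l) *\<^sub>R y + l *\<^sub>R c) = l * norm (y - c)" using l(1) by (simp add: dist_norm)
    also have "\<dots> \<le> l * (2 * R)" using norm_triangle_ineq4[of y c] R[OF y] R[OF c_thin] l(1) by (intro mult_left_mono) auto
    also have "\<dots> \<le> (t / \<delta>1) * (2 * R)" using l(3) R0 by (intro mult_right_mono) auto
    finally show "dist y ((1 - l) *\<^sub>R y + l *\<^sub>R c) \<le> C * t" by (simp add: C_def mult.commute)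
  qed
  have main: "0 \<le> hausdorff_dist (pushed t) P \<and> hausdorff_dist (pushed t) P \<le> C * t \<and>
    0 \<le> hausdorff_dist (pushed (-t)) P \<and> hausdorff_dist (pushed (-t)) P \<le> C * t" if t: "0 < t" "t \<le> \<delta>1 / 2" for t
  proof -
    have t0: "t \<le> \<delta>0" and t1: "t < \<delta>1" using t \<delta>1 by simp_all
    note eq = pushed_eq_Un[OF t(1) t0]
    have th: "thin t \<subseteq> thin \<delta>0" using t0 by (auto simp: thin_def)
    have up: "upper t \<subseteq> thin \<delta>0" and lo: "lower t \<subseteq> thin \<delta>0" using slabs_measurable(3,4)[of t] t t0 th by auto
    have Ct: "C * t \<ge> 0" using C0 t(1) by simp
    have cP: "c \<in> pushed (-t)"
      using pushed_W[of "-t"] thin_W[of \<delta>0] c_thin cK t(1) t1 t0 unfolding poly_of_insert by fastforce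
    then have ne: "pushed (-t) \<noteq> {}" "P \<noteq> {}" "pushed t \<noteq> {}" using eq by auto
    have A: "\<exists>b\<in>P. dist y b \<le> C * t" if y: "y \<in> pushed t" for y
    proof (cases "y \<in> P")
      case True
      then show ?thesis using Ct by (intro bexI[of _ y]) auto
    next
      case False
      then have yu: "y \<in> upper t" using y eq(1) by blast
      \<comment> \<open>moves the height \<open>h + t\<close> to \<open>h\<close>\<close>
      define l where "l = t / (t + \<delta>1)"
      have l: "0 \<le> l" "l \<le> 1" "l \<le> t / \<delta>1" "l * (t + \<delta>1) = t"
        using t(1) \<delta>1(1) by (auto simp: l_def field_simps)
      obtain z where z: "z \<in> poly_of I" "n \<bullet> z = (1 - l) * (n \<bullet> y) + l * (h - \<delta>1)" "dist y z \<le> C * t"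
        using slide[OF _ l(1-3)] yu up by blast
      have yb: "h \<le> n \<bullet> y" "n \<bullet> y \<le> h + t" using yu by (auto simp: upper_def)
      have "(1 - l) * (n \<bullet> y) \<le> (1 - l) * (h + t)" using yb(2) l(2) by (intro mult_left_mono) auto
      then have 1: "n \<bullet> z \<le> h" unfolding z(2) using l(4) by (simp add: algebra_simps)
      have "(1 - l) * (n \<bullet> y) \<ge> (1 - l) * h" using yb(1) l(2) by (intro mult_left_mono) auto
      moreover have "l * \<delta>1 \<le> 1 * \<delta>1" using l(2) \<delta>1(1) by (intro mult_right_mono) auto
      ultimately have "n \<bullet> z \<ge> h - \<delta>1" unfolding z(2) by (simp add: algebra_simps)
      then have "z \<in> thin \<delta>0" using z(1) 1 \<delta>1(2) by (simp add: thin_def)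
      then have "z \<in> P" using mem_P thin_W[of \<delta>0] z(1) 1 by blast
      then show ?thesis using z(3) by blast
    qed
    have B: "\<exists>b\<in>pushed (-t). dist y b \<le> C * t" if y: "y \<in> P" for y
    proof (cases "y \<in> pushed (-t)")
      case True
      then show ?thesis using Ct by (intro bexI[of _ y]) auto
    next
      case False
      then have yl: "y \<in> lower t" using y eq(2) by blast
      \<comment> \<open>moves the height \<open>h\<close> to \<open>h - t\<close>\<close>
      define l where "l = t / \<delta>1"
      have l: "0 \<le> l" "l \<le> 1" "l \<le> t / \<delta>1" "l * \<delta>1 = t"
        using t(1) t1 \<delta>1(1) by (auto simp: l_def)
      obtain z where z: "z \<in> poly_of I" "n \<bullet> z = (1 - l) * (n \<bullet> y) + l * (h - \<delta>1)" "dist y z \<le> C * t"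
        using slide[OF _ l(1-3)] yl lo by blast
      have yb: "h - t \<le> n \<bullet> y" "n \<bullet> y \<le> h" using yl by (auto simp: lower_def)
      have "(1 - l) * (n \<bullet> y) \<le> (1 - l) * h" using yb(2) l(2) by (intro mult_left_mono) auto
      then have 1: "n \<bullet> z \<le> h - t" unfolding z(2) using l(4) by (simp add: algebra_simps)
      have "(1 - l) * (n \<bullet> y) \<ge> (1 - l) * (h - \<delta>1)" using yb(1) t1 l(2) by (intro mult_left_mono) auto
      then have "n \<bullet> z \<ge> h - \<delta>1" unfolding z(2) by (simp add: algebra_simps)
      then have "z \<in> thin \<delta>0" using z(1) 1 t(1) \<delta>1(2) by (simp add: thin_def)
      then have zW: "z \<in> W" using thin_W[of \<delta>0] by blast
      have "z \<in> poly_of (insert (n,h+(-t)) I)" using z(1) 1 unfolding poly_of_insert by auto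
      then have "z \<in> pushed (-t)" using pushed_W[of "-t"] zW t(1) t0 by auto
      then show ?thesis using z(3) by blast
    qed
    have A': "\<exists>b\<in>pushed t. dist y b \<le> C * t" if "y \<in> P" for y using that eq(1) Ct by (intro bexI[of _ y]) auto
    have B': "\<exists>b\<in>P. dist y b \<le> C * t" if "y \<in> pushed (-t)" for y using that eq(2) Ct by (intro bexI[of _ y]) auto
    show ?thesis
      using hausdorff_dist_bound[OF ne(3,2) A A'] hausdorff_dist_bound[OF ne(1,2) B' B] by blast
  qed
  show ?thesis using \<delta>1(1) main by (intro exI[of _ "\<delta>1/2"] conjI exI[of _ C]) auto
qed

section \<open>Decreasing the Melzak ratio\<close>

text \<open>If neither ratio were smaller, multiplying the two inequalities would give
\<open>E ^ 6 * (Vp * Vm) \<le> (Ep * Em) ^ 3 * V\<^sup>2\<close>.  But \<open>Vp * Vm\<close> is at least \<open>V\<^sup>2\<close> up to an error of order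
\<open>t\<^sup>2\<close>, and \<open>Ep * Em\<close> is at most the square of the mean \<open>E - c * t / 2\<close>.\<close>

lemma one_push_improves_ratio:
  fixes E V c C :: real
  assumes V: "V > 0" and c: "c > 0" and C: "C \<ge> 0"
  obtains \<epsilon> where "\<epsilon> > 0" "\<And>t Ep Em Vp Vm. 0 < t \<Longrightarrow> t \<le> \<epsilon> \<Longrightarrow> 0 \<le> Ep \<Longrightarrow> 0 \<le> Em \<Longrightarrow> Ep + Em \<le> 2 * E - c * t \<Longrightarrow>
    \<bar>Vp - V\<bar> \<le> C * t \<Longrightarrow> \<bar>Vm - V\<bar> \<le> C * t \<Longrightarrow> Vp + Vm \<ge> 2 * V - C * t\<^sup>2 \<Longrightarrow>
    Ep ^ 3 / Vp < E ^ 3 / V \<or> Em ^ 3 / Vm < E ^ 3 / V"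
proof -
  define K where "K = V * C + C\<^sup>2"
  have K: "K \<ge> 0" using V C by (simp add: K_def)
  \<comment> \<open>The second bound keeps the volumes \<open>Vp\<close> and \<open>Vm\<close> positive, the third one makes the loss
    \<open>c * t\<close> of edge length outweigh the error of order \<open>t\<^sup>2\<close> in the volumes.\<close>
  define \<epsilon> where "\<epsilon> = min (min 1 (V / (2 * (C + 1)))) (V\<^sup>2 * c / (4 * (\<bar>E\<bar> * K + 1)))"
  have EK: "\<bar>E\<bar> * K + 1 > 0" using K by (simp add: add_nonneg_pos)
  have \<epsilon>0: "\<epsilon> > 0" using V c C EK by (simp add: \<epsilon>_def)
  show ?thesis
  proof (rule that[OF \<epsilon>0], rule ccontr)
    fix t Ep Em Vp Vm :: real
    assume t: "0 < t" "t \<le> \<epsilon>" and Epos: "0 \<le> Ep" "0 \<le> Em" and Esum: "Ep + Em \<le> 2 * E - c * t"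
      and Vp: "\<bar>Vp - V\<bar> \<le> C * t" and Vm: "\<bar>Vm - V\<bar> \<le> C * t" and Vsum: "Vp + Vm \<ge> 2 * V - C * t\<^sup>2"
      and no: "\<not> (Ep ^ 3 / Vp < E ^ 3 / V \<or> Em ^ 3 / Vm < E ^ 3 / V)"
    have ct: "c * t > 0" using c t(1) by simp
    have E: "E > 0" "E - c * t / 2 \<ge> 0" using Esum Epos ct by linarith+
    have "t \<le> V / (2 * (C + 1))" using t(2) by (simp add: \<epsilon>_def)
    then have "t * (2 * (C + 1)) \<le> V" using C by (simp add: pos_le_divide_eq)
    then have tC: "2 * (C * t) + 2 * t \<le> V" by (simp add: algebra_simps)
    have t1: "t \<le> 1" using t(2) by (simp add: \<epsilon>_def)
    have pos: "Vp > 0" "Vm > 0" using Vp Vm tC t(1) V by (auto simp: abs_le_iff)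
    have p3: "Ep ^ 3 * V \<ge> E ^ 3 * Vp" using no pos(1) V by (simp add: not_less field_simps)
    have m3: "Em ^ 3 * V \<ge> E ^ 3 * Vm" using no pos(2) V by (simp add: not_less field_simps)
    have "(E ^ 3 * Vp) * (E ^ 3 * Vm) \<le> (Ep ^ 3 * V) * (Em ^ 3 * V)"
      by (rule mult_mono[OF p3 m3]) (use E(1) pos Epos V in auto)
    then have prod: "E ^ 6 * (Vp * Vm) \<le> (Ep * Em) ^ 3 * V\<^sup>2"
      by (simp add: power_mult_distrib algebra_simps power2_eq_square flip: power_add)
    define e where "e = E - c * t / 2"
    have "4 * (Ep * Em) \<le> (Ep + Em)\<^sup>2" using zero_le_power2[of "Ep - Em"] by (simp add: power2_eq_square algebra_simps)
    also have "\<dots> \<le> (2 * e)\<^sup>2" using Esum Epos by (intro power_mono) (auto simp: e_def)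
    finally have "Ep * Em \<le> e\<^sup>2" by (simp add: power2_eq_square)
    then have "(Ep * Em) ^ 3 \<le> (e\<^sup>2) ^ 3" using Epos by (intro power_mono) auto
    also have "(e\<^sup>2) ^ 3 = e ^ 5 * e" by (simp add: power2_eq_square power3_eq_cube power_numeral_reduce)
    also have "\<dots> \<le> E ^ 5 * e" using E(2) ct by (intro mult_right_mono power_mono) (auto simp: e_def)
    finally have upper: "(Ep * Em) ^ 3 \<le> E ^ 5 * e" .
    have VV: "Vp * Vm \<ge> V\<^sup>2 - K * t\<^sup>2"
    proof -
      define a where "a = Vp - V"
      define b where "b = Vm - V"
      have "\<bar>a * b\<bar> \<le> (C * t) * (C * t)" unfolding abs_mult using Vp Vm by (intro mult_mono) (auto simp: a_def b_def)
      then have "a * b \<ge> - (C\<^sup>2 * t\<^sup>2)" by (simp add: power2_eq_square abs_le_iff algebra_simps)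
      moreover have "a + b \<ge> - (C * t\<^sup>2)" using Vsum by (simp add: a_def b_def)
      then have "V * (a + b) \<ge> V * (- (C * t\<^sup>2))" using V by (intro mult_left_mono) auto
      moreover have "Vp * Vm = V\<^sup>2 + V * (a + b) + a * b" by (simp add: a_def b_def power2_eq_square algebra_simps)
      ultimately show ?thesis by (simp add: K_def algebra_simps)
    qed
    have "E ^ 6 * (V\<^sup>2 - K * t\<^sup>2) \<le> E ^ 6 * (Vp * Vm)" using VV E(1) by (intro mult_left_mono) auto
    also have "\<dots> \<le> (E ^ 5 * e) * V\<^sup>2" using prod mult_right_mono[OF upper, of "V\<^sup>2"] by simp
    finally have "E ^ 5 * (E * (V\<^sup>2 - K * t\<^sup>2)) \<le> E ^ 5 * (e * V\<^sup>2)"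
      by (simp add: power_numeral_reduce mult.assoc)
    then have "E * (V\<^sup>2 - K * t\<^sup>2) \<le> e * V\<^sup>2" using E(1) by simp
    then have "V\<^sup>2 * c / 2 * t \<le> (E * K * t) * t" by (simp add: e_def algebra_simps power2_eq_square)
    then have 1: "V\<^sup>2 * c / 2 \<le> E * K * t" using t(1) by simp
    have "t \<le> V\<^sup>2 * c / (4 * (\<bar>E\<bar> * K + 1))" using t(2) by (simp add: \<epsilon>_def)
    then have "t * (4 * (\<bar>E\<bar> * K + 1)) \<le> V\<^sup>2 * c" using EK by (simp add: pos_le_divide_eq)
    then have "4 * (E * K * t) + 4 * t \<le> V\<^sup>2 * c" using E(1) by (simp add: algebra_simps)
    moreover have "V\<^sup>2 * c > 0" using V c by simp
    ultimately show False using 1 t(1) by linarith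
  qed
qed

theorem theorem2p3:
  fixes P F :: "(real^3) set" and x :: "real^3"
  assumes "solid_polyhedron P"
    and "exposed_face P F"
    and "x \<in> vertices P" and "x \<in> F"
    and "vertex_degree P x > 3"
  shows "\<exists>\<epsilon> Q. is_perturbation P \<epsilon> Q \<and>
           (\<forall>\<^sub>F t in at_right 0. melzak_ratio (Q t) < melzak_ratio P)"
proof -
  obtain n h I p0 \<delta>0 W where slab: "facet_slab n h I p0 \<delta>0" and W: "open W" "poly_of I \<inter> {y. \<bar>n \<bullet> y - h\<bar> \<le> \<delta>0} \<subseteq> W"
    "P \<inter> W = poly_of (insert (n,h) I) \<inter> W" and F: "F = poly_of I \<inter> {y. n \<bullet> y = h}"
    using exposed_face_slab[OF assms(1,2)] by blast
  interpret pushed_face n h I p0 \<delta>0 P W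
    by (intro pushed_face.intro slab pushed_face_axioms.intro assms(1) W)
  have xK: "x \<in> poly_of I" "n \<bullet> x = h" using assms(4) F by auto
  then have "x \<in> W" using W(2) bdd(1) by auto
  then obtain i where i: "i \<in> I" "slice i 0 = {x}"
    using many_edges_imp_tip[OF W(1,3) _ xK assms(3,5)] by blast
  obtain \<delta>a c where ea: "\<delta>a > 0" "c > 0" "\<And>t. 0 < t \<Longrightarrow> t \<le> \<delta>a \<Longrightarrow>
      total_edge_length (pushed t) + total_edge_length (pushed (-t)) \<le> 2 * total_edge_length P - c * t"
    using edge_length_pushed[OF i] by blast
  obtain \<delta>b C where vb: "\<delta>b > 0" "C \<ge> 0" "\<And>t. 0 < t \<Longrightarrow> t \<le> \<delta>b \<Longrightarrow> solid_polyhedron (pushed t) \<and> solid_polyhedron (pushed (-t)) \<and>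
    \<bar>volume (pushed t) - volume P\<bar> \<le> C * t \<and> \<bar>volume (pushed (-t)) - volume P\<bar> \<le> C * t \<and>
    volume (pushed t) + volume (pushed (-t)) \<ge> 2 * volume P - C * t\<^sup>2"
    using volume_estimates by blast
  obtain \<delta>c B where hc: "\<delta>c > 0" "\<And>t. 0 < t \<Longrightarrow> t \<le> \<delta>c \<Longrightarrow>
    0 \<le> hausdorff_dist (pushed t) P \<and> hausdorff_dist (pushed t) P \<le> B * t \<and>
    0 \<le> hausdorff_dist (pushed (-t)) P \<and> hausdorff_dist (pushed (-t)) P \<le> B * t"
    using hausdorff_pushed by blast
  have V: "volume P > 0"
  proof -
    have "P \<in> lmeasurable" using compact_P lmeasurable_compact by blast
    moreover have "\<not> negligible P"
      using open_not_negligible[of "interior P"] negligible_subset[of P "interior P"] interior_subset assms(1)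
      by (auto simp: solid_polyhedron_def)
    ultimately have "measure lebesgue P \<noteq> 0" using negligible_iff_measure by blast
    then show ?thesis unfolding volume_def using measure_nonneg[of lebesgue P] by linarith
  qed
  obtain \<epsilon>0 where e0: "\<epsilon>0 > 0" "\<And>t Ep Em Vp Vm. 0 < t \<Longrightarrow> t \<le> \<epsilon>0 \<Longrightarrow> 0 \<le> Ep \<Longrightarrow> 0 \<le> Em \<Longrightarrow> Ep + Em \<le> 2 * total_edge_length P - c * t \<Longrightarrow>
    \<bar>Vp - volume P\<bar> \<le> C * t \<Longrightarrow> \<bar>Vm - volume P\<bar> \<le> C * t \<Longrightarrow> Vp + Vm \<ge> 2 * volume P - C * t\<^sup>2 \<Longrightarrow>
    Ep ^ 3 / Vp < total_edge_length P ^ 3 / volume P \<or> Em ^ 3 / Vm < total_edge_length P ^ 3 / volume P"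
    using one_push_improves_ratio[OF V ea(2) vb(2)] by blast
  define \<epsilon> where "\<epsilon> = min (min \<delta>a \<delta>b) (min \<delta>c \<epsilon>0)"
  have \<epsilon>: "\<epsilon> > 0" "\<epsilon> \<le> \<delta>a" "\<epsilon> \<le> \<delta>b" "\<epsilon> \<le> \<delta>c" "\<epsilon> \<le> \<epsilon>0" using ea(1) vb(1) hc(1) e0(1) by (auto simp: \<epsilon>_def)
  define Q where "Q t = (if t = 0 then P else if melzak_ratio (pushed t) < melzak_ratio P then pushed t else pushed (-t))" for t
  have better: "melzak_ratio (Q t) < melzak_ratio P" if t: "0 < t" "t \<le> \<epsilon>" for t
  proof -
    have te: "t \<le> \<delta>a" "t \<le> \<delta>b" "t \<le> \<epsilon>0" using t(2) \<epsilon> by auto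
    have v: "solid_polyhedron (pushed t)" "solid_polyhedron (pushed (-t))"
      "\<bar>volume (pushed t) - volume P\<bar> \<le> C * t" "\<bar>volume (pushed (-t)) - volume P\<bar> \<le> C * t"
      "volume (pushed t) + volume (pushed (-t)) \<ge> 2 * volume P - C * t\<^sup>2"
      using vb(3)[OF t(1) te(2)] by blast+
    have "melzak_ratio (pushed t) < melzak_ratio P \<or> melzak_ratio (pushed (-t)) < melzak_ratio P"
      unfolding melzak_ratio_def
      by (rule e0(2)[OF t(1) te(3) total_edge_length_nonneg[OF v(1)] total_edge_length_nonneg[OF v(2)] ea(3)[OF t(1) te(1)] v(3-5)])
    then show ?thesis using t(1) by (auto simp: Q_def)
  qed
  have ev: "eventually (\<lambda>t. 0 < t \<and> t \<le> \<epsilon>) (at_right (0::real))"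
    unfolding eventually_at_right_field using \<epsilon>(1) by (intro exI[of _ \<epsilon>]) auto
  have sol: "solid_polyhedron (Q t)" if "t \<in> {0..\<epsilon>}" for t
    using that vb(3)[of t] assms(1) \<epsilon> by (auto simp: Q_def)
  have H: "0 \<le> hausdorff_dist (Q t) P \<and> hausdorff_dist (Q t) P \<le> B * t" if "0 < t \<and> t \<le> \<epsilon>" for t
    using that hc(2)[of t] \<epsilon> by (auto simp: Q_def)
  have lim: "((\<lambda>t. hausdorff_dist (Q t) P) \<longlongrightarrow> 0) (at_right 0)"
  proof (rule tendsto_sandwich)
    show "\<forall>\<^sub>F t in at_right 0. 0 \<le> hausdorff_dist (Q t) P" using ev by (rule eventually_mono) (use H in blast)
    show "\<forall>\<^sub>F t in at_right 0. hausdorff_dist (Q t) P \<le> B * t" using ev by (rule eventually_mono) (use H in blast)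
    show "((\<lambda>t. B * t) \<longlongrightarrow> 0) (at_right 0)" by (intro tendsto_eq_intros) auto
  qed simp
  have "is_perturbation P \<epsilon> Q"
    unfolding is_perturbation_def using \<epsilon>(1) sol lim by (auto simp: Q_def)
  moreover have "\<forall>\<^sub>F t in at_right 0. melzak_ratio (Q t) < melzak_ratio P"
    using ev by (rule eventually_mono) (use better in blast)
  ultimately show ?thesis by blast
qed

end
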